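(* Let $n\ge2$ and $1\le p<n$. Assume $\varphi$ satisfies conditions (1)–(5) with $C_\varphi=1$ in (4), and that there exists $\alpha\in[1,\frac n{n-1})$ such that $t^\alpha/\varphi(t)$ is increasing for $t>0$. Let $D\subset\mathbb R^n$ be an unbounded domain such that (a) $D=\bigcup_{i=1}^\infty D_i$ with $|D_1|>0$; (b) $\overline{D_i}\subset D_{i+1}$ for each $i$; (c) each $D_i$ is a bounded $\varphi$-cigar John domain with the same constant $c_J$. Then there exists an $N$-function $H$ satisfying the $\Delta_2$-condition with $$H^{-1}(t)\approx\frac{t^{\frac1p-1}}{\psi(t^{-\frac1n})^{n-1}}\quad\text{for all }t>0,$$ and a constant $C$ such that $$\inf_{b\in\mathbb R}\|u-b\|_{L^H(D)}\le C\|\nabla u\|_{L^p(D)}$$ for every $u\in L^1_p(D)$.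
   Context: Conditions on $\varphi:[0,\infty)\to[0,\infty)$: (1) continuous; (2) strictly increasing; (3) $\varphi(0)=\lim_{t\to0^+}\varphi(t)=0$; (4) there is $C_\varphi\ge1$ with $\varphi(t_1)/t_1\le C_\varphi\varphi(t_2)/t_2$ whenever $0<t_1\le t_2$; (5) there is $C^{\Delta_2}_\varphi\ge1$ with $\varphi(2t)\le C^{\Delta_2}_\varphi\varphi(t)$ for all $t>0$. $\psi(t)=\varphi(t)$ for $0\le t\le1$, $\psi(t)=\varphi(1)t$ for $t\ge1$. A domain $D\subset\mathbb R^n$ is a $\varphi$-cigar John domain with constant $c_J>0$ if every pair $a,b\in D$ can be joined by a rectifiable arc $E\subset D$ with endpoints $a,b$ such that $\bigcup\{B(x,\psi(q(x))/c_J):x\in E\setminus\{a,b\}\}\subset D$, where $q(x)=\min\{\ell(E[a,x]),\ell(E[x,b])\}$, $E[x,y]$ the subarc between $x,y$ and $\ell$ length. An $N$-function is a continuous convex $H:[0,\infty)\to[0,\infty)$ with $H(t)/t\to0$ as $t\to0^+$ and $H(t)/t\to\infty$ as $t\to\infty$; $\Delta_2$-condition: $H(2t)\le C^{\Delta_2}_HH(t)$ for all $t>0$. $\approx$ means two-sided bounds with positive constants. $L^H(D)$ is the Orlicz space with Luxemburg norm $\|u\|_{L^H(D)}=\inf\{\lambda>0:\int_DH(|u(x)|/\lambda)\,dx\le1\}$. $L^1_p(D)=\{u\in L^1_{loc}(D):|\nabla u|\in L^p(D)\}$. *)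

theory Defs
  imports "HOL-Analysis.Analysis"
begin

definition psi :: "(real \<Rightarrow> real) \<Rightarrow> real \<Rightarrow> real" where
  "psi \<phi> t = (if t \<le> 1 then \<phi> t else \<phi> 1 * t)"

text \<open>Conditions (1)-(5) on phi, with constant C_phi = 1 in (4).\<close>
definition phi_cond1 :: "(real \<Rightarrow> real) \<Rightarrow> bool" where
  "phi_cond1 \<phi> \<longleftrightarrow>
     (\<forall>t\<ge>0. \<phi> t \<ge> 0) \<and>
     continuous_on {0..} \<phi> \<and>
     strict_mono_on {0..} \<phi> \<and>
     \<phi> 0 = 0 \<and> (\<phi> \<longlongrightarrow> 0) (at_right 0) \<and>
     (\<forall>t1 t2. 0 < t1 \<and> t1 \<le> t2 \<longrightarrow> \<phi> t1 / t1 \<le> \<phi> t2 / t2) \<and>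
     (\<exists>C\<ge>1. \<forall>t>0. \<phi> (2 * t) \<le> C * \<phi> t)"

definition curve_length :: "(real \<Rightarrow> 'a::metric_space) \<Rightarrow> real \<Rightarrow> real \<Rightarrow> ennreal" where
  "curve_length \<gamma> a b =
     (SUP ts \<in> {ts. sorted ts \<and> set ts \<subseteq> {a..b}}.
        ennreal (\<Sum>i<length ts - 1. dist (\<gamma> (ts ! i)) (\<gamma> (ts ! Suc i))))"

text \<open>phi-cigar John domain with constant cJ (the domain property, open and connected,
  is imposed separately).\<close>
definition cigar_john :: "(real \<Rightarrow> real) \<Rightarrow> real \<Rightarrow> 'a::euclidean_space set \<Rightarrow> bool" where
  "cigar_john \<phi> cJ D \<longleftrightarrow> cJ > 0 \<and>
     (\<forall>a\<in>D. \<forall>b\<in>D. a \<noteq> b \<longrightarrow>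
        (\<exists>\<gamma>. arc \<gamma> \<and> pathstart \<gamma> = a \<and> pathfinish \<gamma> = b \<and> path_image \<gamma> \<subseteq> D \<and>
             curve_length \<gamma> 0 1 < \<infinity> \<and>
             (\<forall>t\<in>{0<..<1}.
                ball (\<gamma> t) (psi \<phi> (enn2real (min (curve_length \<gamma> 0 t) (curve_length \<gamma> t 1))) / cJ)
                  \<subseteq> D)))"

definition N_function :: "(real \<Rightarrow> real) \<Rightarrow> bool" where
  "N_function H \<longleftrightarrow> continuous_on {0..} H \<and> convex_on {0..} H \<and> (\<forall>t\<ge>0. H t \<ge> 0) \<and>
     ((\<lambda>t. H t / t) \<longlongrightarrow> 0) (at_right 0) \<and> filterlim (\<lambda>t. H t / t) at_top at_top"

definition Delta2 :: "(real \<Rightarrow> real) \<Rightarrow> bool" where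
  "Delta2 H \<longleftrightarrow> (\<exists>C. \<forall>t>0. H (2 * t) \<le> C * H t)"

text \<open>Luxemburg norm (value \<infinity> if the defining set is empty).\<close>
definition luxemburg_norm :: "(real \<Rightarrow> real) \<Rightarrow> 'a::euclidean_space set \<Rightarrow> ('a \<Rightarrow> real) \<Rightarrow> ennreal" where
  "luxemburg_norm H D v =
     Inf {ennreal l | l. l > 0 \<and> (\<integral>\<^sup>+ x\<in>D. ennreal (H (\<bar>v x\<bar> / l)) \<partial>lebesgue) \<le> 1}"

coinductive smooth_fun :: "('a::euclidean_space \<Rightarrow> real) \<Rightarrow> bool" where
  "(\<forall>x. f differentiable (at x)) \<Longrightarrow>
   (\<forall>i\<in>Basis. smooth_fun (\<lambda>x. frechet_derivative f (at x) i)) \<Longrightarrow> smooth_fun f"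

definition test_fun :: "'a::euclidean_space set \<Rightarrow> ('a \<Rightarrow> real) \<Rightarrow> bool" where
  "test_fun D f \<longleftrightarrow> smooth_fun f \<and> compact (closure {x. f x \<noteq> 0}) \<and> closure {x. f x \<noteq> 0} \<subseteq> D"

definition locally_integrable :: "'a::euclidean_space set \<Rightarrow> ('a \<Rightarrow> real) \<Rightarrow> bool" where
  "locally_integrable D u \<longleftrightarrow> (\<forall>K. compact K \<and> K \<subseteq> D \<longrightarrow> set_integrable lebesgue K u)"

definition weak_gradient :: "'a::euclidean_space set \<Rightarrow> ('a \<Rightarrow> real) \<Rightarrow> ('a \<Rightarrow> 'a) \<Rightarrow> bool" where
  "weak_gradient D u g \<longleftrightarrow> locally_integrable D u \<and> locally_integrable D (\<lambda>x. norm (g x)) \<and>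
     g \<in> borel_measurable lebesgue \<and>
     (\<forall>f i. test_fun D f \<and> i \<in> Basis \<longrightarrow>
        (LINT x:D|lebesgue. u x * frechet_derivative f (at x) i) =
        - (LINT x:D|lebesgue. (g x \<bullet> i) * f x))"

definition sobolev_L1p :: "real \<Rightarrow> 'a::euclidean_space set \<Rightarrow> ('a \<Rightarrow> real) \<Rightarrow> ('a \<Rightarrow> 'a) \<Rightarrow> bool" where
  "sobolev_L1p p D u g \<longleftrightarrow> u \<in> borel_measurable lebesgue \<and> weak_gradient D u g \<and>
     set_integrable lebesgue D (\<lambda>x. norm (g x) powr p)"

definition Lp_norm_grad :: "real \<Rightarrow> 'a::euclidean_space set \<Rightarrow> ('a \<Rightarrow> 'a) \<Rightarrow> real" where
  "Lp_norm_grad p D g = (LINT x:D|lebesgue. norm (g x) powr p) powr (1 / p)"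

end

(*
  Idea.  For a C^1 function f on a cigar John domain U, shrinking balls along the cigar from x to
  y and comparing consecutive averages gives
    |f x - f y| <= C (sum over dyadic s of a_s(x) + a_s(y)),
    a_s(x) = psi(s)^(1-n) * integral of |grad f| over U Int ball x (K s),
  with constants that depend on psi and c_J only; no centre of U is needed.  Scales s > R are
  summed by the trivial bound on a_s, scales s < R by Chebyshev and Fubini; optimising R yields
  a weak-type estimate for f minus its median, with the inverse of
  F(t) = t^(1/p-1) / psi(t^(-1/n))^(n-1) as gauge, and Maz'ya's truncation makes it strong,
  for all p >= 1 and without a maximal function.  As the constant is the same for every D_i, the
  general case follows by mollification and a Fatou argument on u - b_i.
*)
theory Submission
  imports Defs
begin

section \<open>The growth function and its Young function\<close>


text \<open>At scale s a cigar contains balls of radius comparable to \<psi>(s) only, possibly far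
  smaller than s, while the piece of arc to be covered can have length of order s. Charging s /
  \<psi>(s) balls one by one would cost the factor s / \<psi>(s)^n. A shortest chain through points
  of the arc has balls of bounded overlap, so the whole piece costs \<psi>(s)^(1-n). Hoelder's
  inequality then bounds a_s by a multiple of F(s^(-n)) times the L^p norm of the gradient, which is
  where \<open>F\<close> comes from. The hypotheses on \<phi> enter as power scaling for c \<ge> 1:
  \<psi>(t)/t increasing and p < n give F(c t) \<ge> c^\<open>\<kappa>\<close> F(t) with
  \<open>\<kappa>\<close> > 0, which sums the large scales; \<alpha> < n/(n-1) gives F(c t) \<le>
  c^\<open>\<beta>\<close> F(t) with \<open>\<beta>\<close> < 1/p, which sums the small ones. Hence
  the inverse \<open>G\<close> of \<open>F\<close> gains at least the factor c^p under scaling by c;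
  this is what makes the weak estimate linear in the energy of a layer, so that layers can be added.
  As \<open>G\<close> need not be convex, the Young function is the integral of G(r)/r, which is
  comparable to \<open>G\<close>.\<close>

locale orlicz_growth =
  fixes \<psi> :: "real \<Rightarrow> real" and \<alpha> p \<Lambda> :: real and n :: nat
  assumes n2: "2 \<le> n" and p1: "1 \<le> p" and pn: "p < real n"
    and a1: "1 \<le> \<alpha>" and an: "\<alpha> * (real n - 1) < real n"
    and pos: "\<And>s. 0 < s \<Longrightarrow> 0 < \<psi> s"
    and cont: "continuous_on {0<..} \<psi>"
    and upper: "\<And>c s. 0 < c \<Longrightarrow> c \<le> 1 \<Longrightarrow> 0 < s \<Longrightarrow> \<psi> (c * s) \<le> c * \<psi> s"
    and lower: "\<And>c s. 0 < c \<Longrightarrow> c \<le> 1 \<Longrightarrow> 0 < s \<Longrightarrow> c powr \<alpha> * \<psi> s \<le> \<psi> (c * s)"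
    and lin: "\<And>s. 0 < s \<Longrightarrow> \<psi> s \<le> \<Lambda> * s"
begin

text \<open>The lower and upper growth exponents of \<open>F\<close>, obtained from the exponents 1
  and \<alpha> of \<open>\<psi>\<close> through s = t^(-1/n). Positivity of \<open>\<kappa>\<close>
  is p < n; \<open>\<beta>\<close> < 1/p is \<alpha> (n - 1) < n.\<close>

definition \<kappa> :: real where "\<kappa> = 1 / p - 1 / real n"
definition \<beta> :: real where "\<beta> = 1 / p - 1 + \<alpha> * (real n - 1) / real n"
definition F :: "real \<Rightarrow> real"
  where "F t = t powr (1 / p - 1) / \<psi> (t powr (- 1 / real n)) ^ (n - 1)"

lemma kappa_pos: "0 < \<kappa>"
  using p1 pn n2 by (simp add: \<kappa>_def field_simps)

lemma beta_less: "\<beta> < 1 / p"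
  using n2 an by (simp add: \<beta>_def field_simps)

lemma kappa_le_beta: "\<kappa> \<le> \<beta>"
proof -
  have "real n - 1 \<le> \<alpha> * (real n - 1)" using a1 n2 by simp
  then have "(real n - 1) / real n \<le> \<alpha> * (real n - 1) / real n" 
    by (simp add: divide_right_mono)
  moreover have "(real n - 1) / real n = 1 - 1 / real n" using n2 by (simp add: field_simps)
  ultimately show ?thesis unfolding \<kappa>_def \<beta>_def by linarith
qed

lemma beta_pos: "0 < \<beta>"
  using kappa_pos kappa_le_beta by linarith

lemma F_pos: "0 < t \<Longrightarrow> 0 < F t"
  unfolding F_def using pos[of "t powr (- 1 / real n)"] by simp

lemma psi_mono: assumes "0 < s" "s \<le> t" shows "\<psi> s \<le> \<psi> t"
proof -
  have "\<psi> (s / t * t) \<le> s / t * \<psi> t"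
    using upper[of "s/t" t] assms by simp
  also have "\<dots> \<le> 1 * \<psi> t"
    using assms pos[of t] by (intro mult_right_mono) (auto simp: less_imp_le)
  finally show ?thesis using assms by simp
qed

lemma psi_scale_le: assumes "1 \<le> c" "0 < s" shows "\<psi> (c * s) \<le> c powr \<alpha> * \<psi> s"
proof -
  have "(1/c) powr \<alpha> * \<psi> (c * s) \<le> \<psi> (1/c * (c * s))"
    using lower[of "1/c" "c * s"] assms by simp
  then show ?thesis using assms by (simp add: powr_divide field_simps)
qed

text \<open>Multiplying t by c shrinks the radius t^(-1/n) by c^(-1/n), so by \<open>upper\<close>
  the denominator drops at least by the factor c^(-(n-1)/n). Combined with c^(1/p - 1) from the
  numerator this leaves the exponent \<open>\<kappa>\<close>.\<close>

lemma F_scale_ge: assumes "1 \<le> c" "0 < t" shows "c powr \<kappa> * F t \<le> F (c * t)"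
proof -
  define r where "r = t powr (- 1 / real n)"
  define d where "d = c powr (- 1 / real n)"
  have r: "0 < r" and d: "0 < d" "d \<le> 1" using assms n2 powr_mono[of "- 1 / real n" 0 c] by (auto simp: r_def d_def)
  have eq: "(c * t) powr (- 1 / real n) = d * r" using assms by (simp add: powr_mult r_def d_def)
  have "\<psi> (d * r) ^ (n - 1) \<le> (d * \<psi> r) ^ (n - 1)"
    using upper[OF d r] pos[of "d * r"] r d by (intro power_mono) (auto simp: less_imp_le)
  also have "\<dots> = c powr (- (real n - 1) / real n) * \<psi> r ^ (n - 1)"
  proof -
    have "d ^ (n - 1) = c powr (real (n - 1) * (- 1 / real n))"
      using assms by (simp only: d_def powr_power)
    also have "real (n - 1) * (- 1 / real n) = - (real n - 1) / real n" using n2 by (simp add: of_nat_diff field_simps)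
    finally show ?thesis by (simp only: power_mult_distrib)
  qed
  finally have *: "\<psi> (d * r) ^ (n - 1) \<le> c powr (- (real n - 1) / real n) * \<psi> r ^ (n - 1)" .
  have "1/p - 1 - (- (real n - 1) / real n) = \<kappa>" using n2 by (simp add: \<kappa>_def field_simps)
  then have k: "c powr \<kappa> = c powr (1/p - 1) / c powr (- (real n - 1) / real n)"
    by (simp flip: powr_diff)
  have "c powr \<kappa> * F t = (c * t) powr (1/p - 1) / (c powr (- (real n - 1) / real n) * \<psi> r ^ (n - 1))"
    unfolding F_def r_def[symmetric] k using assms by (simp only: powr_mult times_divide_times_eq)
  also have "\<dots> \<le> (c * t) powr (1/p - 1) / \<psi> (d * r) ^ (n - 1)"
    using * pos[of "d * r"] pos[of r] r d assms by (intro divide_left_mono mult_pos_pos) auto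
  also have "\<dots> = F (c * t)" unfolding F_def eq ..
  finally show ?thesis .
qed

text \<open>The mirror image, with \<open>lower\<close> bounding how far the denominator can drop:
  by no more than the factor c^(-\<alpha>(n-1)/n).\<close>

lemma F_scale_le: assumes "1 \<le> c" "0 < t" shows "F (c * t) \<le> c powr \<beta> * F t"
proof -
  define r where "r = t powr (- 1 / real n)"
  define d where "d = c powr (- 1 / real n)"
  have r: "0 < r" and d: "0 < d" "d \<le> 1" using assms n2 powr_mono[of "- 1 / real n" 0 c] by (auto simp: r_def d_def)
  have eq: "(c * t) powr (- 1 / real n) = d * r" using assms by (simp add: powr_mult r_def d_def)
  have "c powr (- \<alpha> * (real n - 1) / real n) * \<psi> r ^ (n - 1) = (d powr \<alpha> * \<psi> r) ^ (n - 1)"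
  proof -
    have "(d powr \<alpha>) ^ (n - 1) = c powr (real (n - 1) * (- 1 / real n * \<alpha>))"
      using assms by (simp only: d_def powr_power powr_powr)
    also have "real (n - 1) * (- 1 / real n * \<alpha>) = - \<alpha> * (real n - 1) / real n" using n2 by (simp add: of_nat_diff)
    finally show ?thesis by (simp only: power_mult_distrib)
  qed
  also have "\<dots> \<le> \<psi> (d * r) ^ (n - 1)"
    using lower[OF d r] pos[of r] r d by (intro power_mono) (auto simp: less_imp_le)
  finally have *: "c powr (- \<alpha> * (real n - 1) / real n) * \<psi> r ^ (n - 1) \<le> \<psi> (d * r) ^ (n - 1)" .
  have k: "c powr \<beta> = c powr (1/p - 1) / c powr (- \<alpha> * (real n - 1) / real n)"
    by (simp add: \<beta>_def flip: powr_diff)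
  have "F (c * t) = (c * t) powr (1/p - 1) / \<psi> (d * r) ^ (n - 1)" unfolding F_def eq ..
  also have "\<dots> \<le> (c * t) powr (1/p - 1) / (c powr (- \<alpha> * (real n - 1) / real n) * \<psi> r ^ (n - 1))"
    using * pos[of "d * r"] assms r d by (intro divide_left_mono) (auto simp: pos)
  also have "\<dots> = c powr \<beta> * F t"
    unfolding F_def r_def[symmetric] k using assms by (simp only: powr_mult times_divide_times_eq)
  finally show ?thesis .
qed

lemma F_strict_mono: assumes "0 < s" "s < t" shows "F s < F t"
proof -
  have "1 < (t / s) powr \<kappa>" using assms kappa_pos by simp
  then have "F s < (t / s) powr \<kappa> * F s" using F_pos[OF assms(1)] by simp
  also have "\<dots> \<le> F (t / s * s)" using assms by (intro F_scale_ge) auto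
  finally show ?thesis using assms by simp
qed

lemma F_le_iff: "0 < s \<Longrightarrow> 0 < t \<Longrightarrow> F s \<le> F t \<longleftrightarrow> s \<le> t"
  using F_strict_mono[of s t] F_strict_mono[of t s] by (cases s t rule: linorder_cases) auto

lemma F_continuous: "continuous_on {0<..} F"
proof -
  have "continuous_on {0<..} (\<lambda>t. \<psi> (t powr (- 1 / real n)))"
    by (intro continuous_on_compose2[OF cont] continuous_intros) auto
  moreover have "\<psi> (t powr (- 1 / real n)) ^ (n - 1) \<noteq> 0" if "t \<in> {0<..}" for t
    using pos[of "t powr (- 1 / real n)"] that by simp
  ultimately show ?thesis unfolding F_def by (intro continuous_intros) auto
qed

lemma F_surj: assumes "0 < y" shows "\<exists>t>0. F t = y"
proof -
  \<comment> \<open>With c^\<open>\<kappa>\<close> = M the scaling inequality forces F(1/c) \<le> y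
    \<le> F(c), so the intermediate value theorem applies on [1/c, c].\<close>
  define M where "M = max 1 (max (F 1 / y) (y / F 1))"
  define c where "c = M powr (1 / \<kappa>)"
  have f1: "F 1 > 0" by (rule F_pos) simp
  have M: "1 \<le> M" "F 1 \<le> M * y" "y \<le> M * F 1" 
  proof -
    have "F 1 / y \<le> M" "y / F 1 \<le> M" by (auto simp: M_def)
    then show "F 1 \<le> M * y" "y \<le> M * F 1" using assms f1 by (simp_all add: field_simps)
  qed (simp add: M_def)
  have c: "1 \<le> c" "c powr \<kappa> = M" using M kappa_pos by (auto simp: c_def powr_powr ge_one_powr_ge_zero)
  have "M * F (1 / c) \<le> F 1" using F_scale_ge[of c "1/c"] c by simp
  also have "\<dots> \<le> M * y" by (rule M)
  finally have lo: "F (1 / c) \<le> y" using M by simp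
  have hi: "y \<le> F c" using F_scale_ge[of c 1] c M by simp
  have "1 / c \<le> c" using c mult_mono[of 1 c 1 c] by (simp add: field_simps)
  moreover have "continuous_on {1/c..c} F"
    using c by (intro continuous_on_subset[OF F_continuous]) (auto intro: less_le_trans[of 0 "1/c"])
  ultimately obtain t where "1/c \<le> t" "F t = y" using IVT'[of F "1/c" y c] lo hi by auto
  moreover have "0 < 1/c" using c by simp
  ultimately show ?thesis by (intro exI[of _ t] conjI) (blast intro: less_le_trans)+
qed

section \<open>The inverse of \<open>F\<close> and its growth\<close>

definition G :: "real \<Rightarrow> real" where "G s = (if 0 < s then inv_into {0<..} F s else 0)"

lemma F_bij: "inj_on F {0<..}" "F ` {0<..} = {0<..}"
proof -
  show "inj_on F {0<..}" by (rule inj_onI) (metis F_le_iff greaterThan_iff order.antisym order.refl)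
  show "F ` {0<..} = {0<..}" 
  proof
    show "F ` {0<..} \<subseteq> {0<..}" using F_pos by auto
    show "{0<..} \<subseteq> F ` {0<..}" using F_surj by (metis greaterThan_iff imageI subsetI)
  qed
qed

lemma G_pos: "0 < s \<Longrightarrow> 0 < G s" and F_G: "0 < s \<Longrightarrow> F (G s) = s" and G_F: "0 < t \<Longrightarrow> G (F t) = t"
  using inv_into_into[of s F "{0<..}"] f_inv_into_f[of s F "{0<..}"] inv_into_f_f[OF F_bij(1), of t] F_bij F_pos
  by (auto simp: G_def)

lemma G_nonneg: "0 \<le> G s" using G_pos[of s] by (cases "0 < s") (auto simp: G_def)

lemma G_le_iff: assumes "0 < s" "0 < t" shows "G s \<le> t \<longleftrightarrow> s \<le> F t"
  using F_le_iff[of "G s" t] assms G_pos F_G by simp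

lemma le_G_iff: assumes "0 < s" "0 < t" shows "t \<le> G s \<longleftrightarrow> F t \<le> s"
  using F_le_iff[of t "G s"] assms G_pos F_G by simp

lemma G_mono: assumes "s \<le> t" shows "G s \<le> G t"
proof (cases "0 < s")
  case True then show ?thesis using assms G_le_iff[of s "G t"] G_pos[of t] F_G[of t] by simp
qed (use G_nonneg[of t] in \<open>simp add: G_def[of s]\<close>)

lemma G_scale_ge: assumes "1 \<le> c" "0 < s" shows "c powr (1 / \<beta>) * G s \<le> G (c * s)"
proof -
  have "F (c powr (1 / \<beta>) * G s) \<le> (c powr (1 / \<beta>)) powr \<beta> * F (G s)"
    using assms beta_pos by (intro F_scale_le) (auto simp: G_pos ge_one_powr_ge_zero)
  also have "\<dots> = c * s" using assms beta_pos by (simp add: powr_powr F_G)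
  finally show ?thesis using assms le_G_iff[of "c * s" "c powr (1 / \<beta>) * G s"] G_pos[of s] by simp
qed

lemma G_scale_le: assumes "1 \<le> c" "0 < s" shows "G (c * s) \<le> c powr (1 / \<kappa>) * G s"
proof -
  have "c * s = (c powr (1 / \<kappa>)) powr \<kappa> * F (G s)" using assms kappa_pos by (simp add: powr_powr F_G)
  also have "\<dots> \<le> F (c powr (1 / \<kappa>) * G s)"
    using assms kappa_pos by (intro F_scale_ge) (auto simp: G_pos ge_one_powr_ge_zero)
  finally show ?thesis using assms G_le_iff[of "c * s" "c powr (1 / \<kappa>) * G s"] G_pos[of s] by simp
qed

lemma beta_inv: "p < 1 / \<beta>" "1 < 1 / \<beta>"
proof -
  show "p < 1 / \<beta>" using beta_less beta_pos p1 by (simp add: field_simps)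
  then show "1 < 1 / \<beta>" using p1 by linarith
qed

text \<open>Since 1/\<open>\<beta>\<close> > p, the growth of \<open>G\<close> beats the power p.
  This is the form in which \<alpha> < n/(n-1) enters the truncation argument. For s \<le> 0 it
  holds because \<open>G\<close> is 0 there.\<close>

lemma G_scale_ge': assumes "1 \<le> c" shows "c powr p * G s \<le> G (c * s)"
proof (cases "0 < s")
  case True
  have "c powr p \<le> c powr (1/\<beta>)" using beta_inv assms by (intro powr_mono) auto
  then have "c powr p * G s \<le> c powr (1/\<beta>) * G s" using G_nonneg by (intro mult_right_mono)
  also have "\<dots> \<le> G (c * s)" using G_scale_ge[OF assms True] .
  finally show ?thesis .
qed (use G_nonneg[of "c * s"] in \<open>simp add: G_def[of s]\<close>)

text \<open>Superlinear scaling, 1/\<open>\<beta>\<close> > 1, gives a monotone quotient. It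
  substitutes for convexity of \<open>G\<close> and is exactly what makes the integral of the
  quotient convex.\<close>

lemma G_over_mono: assumes "0 < s" "s \<le> t" shows "G s / s \<le> G t / t"
proof -
  have "(t / s) * G s \<le> (t/s) powr (1/\<beta>) * G s"
    using G_nonneg assms beta_inv powr_mono[of 1 "1/\<beta>" "t/s"] by (intro mult_right_mono) auto
  also have "\<dots> \<le> G (t / s * s)" using assms by (intro G_scale_ge) auto
  finally show ?thesis using assms by (simp add: field_simps)
qed

lemma G_continuous: "continuous_on {0<..} G"
proof -
  have "continuous_on (F ` {0<..}) G"
    by (rule continuous_on_inverse_open[OF _ F_continuous]) (auto simp: G_F)
  then show ?thesis using F_bij by simp
qed

lemma G_over_tendsto_0: "((\<lambda>r. G r / r) \<longlongrightarrow> 0) (at_right 0)"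
proof (rule tendsto_sandwich[of "\<lambda>_. 0" _ _ "\<lambda>r. r powr (1/\<beta> - 1) * G 1"])
  have "eventually (\<lambda>r::real. r < 1) (at_right 0)" "eventually (\<lambda>r::real. 0 < r) (at_right 0)" 
    by (auto simp: eventually_at_right_less intro: eventually_at_right_real eventually_at_rightI[of 0 1])
  then show "\<forall>\<^sub>F r in at_right 0. G r / r \<le> r powr (1/\<beta> - 1) * G 1"
  proof eventually_elim
    fix r :: real assume r: "r < 1" "0 < r"
    then have "(1/r) powr (1/\<beta>) * G r \<le> G 1" using G_scale_ge[of "1/r" r] by simp
    then have "G r \<le> r powr (1/\<beta>) * G 1" using r by (simp add: powr_divide field_simps)
    then show "G r / r \<le> r powr (1/\<beta> - 1) * G 1" using r by (simp add: powr_diff divide_right_mono)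
  qed
  show "\<forall>\<^sub>F r in at_right 0. 0 \<le> G r / r"
    by (auto simp: G_nonneg eventually_at_right_less intro!: eventually_at_rightI[of 0 1])
  have "((\<lambda>r::real. r powr (1/\<beta> - 1)) \<longlongrightarrow> 0) (at_right 0)"
    using beta_inv by (intro tendsto_zero_powrI[OF tendsto_ident_at tendsto_const] eventually_at_rightI[of 0 1]) auto
  then show "((\<lambda>r. r powr (1/\<beta> - 1) * G 1) \<longlongrightarrow> 0) (at_right 0)"
    using tendsto_mult_right[of _ 0 "at_right 0" "G 1"] by simp
qed auto

text \<open>At 0 the default value of \<open>G\<close> and division by zero give the value 0, which
  is also the limit from the right because 1/\<open>\<beta>\<close> > 1. So the integrand of
  \<open>H\<close> is continuous on the closed half-line.\<close>

lemma G_over_continuous: "continuous_on {0..} (\<lambda>r. G r / r)"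
  unfolding continuous_on_def
proof
  fix x :: real assume x: "x \<in> {0..}"
  show "((\<lambda>r. G r / r) \<longlongrightarrow> G x / x) (at x within {0..})"
  proof (cases "x = 0")
    case True then show ?thesis using G_over_tendsto_0 
      by (simp add: at_within_Ici_at_right)
  next
    case False
    then have "x > 0" using x by simp
    have "continuous_on {0<..} (\<lambda>r. G r / r)" by (intro continuous_intros G_continuous) auto
    then have "isCont (\<lambda>r. G r / r) x" using \<open>x > 0\<close> by (auto simp: continuous_on_eq_continuous_at)
    then show ?thesis by (auto simp: isCont_def intro: tendsto_within_subset)
  qed
qed

section \<open>The Young function\<close>

definition H :: "real \<Rightarrow> real" where "H s = integral {0..s} (\<lambda>r. G r / r)"

lemma G_over_mono': assumes "0 \<le> s" "s \<le> t" shows "G s / s \<le> G t / t"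
  using G_over_mono[of s t] assms G_nonneg[of t] by (cases "s = 0") auto

text \<open>The integrand is increasing, so on [s, t] it lies between its end values. The two bounds
  act as subgradient inequalities; convexity, strict growth and the comparison of \<open>H\<close>
  with \<open>G\<close> all come from them.\<close>

lemma H_diff: assumes "0 \<le> s" "s \<le> t"
  shows "(t - s) * (G s / s) \<le> H t - H s" "H t - H s \<le> (t - s) * (G t / t)"
proof -
  have I: "(\<lambda>r. G r / r) integrable_on {a..b}" if "0 \<le> a" for a b
    using that by (intro integrable_continuous_interval continuous_on_subset[OF G_over_continuous]) auto
  have "H t - H s = integral {s..t} (\<lambda>r. G r / r)"
    using Henstock_Kurzweil_Integration.integral_combine[of 0 s t "\<lambda>r. G r / r"] I[of 0 t] assms by (simp add: H_def)
  moreover have "integral {s..t} (\<lambda>r. G s / s) \<le> integral {s..t} (\<lambda>r. G r / r)"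
    using assms by (intro integral_le I) (auto intro!: G_over_mono' integrable_const_ivl)
  moreover have "integral {s..t} (\<lambda>r. G r / r) \<le> integral {s..t} (\<lambda>r. G t / t)"
    using assms by (intro integral_le I) (auto intro!: G_over_mono' integrable_const_ivl)
  ultimately show "(t - s) * (G s / s) \<le> H t - H s" "H t - H s \<le> (t - s) * (G t / t)"
    using assms by simp_all
qed

lemma H_0: "H 0 = 0" by (simp add: H_def)

lemma H_le_G: assumes "0 \<le> s" shows "H s \<le> G s"
  using H_diff(2)[of 0 s] assms G_nonneg[of s] by (cases "s = 0") (auto simp: H_0)

lemma H_nonneg: assumes "0 \<le> s" shows "0 \<le> H s"
  using H_diff(1)[of 0 s] assms by (simp add: H_0)

text \<open>Only the upper half of [0, s] is used, where the integrand is at least G(s/2)/(s/2).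
  Together with \<open>H_le_G\<close> this makes \<open>H\<close> and \<open>G\<close>
  interchangeable up to a factor 2 in the argument.\<close>

lemma G_half_le_H: assumes "0 \<le> s" shows "G (s / 2) \<le> H s"
  using H_diff(1)[of "s / 2" s] H_nonneg[of "s/2"] assms H_nonneg[of s] by (cases "s = 0") (auto simp: G_def[of 0])

lemma H_strict_mono: assumes "0 \<le> s" "s < t" shows "H s < H t"
proof -
  define m where "m = (s + t) / 2"
  have m: "s < m" "m < t" "0 < m" using assms by (auto simp: m_def)
  have "0 \<le> (m - s) * (G s / s)" using m assms G_nonneg[of s] by simp
  then have "H s \<le> H m" using H_diff(1)[of s m] m assms by linarith
  moreover have "0 < (t - m) * (G m / m)" using m G_pos[of m] by simp
  then have "H m < H t" using H_diff(1)[of m t] m by linarith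
  ultimately show ?thesis by simp
qed

lemma H_continuous: "continuous_on {0..} H"
  unfolding continuous_on_eq_continuous_within
proof
  fix x :: real assume x: "x \<in> {0..}"
  have "continuous_on {0..x+1} H"
    unfolding H_def by (intro indefinite_integral_continuous_1 integrable_continuous_interval continuous_on_subset[OF G_over_continuous]) auto
  then have "continuous (at x within {0..x+1}) H" using x by (auto simp: continuous_on_eq_continuous_within)
  moreover have "at x within {0..x+1} = at x within {0..}"
    by (rule at_within_nhd[of _ "{..<x+1}"]) auto
  ultimately show "continuous (at x within {0..}) H" by simp
qed

lemma H_convex: "convex_on {0..} H"
proof (rule convex_on_linorderI)
  fix t x y :: real assume t: "0 < t" "t < 1" and xy: "x \<in> {0..}" "y \<in> {0..}" "x < y"
  \<comment> \<open>The slope \<open>G z / z\<close> separates the difference quotient of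
    \<open>H\<close> on [x, z] from the one on [z, y].\<close>
  define z where "z = (1 - t) * x + t * y"
  have z: "z - x = t * (y - x)" "y - z = (1 - t) * (y - x)" by (auto simp: z_def algebra_simps)
  have "0 \<le> z - x" "0 \<le> y - z" unfolding z using t xy by auto
  then have zz: "x \<le> z" "z \<le> y" "0 \<le> z" using xy by auto
  have "(1 - t) * (H z - H x) \<le> (1 - t) * ((z - x) * (G z / z))"
    using H_diff(2)[of x z] zz xy t by (intro mult_left_mono) auto
  also have "\<dots> = t * ((y - z) * (G z / z))" by (simp add: z)
  also have "\<dots> \<le> t * (H y - H z)"
    using H_diff(1)[of z y] zz xy t by (intro mult_left_mono) auto
  finally have "H z \<le> (1 - t) * H x + t * H y" by (simp add: algebra_simps)
  then show "H ((1 - t) *\<^sub>R x + t *\<^sub>R y) \<le> (1 - t) * H x + t * H y" by (simp add: z_def)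
qed auto

lemma H_Delta2: "Delta2 H"
  unfolding Delta2_def
\<comment> \<open>The comparison with \<open>G\<close> is made at 2 t from above and at t/2 from
  below, so the argument of \<open>G\<close> is scaled by 4.\<close>
proof (intro exI[of _ "4 powr (1 / \<kappa>)"] allI impI)
  fix t :: real assume "t > 0"
  then have "H (2 * t) \<le> G (4 * (t / 2))" using H_le_G[of "2 * t"] by simp
  also have "\<dots> \<le> 4 powr (1 / \<kappa>) * G (t / 2)" using \<open>t > 0\<close> by (intro G_scale_le) auto
  also have "\<dots> \<le> 4 powr (1 / \<kappa>) * H t" using \<open>t > 0\<close> by (intro mult_left_mono G_half_le_H) auto
  finally show "H (2 * t) \<le> 4 powr (1 / \<kappa>) * H t" .
qed

lemma H_over_at_top: "filterlim (\<lambda>t. H t / t) at_top at_top"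
proof (rule filterlim_at_top_mono)
  have "eventually (\<lambda>t::real. 2 \<le> t) at_top" by (rule eventually_ge_at_top)
  then show "\<forall>\<^sub>F t in at_top. (t / 2) powr (1/\<beta> - 1) * (G 1 / 2) \<le> H t / t"
  proof eventually_elim
    fix t :: real assume t: "2 \<le> t"
    have "(t / 2) powr (1/\<beta>) * G 1 \<le> H t"
      using G_scale_ge[of "t/2" 1] G_half_le_H[of t] t by simp
    then have "(t / 2) powr (1/\<beta>) * G 1 / t \<le> H t / t" using t by (intro divide_right_mono) auto
    moreover have "(t / 2) powr (1/\<beta> - 1) * (G 1 / 2) = (t / 2) powr (1/\<beta>) * G 1 / t"
      using t by (simp add: powr_diff)
    ultimately show "(t / 2) powr (1/\<beta> - 1) * (G 1 / 2) \<le> H t / t" by simp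
  qed
  have "filterlim (\<lambda>t::real. t / 2) at_top at_top"
    using filterlim_tendsto_pos_mult_at_top[OF tendsto_const _ filterlim_ident, of "1/2::real"] by simp
  moreover have "filterlim (\<lambda>t::real. t powr (1/\<beta> - 1)) at_top at_top"
  proof (rule filterlim_mono_eventually[OF _ order.refl order.refl])
    show "filterlim (\<lambda>t::real. exp ((1/\<beta> - 1) * ln t)) at_top at_top"
      using beta_inv
      by (intro filterlim_compose[OF exp_at_top] filterlim_tendsto_pos_mult_at_top[OF tendsto_const _ ln_at_top]) auto
    show "\<forall>\<^sub>F t::real in at_top. exp ((1/\<beta> - 1) * ln t) = t powr (1/\<beta> - 1)"
      using eventually_gt_at_top[of 0] by eventually_elim (simp add: powr_def)
  qed
  ultimately have "filterlim (\<lambda>t::real. (t / 2) powr (1/\<beta> - 1)) at_top at_top" 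
    by (rule filterlim_compose[rotated])
  then show "filterlim (\<lambda>t::real. (t / 2) powr (1/\<beta> - 1) * (G 1 / 2)) at_top at_top"
    using G_pos[of 1] by (intro filterlim_at_top_mult_tendsto_pos[OF tendsto_const]) simp_all
qed

lemma H_N_function: "N_function H"
  unfolding N_function_def
proof (intro conjI H_continuous H_convex H_over_at_top allI impI H_nonneg)
  show "((\<lambda>t. H t / t) \<longlongrightarrow> 0) (at_right 0)"
  proof (rule tendsto_sandwich[OF _ _ tendsto_const G_over_tendsto_0])
    show "\<forall>\<^sub>F t in at_right 0. 0 \<le> H t / t" "\<forall>\<^sub>F t in at_right 0. H t / t \<le> G t / t"
      by (auto intro!: eventually_at_rightI[of 0 1] divide_right_mono H_le_G divide_nonneg_pos H_nonneg)
  qed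
qed

text \<open>The sandwich G(s/2) \<le> H(s) \<le> G(s) becomes, after inversion, a two-sided bound by
  \<open>F\<close> with the constants 1 and 2. Strict monotonicity makes \<open>inv_into\<close> the
  genuine inverse.\<close>

lemma H_inverse_bounds: assumes "0 < t"
  shows "F t \<le> inv_into {0..} H t" "inv_into {0..} H t \<le> 2 * F t"
proof -
  have f: "0 < F t" using F_pos assms .
  have "t \<le> H (2 * F t)" using G_half_le_H[of "2 * F t"] f G_F[OF assms] by simp
  then obtain s where s: "0 \<le> s" "H s = t"
    using IVT'[of H 0 t "2 * F t"] continuous_on_subset[OF H_continuous, of "{0..2 * F t}"] f assms
    by (auto simp: H_0)
  have "inj_on H {0..}" 
    by (intro strict_mono_on_imp_inj_on) (auto simp: strict_mono_on_def intro: H_strict_mono)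
  then have inv: "inv_into {0..} H t = s" using s by (intro inv_into_f_eq) auto
  have s0: "0 < s" using s assms by (cases "s = 0") (auto simp: H_0)
  show "F t \<le> inv_into {0..} H t" using le_G_iff[OF s0 assms] H_le_G[of s] s inv by simp
  show "inv_into {0..} H t \<le> 2 * F t" using G_le_iff[of "s/2" t] G_half_le_H[of s] s s0 inv assms by simp
qed

end

section \<open>Averages over balls\<close>


text \<open>The gradient is carried as an explicit field on the whole space. Mollified functions and
  their C^1 truncations have such a field, so that no derivative relative to a subset
  occurs.\<close>

definition C1_gradient :: "('a::euclidean_space \<Rightarrow> real) \<Rightarrow> ('a \<Rightarrow> 'a) \<Rightarrow> bool" where
  "C1_gradient f G \<longleftrightarrow>
     (\<forall>x. (f has_derivative (\<lambda>h. G x \<bullet> h)) (at x)) \<and> continuous_on UNIV G"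

text \<open>Pulled back to the unit ball, averages with different centres and radii are integrals
  over the same set and can be compared for each z separately.\<close>

definition ball_avg :: "('a::euclidean_space \<Rightarrow> real) \<Rightarrow> 'a \<Rightarrow> real \<Rightarrow> real" where
  "ball_avg f x r = (LINT z:ball 0 1|lborel. f (x + r *\<^sub>R z)) / unit_ball_vol (real DIM('a))"

lemma C1_gradient_continuous: assumes "C1_gradient f G" shows "continuous_on UNIV f"
  using assms unfolding C1_gradient_def
  by (auto intro!: has_derivative_continuous_on)

lemma nn_integral_lborel_affine:
  fixes k :: "'a::euclidean_space \<Rightarrow> ennreal"
  assumes [measurable]: "k \<in> borel_measurable borel" and r: "0 < r"
  shows "(\<integral>\<^sup>+z. k (x + r *\<^sub>R z) \<partial>lborel) = ennreal (1 / r ^ DIM('a)) * (\<integral>\<^sup>+y. k y \<partial>lborel)"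
proof -
  have "(\<integral>\<^sup>+y. k y \<partial>lborel) = ennreal (r ^ DIM('a)) * (\<integral>\<^sup>+z. k (x + r *\<^sub>R z) \<partial>lborel)"
    using r by (subst lborel_affine[of r x])
      (simp_all add: nn_integral_density nn_integral_distr nn_integral_cmult)
  then show ?thesis using r by (simp add: mult.assoc[symmetric] ennreal_mult[symmetric])
qed

lemma set_integrable_ball_continuous:
  fixes g :: "'a::euclidean_space \<Rightarrow> real"
  assumes "continuous_on UNIV g" shows "set_integrable lborel (ball x r) g"
proof (rule set_integrable_subset)
  show "set_integrable lborel (cball x r) g"
    unfolding set_integrable_def
    by (intro borel_integrable_compact continuous_on_subset[OF assms]) auto
qed auto

lemma abs_diff_le_segment_integral:
  fixes f :: "'a::euclidean_space \<Rightarrow> real"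
  assumes f: "C1_gradient f G" and \<delta>: "norm d \<le> \<delta>"
  shows "ennreal \<bar>f (a + d) - f a\<bar> \<le> (\<integral>\<^sup>+s\<in>{0..1}. ennreal (\<delta> * norm (G (a + s *\<^sub>R d))) \<partial>lborel)"
proof -
  have cG: "continuous_on UNIV G" and df: "\<And>x. (f has_derivative (\<lambda>h. G x \<bullet> h)) (at x)"
    using f by (auto simp: C1_gradient_def)
  have cc: "continuous_on {0..1} (\<lambda>s::real. G (a + s *\<^sub>R d) \<bullet> d)"
    by (intro continuous_intros continuous_on_compose2[OF cG]) auto
  have "(LINT s|lborel. indicator {0..1} s *\<^sub>R (G (a + s *\<^sub>R d) \<bullet> d)) = f (a + 1 *\<^sub>R d) - f (a + 0 *\<^sub>R d)"
  proof (rule integral_FTC_Icc[OF _ _ cc])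
    fix s :: real
    have "((\<lambda>s. f (a + s *\<^sub>R d)) has_derivative (\<lambda>h. G (a + s *\<^sub>R d) \<bullet> (h *\<^sub>R d))) (at s within {0..1})"
      by (rule has_derivative_compose[OF _ df]) (auto intro!: derivative_eq_intros)
    then show "((\<lambda>s. f (a + s *\<^sub>R d)) has_vector_derivative G (a + s *\<^sub>R d) \<bullet> d) (at s within {0..1})"
      by (simp add: has_vector_derivative_def)
  qed simp
  then have "ennreal \<bar>f (a + d) - f a\<bar> = ennreal (norm (LINT s|lborel. indicator {0..1} s *\<^sub>R (G (a + s *\<^sub>R d) \<bullet> d)))"
    by simp
  also have "\<dots> \<le> (\<integral>\<^sup>+s. norm (indicator {0..1} s *\<^sub>R (G (a + s *\<^sub>R d) \<bullet> d)) \<partial>lborel)"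
    by (rule integral_norm_bound_ennreal) (intro borel_integrable_compact cc compact_Icc)
  also have "\<dots> \<le> (\<integral>\<^sup>+s\<in>{0..1}. ennreal (\<delta> * norm (G (a + s *\<^sub>R d))) \<partial>lborel)"
  proof (intro nn_integral_mono)
    fix s :: real
    have "\<bar>G (a + s *\<^sub>R d) \<bullet> d\<bar> \<le> norm (G (a + s *\<^sub>R d)) * norm d" by (rule Cauchy_Schwarz_ineq2)
    also have "\<dots> \<le> norm (G (a + s *\<^sub>R d)) * \<delta>" using \<delta> by (intro mult_left_mono) auto
    finally show "ennreal (norm (indicator {0..1} s *\<^sub>R (G (a + s *\<^sub>R d) \<bullet> d)))
        \<le> ennreal (\<delta> * norm (G (a + s *\<^sub>R d))) * indicator {0..1} s"
      by (auto simp: indicator_def mult.commute intro!: ennreal_leI)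
  qed
  finally show ?thesis .
qed

text \<open>For each z in the unit ball the points x + r z and x' + r' z are joined by a segment,
  whose point at time s is x_s + r_s z with x_s and r_s interpolated linearly;
  \<open>\<delta>\<close> bounds the length of all these segments. After exchanging the integrals,
  the substitution y = x_s + r_s z costs 1/r_s^n \<le> 1/\<open>\<rho>\<close>^n, and the
  interpolated ball lies in \<open>V\<close>.\<close>

lemma ball_avg_diff:
  fixes f :: "'a::euclidean_space \<Rightarrow> real"
  assumes f: "C1_gradient f G" and V: "V \<in> sets borel"
    and \<rho>: "0 < \<rho>" "\<rho> \<le> r" "\<rho> \<le> r'"
    and sub: "\<And>s. 0 \<le> s \<Longrightarrow> s \<le> 1 \<Longrightarrow> ball (x + s *\<^sub>R (x' - x)) (r + s * (r' - r)) \<subseteq> V"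
    and \<delta>: "dist x x' + \<bar>r - r'\<bar> \<le> \<delta>"
  shows "ennreal \<bar>ball_avg f x r - ball_avg f x' r'\<bar>
    \<le> ennreal (\<delta> / (unit_ball_vol (real DIM('a)) * \<rho> ^ DIM('a))) * (\<integral>\<^sup>+y\<in>V. ennreal (norm (G y)) \<partial>lborel)"
proof -
  define \<omega> where "\<omega> = unit_ball_vol (real DIM('a))"
  have \<omega>: "0 < \<omega>" by (simp add: \<omega>_def)
  have [measurable]: "V \<in> sets borel" by fact
  have cG: "continuous_on UNIV G" using f by (auto simp: C1_gradient_def)
  then have [measurable]: "G \<in> borel_measurable borel" by (rule borel_measurable_continuous_onI)
  have cf: "continuous_on UNIV f" by (rule C1_gradient_continuous[OF f])
  have d0: "0 \<le> \<delta>" using \<delta> zero_le_dist[of x x'] by linarith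
  let ?N = "\<integral>\<^sup>+y\<in>V. ennreal (norm (G y)) \<partial>lborel"
  have I: "set_integrable lborel (ball 0 1) (\<lambda>z. f (a + b *\<^sub>R z))" for a b
    by (intro set_integrable_ball_continuous continuous_on_compose2[OF cf] continuous_intros) auto
  have "ball_avg f x' r' - ball_avg f x r = (LINT z:ball 0 1|lborel. f (x' + r' *\<^sub>R z) - f (x + r *\<^sub>R z)) / \<omega>"
    unfolding ball_avg_def \<omega>_def by (simp add: set_integral_diff(2)[OF I I] diff_divide_distrib)
  then have "\<bar>ball_avg f x r - ball_avg f x' r'\<bar> = \<bar>LINT z:ball 0 1|lborel. f (x' + r' *\<^sub>R z) - f (x + r *\<^sub>R z)\<bar> / \<omega>"
    using \<omega> by (simp add: abs_minus_commute[of "ball_avg f x r"] abs_divide)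
  then have "ennreal \<bar>ball_avg f x r - ball_avg f x' r'\<bar> = 
      ennreal (1 / \<omega>) * ennreal (norm (LINT z|lborel. indicator (ball 0 1) z *\<^sub>R (f (x' + r' *\<^sub>R z) - f (x + r *\<^sub>R z))))"
    using \<omega> by (simp add: ennreal_mult'[symmetric] set_lebesgue_integral_def field_simps)
  also have "ennreal (norm (LINT z|lborel. indicator (ball 0 1) z *\<^sub>R (f (x' + r' *\<^sub>R z) - f (x + r *\<^sub>R z))))
     \<le> (\<integral>\<^sup>+z. norm (indicator (ball 0 1) z *\<^sub>R (f (x' + r' *\<^sub>R z) - f (x + r *\<^sub>R z))) \<partial>lborel)"
    using set_integral_diff(1)[OF I I] unfolding set_integrable_def by (rule integral_norm_bound_ennreal)
  also have "\<dots> \<le> (\<integral>\<^sup>+z. \<integral>\<^sup>+s. ennreal (\<delta> * norm (G (x + r *\<^sub>R z + s *\<^sub>R ((x' - x) + (r' - r) *\<^sub>R z)))) * indicator {0..1} s * indicator (ball 0 1) z \<partial>lborel \<partial>lborel)"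
  proof (intro nn_integral_mono)
    fix z :: 'a
    show "ennreal (norm (indicator (ball 0 1) z *\<^sub>R (f (x' + r' *\<^sub>R z) - f (x + r *\<^sub>R z)))) \<le> 
      (\<integral>\<^sup>+s. ennreal (\<delta> * norm (G (x + r *\<^sub>R z + s *\<^sub>R ((x' - x) + (r' - r) *\<^sub>R z)))) * indicator {0..1} s * indicator (ball 0 1) z \<partial>lborel)"
    proof (cases "z \<in> ball 0 1")
      case True
      have "norm ((x' - x) + (r' - r) *\<^sub>R z) \<le> norm (x' - x) + \<bar>r' - r\<bar> * norm z" 
        by (rule order_trans[OF norm_triangle_ineq]) simp
      also have "\<dots> \<le> norm (x' - x) + \<bar>r' - r\<bar> * 1" using True by (intro add_left_mono mult_left_mono) auto
      also have "\<dots> \<le> \<delta>" using \<delta> by (simp add: dist_norm norm_minus_commute abs_minus_commute)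
      finally have "norm ((x' - x) + (r' - r) *\<^sub>R z) \<le> \<delta>" .
      from abs_diff_le_segment_integral[OF f this, of "x + r *\<^sub>R z"] show ?thesis
        using True by (simp add: algebra_simps)
    qed simp
  qed
  also have "\<dots> = (\<integral>\<^sup>+s. \<integral>\<^sup>+z. ennreal (\<delta> * norm (G (x + r *\<^sub>R z + s *\<^sub>R ((x' - x) + (r' - r) *\<^sub>R z)))) * indicator {0..1} s * indicator (ball 0 1) z \<partial>lborel \<partial>lborel)"
  proof (rule lborel_pair.Fubini'[symmetric])
    have [measurable]: "Measurable.pred (borel \<Otimes>\<^sub>M borel) (\<lambda>x::'a \<times> real. fst x \<in> ball 0 1)"
      unfolding mem_ball by measurable
    show "(\<lambda>(z, s). ennreal (\<delta> * norm (G (x + r *\<^sub>R z + s *\<^sub>R ((x' - x) + (r' - r) *\<^sub>R z)))) * indicator {0..1} s * indicator (ball 0 1) z)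
        \<in> borel_measurable (lborel \<Otimes>\<^sub>M lborel)"
      by measurable
  qed
  also have "\<dots> \<le> (\<integral>\<^sup>+s. ennreal (\<delta> / \<rho> ^ DIM('a)) * ?N * indicator {0..1} (s::real) \<partial>lborel)"
  proof (intro nn_integral_mono)
    fix s :: real
    show "(\<integral>\<^sup>+z. ennreal (\<delta> * norm (G (x + r *\<^sub>R z + s *\<^sub>R ((x' - x) + (r' - r) *\<^sub>R z)))) * indicator {0..1} s * indicator (ball 0 1) z \<partial>lborel)
        \<le> ennreal (\<delta> / \<rho> ^ DIM('a)) * ?N * indicator {0..1} s"
    proof (cases "s \<in> {0..1}")
      case True
      define xs where "xs = x + s *\<^sub>R (x' - x)"
      define rs where "rs = r + s * (r' - r)"
      have "\<rho> = (1 - s) * \<rho> + s * \<rho>" by (simp add: algebra_simps)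
      also have "\<dots> \<le> (1 - s) * r + s * r'" using True \<rho> by (intro add_mono mult_left_mono) auto
      finally have rs: "\<rho> \<le> rs" by (simp add: rs_def algebra_simps)
      have mem: "z \<in> ball 0 1 \<Longrightarrow> xs + rs *\<^sub>R z \<in> V" for z
        using sub[of s] True rs \<rho> by (auto simp: xs_def rs_def dist_norm subset_iff)
      have "(\<integral>\<^sup>+z. ennreal (\<delta> * norm (G (x + r *\<^sub>R z + s *\<^sub>R ((x' - x) + (r' - r) *\<^sub>R z)))) * indicator {0..1} s * indicator (ball 0 1) z \<partial>lborel)
        \<le> (\<integral>\<^sup>+z. ennreal \<delta> * (ennreal (norm (G (xs + rs *\<^sub>R z))) * indicator V (xs + rs *\<^sub>R z)) \<partial>lborel)"
      proof (intro nn_integral_mono)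
        fix z :: 'a
        have "x + r *\<^sub>R z + s *\<^sub>R ((x' - x) + (r' - r) *\<^sub>R z) = xs + rs *\<^sub>R z"
          by (simp add: xs_def rs_def algebra_simps)
        then show "ennreal (\<delta> * norm (G (x + r *\<^sub>R z + s *\<^sub>R ((x' - x) + (r' - r) *\<^sub>R z)))) * indicator {0..1} s * indicator (ball 0 1) z
          \<le> ennreal \<delta> * (ennreal (norm (G (xs + rs *\<^sub>R z))) * indicator V (xs + rs *\<^sub>R z))"
          using mem[of z] d0 by (auto simp: indicator_def ennreal_mult)
      qed
      also have "\<dots> = ennreal \<delta> * (ennreal (1 / rs ^ DIM('a)) * ?N)"
        using rs \<rho> by (subst nn_integral_cmult, measurable) (subst nn_integral_lborel_affine, auto)
      also have "\<dots> \<le> ennreal \<delta> * (ennreal (1 / \<rho> ^ DIM('a)) * ?N)"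
        using rs \<rho> by (intro mult_left_mono mult_right_mono ennreal_leI divide_left_mono power_mono) auto
      also have "\<dots> = ennreal (\<delta> / \<rho> ^ DIM('a)) * ?N"
        using d0 \<rho> by (simp add: mult.assoc[symmetric] ennreal_mult'[symmetric])
      finally show ?thesis using True by simp
    qed simp
  qed
  also have "\<dots> = ennreal (\<delta> / \<rho> ^ DIM('a)) * ?N"
    by (subst nn_integral_cmult_indicator) auto
  finally have "ennreal \<bar>ball_avg f x r - ball_avg f x' r'\<bar> \<le> ennreal (1 / \<omega>) * (ennreal (\<delta> / \<rho> ^ DIM('a)) * ?N)"
    by (simp add: mult_left_mono)
  also have "\<dots> = ennreal (\<delta> / (\<omega> * \<rho> ^ DIM('a))) * ?N"
    using d0 \<rho> \<omega> by (simp add: mult.assoc[symmetric] ennreal_mult'[symmetric])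
  finally show ?thesis by (simp add: \<omega>_def)
qed

lemma ball_avg_near:
  fixes f :: "'a::euclidean_space \<Rightarrow> real"
  assumes f: "continuous_on UNIV f" and r: "0 < r" and e: "\<And>y. y \<in> ball c r \<Longrightarrow> \<bar>f y - v\<bar> \<le> e"
  shows "\<bar>ball_avg f c r - v\<bar> \<le> e"
proof -
  define \<omega> where "\<omega> = unit_ball_vol (real DIM('a))"
  have \<omega>: "0 < \<omega>" "measure lborel (ball (0::'a) 1) = \<omega>" using content_ball[of 1 "0::'a"] by (simp_all add: \<omega>_def)
  have I: "set_integrable lborel (ball 0 1) (\<lambda>z. f (c + r *\<^sub>R z))"
    by (intro set_integrable_ball_continuous continuous_on_compose2[OF f] continuous_intros) auto
  have J: "set_integrable lborel (ball (0::'a) 1) (\<lambda>z. k)" for k :: real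
    by (intro set_integrable_ball_continuous continuous_intros)
  have kk: "(LINT z:ball (0::'a) 1|lborel. k) = k * \<omega>" for k :: real
    using \<omega> emeasure_lborel_ball_finite[of "0::'a" 1] by (simp add: set_lebesgue_integral_def)
  have mem: "c + r *\<^sub>R z \<in> ball c r" if "z \<in> ball 0 1" for z using that r by (simp add: dist_norm)
  have "(LINT z:ball (0::'a) 1|lborel. f (c + r *\<^sub>R z)) \<le> (LINT z:ball (0::'a) 1|lborel. v + e)"
    by (intro set_integral_mono I J) (use e[OF mem] in force)
  then have 1: "ball_avg f c r \<le> v + e" unfolding kk ball_avg_def \<omega>_def[symmetric] using \<omega> by (simp add: field_simps)
  have "(LINT z:ball (0::'a) 1|lborel. v - e) \<le> (LINT z:ball (0::'a) 1|lborel. f (c + r *\<^sub>R z))"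
    by (intro set_integral_mono I J) (use e[OF mem] in force)
  then have 2: "v - e \<le> ball_avg f c r" unfolding kk ball_avg_def \<omega>_def[symmetric] using \<omega> by (simp add: field_simps)
  show ?thesis using 1 2 by linarith
qed

section \<open>Chains of balls with bounded overlap\<close>

lemma card_separated_le:
  fixes g :: "nat \<Rightarrow> 'a::euclidean_space"
  assumes fin: "finite J" and sep: "\<And>i j. i \<in> J \<Longrightarrow> j \<in> J \<Longrightarrow> i \<noteq> j \<Longrightarrow> \<rho> \<le> dist (g i) (g j)"
    and near: "\<And>i. i \<in> J \<Longrightarrow> dist (g i) y < 2 * \<rho>" and \<rho>: "0 < \<rho>"
  shows "card J \<le> 5 ^ DIM('a)"
proof -
  define \<omega> where "\<omega> = unit_ball_vol (real DIM('a))"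
  have \<omega>: "0 < \<omega>" by (simp add: \<omega>_def)
  \<comment> \<open>Balls of half the separation are disjoint and all lie in the ball of radius 5/2
    \<open>\<rho>\<close> about y; comparing volumes leaves at most 5^n of them.\<close>
  have disj: "disjoint_family_on (\<lambda>i. ball (g i) (\<rho>/2)) J"
    unfolding disjoint_family_on_def
  proof (intro ballI impI)
    fix i j assume "i \<in> J" "j \<in> J" "i \<noteq> j"
    from sep[OF this] show "ball (g i) (\<rho>/2) \<inter> ball (g j) (\<rho>/2) = {}"
      by (intro disjoint_ballI) auto
  qed
  have "(\<Sum>i\<in>J. measure lborel (ball (g i) (\<rho>/2))) = measure lborel (\<Union>i\<in>J. ball (g i) (\<rho>/2))"
  proof (rule measure_finite_Union[symmetric, OF fin _ disj])
    show "emeasure lborel (ball (g i) (\<rho>/2)) \<noteq> \<infinity>" for i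
      using emeasure_lborel_ball_finite[of "g i" "\<rho>/2"] by simp
  qed auto
  also have "\<dots> \<le> measure lborel (ball y (5/2 * \<rho>))"
  proof (rule measure_mono_fmeasurable)
    show "(\<Union>i\<in>J. ball (g i) (\<rho>/2)) \<subseteq> ball y (5/2 * \<rho>)"
    proof clarify
      fix i z assume "i \<in> J" "z \<in> ball (g i) (\<rho>/2)"
      then show "z \<in> ball y (5/2 * \<rho>)" using near[of i] dist_triangle[of y z "g i"] 
        by (simp add: dist_commute)
    qed
    show "ball y (5/2 * \<rho>) \<in> fmeasurable lborel" using emeasure_lborel_ball_finite by (intro fmeasurableI) auto
    show "(\<Union>i\<in>J. ball (g i) (\<rho>/2)) \<in> sets lborel" using fin by (intro sets.finite_UN) auto
  qed
  finally have "real (card J) * (\<omega> * (\<rho>/2) ^ DIM('a)) \<le> \<omega> * (5/2 * \<rho>) ^ DIM('a)"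
    using \<rho> by (simp add: content_ball \<omega>_def)
  also have "\<omega> * (5/2 * \<rho>) ^ DIM('a) = 5 ^ DIM('a) * (\<omega> * (\<rho>/2) ^ DIM('a))"
  proof -
    have "(5/2 * \<rho>) ^ DIM('a) = (5 * (\<rho>/2)) ^ DIM('a)" by simp
    then show ?thesis by (simp only: power_mult_distrib) (simp add: mult_ac)
  qed
  finally have "real (card J) \<le> 5 ^ DIM('a)" using \<omega> \<rho> by simp
  then show ?thesis by (metis of_nat_le_iff of_nat_numeral of_nat_power)
qed


text \<open>Points of the curve at distance at most \<open>\<rho>\<close> are the edges of a graph.
  By uniform continuity the two end points are connected in it, and on a path with the fewest edges
  two non-consecutive vertices are more than \<open>\<rho>\<close> apart, since an edge between them
  would be a shortcut.\<close>

lemma ex_minimal_chain: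
  fixes c :: "real \<Rightarrow> 'a::metric_space"
  assumes ab: "a \<le> b" and c: "continuous_on {a..b} c" and \<rho>: "0 < \<rho>"
  shows "\<exists>(g :: nat \<Rightarrow> 'a) k. g 0 = c a \<and> g k = c b \<and> (\<forall>i\<le>k. g i \<in> c ` {a..b}) \<and>
    (\<forall>i<k. dist (g i) (g (Suc i)) \<le> \<rho>) \<and> (\<forall>i j. i + 2 \<le> j \<and> j \<le> k \<longrightarrow> \<rho> < dist (g i) (g j))"
proof -
  define R where "R = {(x, y). x \<in> c ` {a..b} \<and> y \<in> c ` {a..b} \<and> dist x y \<le> \<rho>}"
  have "uniformly_continuous_on {a..b} c" using c by (intro compact_uniformly_continuous) auto
  then obtain d where d: "d > 0" "\<And>s t. s \<in> {a..b} \<Longrightarrow> t \<in> {a..b} \<Longrightarrow> dist t s < d \<Longrightarrow> dist (c t) (c s) < \<rho>"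
    using \<rho> unfolding uniformly_continuous_on_def by meson
  have reach: "(c a, c (min b (a + real i * (d / 2)))) \<in> R\<^sup>*" for i
  proof (induction i)
    case 0 then show ?case using ab by simp
  next
    case (Suc i)
    have "min b (a + real i * (d / 2)) \<in> {a..b}" "min b (a + real (Suc i) * (d / 2)) \<in> {a..b}"
      using ab d(1) by auto
    moreover have "dist (min b (a + real i * (d / 2))) (min b (a + real (Suc i) * (d / 2))) < d"
    proof -
      have e: "real (Suc i) * (d / 2) = real i * (d / 2) + d / 2" by (simp add: algebra_simps)
      define w where "w = real i * (d / 2)"
      show ?thesis unfolding e w_def[symmetric] using d(1) by (auto simp: dist_real_def min_def)
    qed
    ultimately have "(c (min b (a + real i * (d / 2))), c (min b (a + real (Suc i) * (d / 2)))) \<in> R"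
      using d(2) unfolding R_def by (auto intro: less_imp_le)
    with Suc show ?case by (rule rtrancl_into_rtrancl)
  qed
  obtain i where "(b - a) / (d / 2) \<le> real i" using real_arch_simple by blast
  then have "min b (a + real i * (d / 2)) = b" using d(1) by (simp add: field_simps)
  with reach[of i] have "(c a, c b) \<in> R\<^sup>*" by simp
  then have ex: "\<exists>k. (c a, c b) \<in> R ^^ k" by (simp add: rtrancl_power)
  define k where "k = (LEAST k. (c a, c b) \<in> R ^^ k)"
  have k: "(c a, c b) \<in> R ^^ k" unfolding k_def using ex by (rule LeastI_ex)
  have least: "k \<le> m" if "(c a, c b) \<in> R ^^ m" for m unfolding k_def using that by (rule Least_le)
  from k obtain g where g: "g 0 = c a" "g k = c b" "\<And>i. i < k \<Longrightarrow> (g i, g (Suc i)) \<in> R"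
    unfolding relpow_fun_conv by blast
  have mem: "g i \<in> c ` {a..b}" if "i \<le> k" for i
  proof (cases "i < k")
    case True then show ?thesis using g(3)[of i] by (auto simp: R_def)
  next
    case False then show ?thesis using that g(2) ab by auto
  qed
  have pre: "(g i, g j) \<in> R ^^ (j - i)" if "i \<le> j" "j \<le> k" for i j
    unfolding relpow_fun_conv using that by (intro exI[of _ "\<lambda>m. g (i + m)"]) (auto intro!: g(3))
  show ?thesis
  proof (intro exI[of _ g] exI[of _ k] conjI allI impI g(1,2) mem)
    show "dist (g i) (g (Suc i)) \<le> \<rho>" if "i < k" for i using g(3)[OF that] by (auto simp: R_def)
    show "\<rho> < dist (g i) (g j)" if "i + 2 \<le> j \<and> j \<le> k" for i j
    proof (rule ccontr)
      \<comment> \<open>The shortcut would give a path of i + 1 + (k - j) edges, which is less than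
        k because i + 2 \<le> j.\<close>
      assume "\<not> \<rho> < dist (g i) (g j)"
      then have "(g i, g j) \<in> R ^^ 1" using mem[of i] mem[of j] that by (auto simp: R_def)
      then have "(c a, g j) \<in> R ^^ (i + 1)" using pre[of 0 i] that g(1) unfolding relpow_add by auto
      then have "(c a, c b) \<in> R ^^ (i + 1 + (k - j))" using pre[of j k] that g(2) unfolding relpow_add[of "i + 1"] by auto
      from least[OF this] that show False by linarith
    qed
  qed auto
qed

text \<open>Consecutive points may be arbitrarily close, so the indices are split by parity:
  distinct indices of equal parity differ by at least 2, and the packing bound applies to each
  class.\<close>

lemma card_overlap_le:
  fixes g :: "nat \<Rightarrow> 'a::euclidean_space"
  assumes sep: "\<And>i j. i + 2 \<le> j \<Longrightarrow> j \<le> k \<Longrightarrow> \<rho> < dist (g i) (g j)" and \<rho>: "0 < \<rho>"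
  shows "card {i. i < k \<and> y \<in> ball (g i) (2 * \<rho>)} \<le> 2 * 5 ^ DIM('a)"
proof -
  define J where "J e = {i. i < k \<and> y \<in> ball (g i) (2 * \<rho>) \<and> (even i \<longleftrightarrow> e)}" for e
  have cardJ: "card (J e) \<le> 5 ^ DIM('a)" for e
  proof (rule card_separated_le[OF _ _ _ \<rho>])
    fix i j assume ij: "i \<in> J e" "j \<in> J e" "i \<noteq> j"
    then have "i + 2 \<le> j \<or> j + 2 \<le> i" unfolding J_def by (auto) presburger+
    then show "\<rho> \<le> dist (g i) (g j)"
      using sep[of i j] sep[of j i] ij by (auto simp: J_def dist_commute)
  qed (auto simp: J_def)
  have "{i. i < k \<and> y \<in> ball (g i) (2 * \<rho>)} = J True \<union> J False" by (auto simp: J_def)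
  then have "card {i. i < k \<and> y \<in> ball (g i) (2 * \<rho>)} \<le> card (J True) + card (J False)"
    using card_Un_le by metis
  moreover have "card (J True) \<le> 5 ^ DIM('a)" "card (J False) \<le> 5 ^ DIM('a)" by (rule cardJ)+
  ultimately show ?thesis by linarith
qed

text \<open>A shortest \<open>\<rho>\<close>-chain of points of the curve revisits no region, so its balls overlap boundedly.\<close>
lemma ball_avg_along_curve:
  fixes f :: "'a::euclidean_space \<Rightarrow> real" and c :: "real \<Rightarrow> 'a"
  assumes f: "C1_gradient f G" and ab: "a \<le> b" and c: "continuous_on {a..b} c" and \<rho>: "0 < \<rho>"
    and V: "V \<in> sets borel" and sub: "\<And>t. t \<in> {a..b} \<Longrightarrow> ball (c t) (2 * \<rho>) \<subseteq> V"
  shows "ennreal \<bar>ball_avg f (c a) \<rho> - ball_avg f (c b) \<rho>\<bar>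
    \<le> ennreal (2 * 5 ^ DIM('a) * (\<rho> / (unit_ball_vol (real DIM('a)) * \<rho> ^ DIM('a))))
        * (\<integral>\<^sup>+y\<in>V. ennreal (norm (G y)) \<partial>lborel)"
proof -
  define q where "q = \<rho> / (unit_ball_vol (real DIM('a)) * \<rho> ^ DIM('a))"
  have q: "0 \<le> q" using \<rho> by (simp add: q_def)
  have [measurable]: "V \<in> sets borel" by fact
  have [measurable]: "G \<in> borel_measurable borel" 
    using f by (auto simp: C1_gradient_def intro: borel_measurable_continuous_onI)
  obtain g k where g: "g 0 = c a" "g k = c b" "\<And>i. i \<le> k \<Longrightarrow> g i \<in> c ` {a..b}"
    "\<And>i. i < k \<Longrightarrow> dist (g i) (g (Suc i)) \<le> \<rho>"
    "\<And>i j. i + 2 \<le> j \<Longrightarrow> j \<le> k \<Longrightarrow> \<rho> < dist (g i) (g j)"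
    using ex_minimal_chain[OF ab c \<rho>] by metis
  have "ball_avg f (c a) \<rho> - ball_avg f (c b) \<rho> = (\<Sum>i<k. ball_avg f (g i) \<rho> - ball_avg f (g (Suc i)) \<rho>)"
    using sum_lessThan_telescope'[of "\<lambda>i. ball_avg f (g i) \<rho>" k] g(1,2) by simp
  then have "ennreal \<bar>ball_avg f (c a) \<rho> - ball_avg f (c b) \<rho>\<bar> \<le> ennreal (\<Sum>i<k. \<bar>ball_avg f (g i) \<rho> - ball_avg f (g (Suc i)) \<rho>\<bar>)"
    by (auto intro!: ennreal_leI sum_abs)
  also have "\<dots> = (\<Sum>i<k. ennreal \<bar>ball_avg f (g i) \<rho> - ball_avg f (g (Suc i)) \<rho>\<bar>)"
    by (rule sum_ennreal[symmetric]) auto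
  \<comment> \<open>Each step of the chain is charged to one ball of radius 2 \<open>\<rho>\<close>:
    consecutive centres are at most \<open>\<rho>\<close> apart, so it contains all interpolated
    balls of radius \<open>\<rho>\<close>.\<close>
  also have "\<dots> \<le> (\<Sum>i<k. ennreal q * (\<integral>\<^sup>+y\<in>ball (g i) (2 * \<rho>). ennreal (norm (G y)) \<partial>lborel))"
  proof (intro sum_mono)
    fix i assume i: "i \<in> {..<k}"
    show "ennreal \<bar>ball_avg f (g i) \<rho> - ball_avg f (g (Suc i)) \<rho>\<bar> \<le> ennreal q * (\<integral>\<^sup>+y\<in>ball (g i) (2 * \<rho>). ennreal (norm (G y)) \<partial>lborel)"
      unfolding q_def
    proof (rule ball_avg_diff[OF f _ \<rho> order.refl order.refl])
      fix s :: real assume s: "0 \<le> s" "s \<le> 1"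
      show "ball (g i + s *\<^sub>R (g (Suc i) - g i)) (\<rho> + s * (\<rho> - \<rho>)) \<subseteq> ball (g i) (2 * \<rho>)"
      proof
        fix z assume "z \<in> ball (g i + s *\<^sub>R (g (Suc i) - g i)) (\<rho> + s * (\<rho> - \<rho>))"
        moreover have "dist (g i) (g i + s *\<^sub>R (g (Suc i) - g i)) = s * dist (g i) (g (Suc i))"
          using s by (simp add: dist_norm norm_minus_commute)
        moreover have "s * dist (g i) (g (Suc i)) \<le> 1 * \<rho>" using s g(4)[of i] i by (intro mult_mono) auto
        ultimately show "z \<in> ball (g i) (2 * \<rho>)"
          using dist_triangle[of "g i" z "g i + s *\<^sub>R (g (Suc i) - g i)"] by simp
      qed
    qed (use g(4)[of i] i in auto)
  qed
  also have "\<dots> = ennreal q * (\<integral>\<^sup>+y. (\<Sum>i<k. ennreal (norm (G y)) * indicator (ball (g i) (2 * \<rho>)) y) \<partial>lborel)"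
  proof -
    have "(\<lambda>y. ennreal (norm (G y)) * indicator (ball z r) y) \<in> borel_measurable lborel" for z r
      by (intro borel_measurable_times_ennreal borel_measurable_indicator) auto
    then show ?thesis by (subst nn_integral_sum) (auto simp: sum_distrib_left)
  qed
  \<comment> \<open>Here the number of balls through a point replaces the number of balls in the
    chain, so the bound depends neither on the number of steps nor on the length of the
    curve.\<close>
  also have "\<dots> \<le> ennreal q * (\<integral>\<^sup>+y. ennreal (2 * 5 ^ DIM('a)) * (ennreal (norm (G y)) * indicator V y) \<partial>lborel)"
  proof (intro mult_left_mono nn_integral_mono)
    fix y
    have "(\<Sum>i<k. indicator (ball (g i) (2 * \<rho>)) y :: real) = real (card {i. i < k \<and> y \<in> ball (g i) (2 * \<rho>)})"
      by (simp add: indicator_def sum.If_cases Int_def del: mem_ball)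
    also have "\<dots> \<le> real (2 * 5 ^ DIM('a))" 
      using card_overlap_le[of k \<rho> g y] g(5) \<rho> by (intro of_nat_mono) blast
    finally have "(\<Sum>i<k. indicator (ball (g i) (2 * \<rho>)) y :: real) \<le> 2 * 5 ^ DIM('a)" by simp
    moreover have "y \<in> V" if i: "i < k" and y: "y \<in> ball (g i) (2 * \<rho>)" for i
    proof -
      obtain t where "t \<in> {a..b}" "g i = c t" using g(3)[of i] i by auto
      then show ?thesis using sub[of t] y by auto
    qed
    then have "y \<notin> V \<Longrightarrow> (\<Sum>i<k. indicator (ball (g i) (2 * \<rho>)) y :: real) = 0" 
      by (intro sum.neutral) (auto simp: indicator_def simp del: mem_ball)
    ultimately have "(\<Sum>i<k. indicator (ball (g i) (2 * \<rho>)) y :: real) \<le> 2 * 5 ^ DIM('a) * indicator V y"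
      by (auto simp: indicator_def simp del: mem_ball)
    then have "ennreal (norm (G y) * (\<Sum>i<k. indicator (ball (g i) (2 * \<rho>)) y)) \<le> ennreal (norm (G y) * (2 * 5 ^ DIM('a) * indicator V y))"
      by (intro ennreal_leI mult_left_mono) auto
    moreover have "ennreal (norm (G y) * (\<Sum>i<k. indicator (ball (g i) (2 * \<rho>)) y)) = (\<Sum>i<k. ennreal (norm (G y)) * indicator (ball (g i) (2 * \<rho>)) y)"
      by (simp add: sum_distrib_left sum_ennreal[symmetric] ennreal_mult' ennreal_indicator ennreal_of_nat_eq_real_of_nat del: sum_ennreal)
    moreover have "ennreal (norm (G y) * (2 * 5 ^ DIM('a) * indicator V y)) = ennreal (2 * 5 ^ DIM('a)) * (ennreal (norm (G y)) * indicator V y)"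
      by (auto simp: indicator_def ennreal_mult'[symmetric] mult_ac)
    ultimately show "(\<Sum>i<k. ennreal (norm (G y)) * indicator (ball (g i) (2 * \<rho>)) y) \<le> ennreal (2 * 5 ^ DIM('a)) * (ennreal (norm (G y)) * indicator V y)"
      by simp
  qed auto
  also have "\<dots> = ennreal (2 * 5 ^ DIM('a) * q) * (\<integral>\<^sup>+y\<in>V. ennreal (norm (G y)) \<partial>lborel)"
    using q by (subst nn_integral_cmult) (auto simp: ennreal_mult' mult_ac)
  finally show ?thesis unfolding q_def .
qed

section \<open>Cigar John domains\<close>


text \<open>For a fixed z, lying at distance less than r is an open condition on the centre, so a
  point of the limiting ball lies in some ball with a nearby centre. This carries the cigar
  condition to a time at which it is known only for neighbouring times.\<close>

lemma ball_subset_of_limit: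
  fixes \<gamma> :: "real \<Rightarrow> 'a::metric_space"
  assumes cont: "continuous_on A \<gamma>" and T: "T \<in> A" and B: "B \<subseteq> A" and lim: "T islimpt B"
    and sub: "\<And>t. t \<in> B \<Longrightarrow> ball (\<gamma> t) r \<subseteq> U"
  shows "ball (\<gamma> T) r \<subseteq> U"
proof
  fix z assume z: "z \<in> ball (\<gamma> T) r"
  have "(\<gamma> \<longlongrightarrow> \<gamma> T) (at T within A)" using cont T by (auto simp: continuous_on_def)
  then have "(\<gamma> \<longlongrightarrow> \<gamma> T) (at T within B)" using B by (rule tendsto_within_subset)
  then have "((\<lambda>u. dist (\<gamma> u) z) \<longlongrightarrow> dist (\<gamma> T) z) (at T within B)" by (intro tendsto_intros)
  then have "\<forall>\<^sub>F u in at T within B. dist (\<gamma> u) z < r"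
    using z by (intro order_tendstoD) auto
  moreover have "\<forall>\<^sub>F u in at T within B. u \<in> B" by (simp add: eventually_at_filter)
  ultimately have "\<forall>\<^sub>F u in at T within B. dist (\<gamma> u) z < r \<and> u \<in> B" by (rule eventually_conj)
  moreover have "at T within B \<noteq> bot" using lim by (simp add: trivial_limit_within)
  ultimately obtain u where "dist (\<gamma> u) z < r" "u \<in> B" by (auto dest: eventually_happens)
  then show "z \<in> U" using sub[of u] by auto
qed

text \<open>
  The carrot at \<open>x\<close> is cut at the last times at which the length parameter \<open>m\<close> is at most
  \<open>R * 2 powi j\<close>; monotonicity of \<open>m\<close> suffices, so continuity of arc length is never needed.
\<close>
lemma carrot_chain:
  fixes f :: "'a::euclidean_space \<Rightarrow> real" and \<gamma> :: "real \<Rightarrow> 'a" and m \<theta> :: "real \<Rightarrow> real" and N :: int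
  assumes f: "C1_gradient f G" and U: "U \<in> sets borel"
    and \<theta>pos: "\<And>s. 0 < s \<Longrightarrow> 0 < \<theta> s" and \<theta>mono: "\<And>s t. 0 < s \<Longrightarrow> s \<le> t \<Longrightarrow> \<theta> s \<le> \<theta> t"
    and \<theta>lin: "\<And>s. 0 < s \<Longrightarrow> \<theta> s \<le> L * s" and \<theta>dbl: "\<And>s. 0 < s \<Longrightarrow> \<theta> (2 * s) \<le> D * \<theta> s"
    and T: "0 \<le> T" and \<gamma>: "continuous_on {0..T} \<gamma>" "\<gamma> 0 = x"
    and m_mono: "\<And>s t. 0 < s \<Longrightarrow> s \<le> t \<Longrightarrow> t < T \<Longrightarrow> m s \<le> m t"
    and m_dist: "\<And>t. 0 < t \<Longrightarrow> t < T \<Longrightarrow> dist x (\<gamma> t) \<le> m t"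
    and m_le: "\<And>t. 0 < t \<Longrightarrow> t < T \<Longrightarrow> m t \<le> M"
    and sub: "\<And>t. 0 < t \<Longrightarrow> t < T \<Longrightarrow> ball (\<gamma> t) (\<theta> (m t)) \<subseteq> U"
    and subT: "ball (\<gamma> T) (\<theta> (M / 2)) \<subseteq> U"
    and R: "0 < R" and N: "M \<le> R * 2 powi N" "R * 2 powi N < 2 * M"
  shows "ennreal \<bar>f x - ball_avg f (\<gamma> T) (\<theta> (R * 2 powi N / 4) / 2)\<bar> \<le>
    (\<Sum>i. (\<lambda>j. ennreal ((2 * 5 ^ DIM('a) + D) * ((\<theta> (R * 2 powi j / 4) / 2)
              / (unit_ball_vol (real DIM('a)) * (\<theta> (R * 2 powi j / 4) / 2) ^ DIM('a))))
        * (\<integral>\<^sup>+y\<in>U \<inter> ball x ((2 + L) * (R * 2 powi j)). ennreal (norm (G y)) \<partial>lborel)) (N - 1 - int i))"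
proof -
  define s where "s j = R * 2 powi j" for j :: int
  \<comment> \<open>The ball given at the end point has radius \<theta>(M/2), and s_N < 2 M, so s_j
    / 4 \<le> M / 2 for all j \<le> N. The outer factor 1/2 leaves room for the balls of radius 2
    \<rho>_j that a chain along the curve occupies.\<close>
  define \<rho> where "\<rho> j = \<theta> (s j / 4) / 2" for j
  define \<omega> where "\<omega> = unit_ball_vol (real DIM('a))"
  define V where "V j = U \<inter> ball x ((2 + L) * s j)" for j
  define e where "e j = ennreal ((2 * 5 ^ DIM('a) + D) * (\<rho> j / (\<omega> * \<rho> j ^ DIM('a))))
        * (\<integral>\<^sup>+y\<in>V j. ennreal (norm (G y)) \<partial>lborel)" for j
  \<comment> \<open>The inserted 0 keeps the supremum in [0, T] when no time qualifies.\<close>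
  define S where "S j = insert 0 {t. 0 < t \<and> t < T \<and> m t \<le> s j}" for j
  define \<tau> where "\<tau> j = Sup (S j)" for j
  have \<omega>: "0 < \<omega>" by (simp add: \<omega>_def)
  have s_pos: "0 < s j" for j using R by (simp add: s_def)
  have s_Suc: "s (j + 1) = 2 * s j" for j by (simp add: s_def power_int_add_1)
  have s_mono: "s i \<le> s j" if "i \<le> j" for i j using that R by (simp add: s_def power_int_increasing)
  have \<rho>_pos: "0 < \<rho> j" for j using \<theta>pos[of "s j / 4"] s_pos[of j] by (simp add: \<rho>_def)
  have L: "0 < L" using \<theta>lin[of 1] \<theta>pos[of 1] by simp
  have \<rho>_le: "2 * \<rho> j \<le> L * s j / 4" for j using \<theta>lin[of "s j / 4"] s_pos[of j] by (simp add: \<rho>_def)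
  have \<rho>_Suc: "\<rho> j \<le> \<rho> (j + 1)" "\<rho> (j + 1) \<le> D * \<rho> j" for j
    using \<theta>mono[of "s j / 4" "s (j + 1) / 4"] \<theta>dbl[of "s j / 4"] s_pos[of j] by (simp_all add: \<rho>_def s_Suc)
  have D: "0 < D" using \<rho>_Suc[of 0] \<rho>_pos[of 0] \<rho>_pos[of 1] by (smt (verit) mult_nonpos_nonneg add_0)
  have [measurable]: "V j \<in> sets borel" for j unfolding V_def using U by (intro sets.Int) auto
  have bdd: "bdd_above (S j)" for j unfolding S_def using T by (intro bdd_aboveI[of _ T]) auto
  have \<tau>: "0 \<le> \<tau> j" "\<tau> j \<le> T" for j
    unfolding \<tau>_def using T by (auto intro!: cSup_upper bdd cSup_least) (auto simp: S_def)
  have \<tau>_mono: "\<tau> j \<le> \<tau> (j + 1)" for j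
    unfolding \<tau>_def using s_mono[of j "j + 1"] by (intro cSup_subset_mono bdd) (auto simp: S_def)
  have \<tau>_N: "\<tau> N = T"
  proof (rule antisym[OF \<tau>(2)])
    show "T \<le> \<tau> N"
    proof (cases "T = 0")
      case True then show ?thesis using \<tau>(1)[of N] by simp
    next
      case False
      show ?thesis
      proof (rule dense_le_bounded[of 0 T])
        show "0 < T" using False T by simp
      fix t assume "0 < t" "t < T"
      then show "t \<le> \<tau> N" unfolding \<tau>_def using m_le[of t] N by (intro cSup_upper bdd) (auto simp: S_def s_def)
      qed
    qed
  qed
  have below: "m t \<le> s j" if t: "0 < t" "t < \<tau> j" for t j
  proof -
    obtain t' where "t' \<in> S j" "t < t'" using t bdd[of j] by (auto simp: \<tau>_def less_cSup_iff S_def)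
    then show ?thesis using t m_mono[of t t'] by (auto simp: S_def)
  qed
  have above: "s j < m t" if "\<tau> j < t" "t < T" for t j
  proof (rule ccontr)
    assume "\<not> s j < m t"
    then have "t \<in> S j" using that \<tau>(1)[of j] by (auto simp: S_def)
    then have "t \<le> \<tau> j" unfolding \<tau>_def by (intro cSup_upper bdd)
    then show False using that by simp
  qed
  \<comment> \<open>Before \<tau>_j this is \<open>m_dist\<close> with \<open>below\<close>. The
    time \<tau>_j itself, where no bound on m is at hand, is reached by continuity of the
    curve.\<close>
  have dist_le: "dist x (\<gamma> t) \<le> s j" if t: "0 \<le> t" "t \<le> \<tau> j" for t j
  proof (cases "0 < \<tau> j")
    case False
    then have "t = 0" using t by linarith
    then show ?thesis using \<gamma>(2) s_pos[of j] by simp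
  next
    case True
    have "\<gamma> ` closure {0..<\<tau> j} \<subseteq> cball x (s j)"
    proof (rule image_closure_subset)
      show "continuous_on (closure {0..<\<tau> j}) \<gamma>"
        using True \<tau>(2)[of j] by (auto intro!: continuous_on_subset[OF \<gamma>(1)])
      show "\<gamma> ` {0..<\<tau> j} \<subseteq> cball x (s j)"
      proof clarify
        fix u assume u: "u \<in> {0..<\<tau> j}"
        show "\<gamma> u \<in> cball x (s j)"
        proof (cases "u = 0")
          case True then show ?thesis using \<gamma>(2) s_pos[of j] by simp
        next
          case False then show ?thesis using u below[of u j] m_dist[of u] \<tau>(2)[of j] by simp
        qed
      qed
    qed auto
    moreover have "t \<in> closure {0..<\<tau> j}" using t True by simp
    ultimately have "\<gamma> t \<in> cball x (s j)" by blast
    then show ?thesis by simp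
  qed
  \<comment> \<open>After \<tau>_j the parameter exceeds s_j and the cigar ball is large enough. At
    \<tau>_j this passes to the limit from the right, and at T it is the assumption on the end
    ball.\<close>
  have ball_sub: "ball (\<gamma> t) (2 * \<rho> j) \<subseteq> U" if t: "\<tau> j \<le> t" "t \<le> T" and j: "j \<le> N" for t j
  proof -
    consider "t = T" | "\<tau> j < t" "t < T" | "t = \<tau> j" "\<tau> j < T" using t by linarith
    then show ?thesis
    proof cases
      case 1
      have "2 * \<rho> j \<le> \<theta> (M / 2)"
        using \<theta>mono[of "s j / 4" "M / 2"] s_pos[of j] s_mono[OF j] N by (simp add: \<rho>_def s_def)
      then show ?thesis using subT 1 by (meson order_trans subset_ball)
    next
      case 2
      have "2 * \<rho> j \<le> \<theta> (m t)"
        using \<theta>mono[of "s j / 4" "m t"] s_pos[of j] above[OF 2] by (simp add: \<rho>_def)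
      then show ?thesis using sub[of t] 2 \<tau>(1)[of j] by (meson order_trans subset_ball le_less_trans)
    next
      case 3
      show ?thesis
      proof (rule ball_subset_of_limit[OF \<gamma>(1)])
        show "t islimpt {\<tau> j<..<T}" using 3 islimpt_greaterThanLessThan1 by simp
        fix u assume u: "u \<in> {\<tau> j<..<T}"
        then have "2 * \<rho> j \<le> \<theta> (m u)"
          using \<theta>mono[of "s j / 4" "m u"] s_pos[of j] above[of j u] by (simp add: \<rho>_def)
        then show "ball (\<gamma> u) (2 * \<rho> j) \<subseteq> U" using sub[of u] u \<tau>(1)[of j]
          by (meson greaterThanLessThan_iff le_less_trans order_trans subset_ball)
      qed (use \<tau>[of j] 3 in auto)
    qed
  qed
  \<comment> \<open>Two moves: the centre travels along the curve with the radius \<rho>_j kept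
    fixed, then the radius grows to that of scale j + 1 at a fixed centre. The first costs the
    factor 2 * 5^n of the chain, the second the doubling constant \<open>D\<close>.\<close>
  have step: "ennreal \<bar>ball_avg f (\<gamma> (\<tau> j)) (\<rho> j) - ball_avg f (\<gamma> (\<tau> (j + 1))) (\<rho> (j + 1))\<bar> \<le> e j" if j: "j < N" for j
  proof -
    let ?N = "\<integral>\<^sup>+y\<in>V j. ennreal (norm (G y)) \<partial>lborel"
    let ?q = "\<rho> j / (\<omega> * \<rho> j ^ DIM('a))"
    have q: "0 \<le> ?q" using \<rho>_pos[of j] \<omega> by simp
    \<comment> \<open>Up to the cut of scale j + 1 the curve stays within 2 s_j of x, and the radii
      used are at most L s_j. This is the origin of the factor \<open>2 + L\<close>.\<close>
    have inV: "ball (\<gamma> t) r \<subseteq> V j" if "t \<le> \<tau> (j + 1)" "0 \<le> t" "r \<le> L * s j" "ball (\<gamma> t) r \<subseteq> U" for t r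
    proof -
      have "ball (\<gamma> t) r \<subseteq> ball x ((2 + L) * s j)"
      proof
        fix z assume "z \<in> ball (\<gamma> t) r"
        then have "dist (\<gamma> t) z < r" by simp
        moreover have "dist x (\<gamma> t) \<le> 2 * s j" using dist_le[of t "j + 1"] that(1,2) s_Suc[of j] by simp
        ultimately have "dist x z < 2 * s j + L * s j"
          using dist_triangle[of x z "\<gamma> t"] that(3) by linarith
        then show "z \<in> ball x ((2 + L) * s j)" by (simp only: mem_ball distrib_right)
      qed
      then show ?thesis using that by (simp add: V_def)
    qed
    have 1: "ennreal \<bar>ball_avg f (\<gamma> (\<tau> j)) (\<rho> j) - ball_avg f (\<gamma> (\<tau> (j + 1))) (\<rho> j)\<bar> \<le> ennreal (2 * 5 ^ DIM('a) * ?q) * ?N"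
      unfolding \<omega>_def
    proof (rule ball_avg_along_curve[OF f \<tau>_mono _ \<rho>_pos])
      show "continuous_on {\<tau> j..\<tau> (j + 1)} \<gamma>" using \<tau>(1)[of j] \<tau>(2)[of "j+1"] by (intro continuous_on_subset[OF \<gamma>(1)]) auto
      fix t assume t: "t \<in> {\<tau> j..\<tau> (j + 1)}"
      have "2 * \<rho> j \<le> L * s j" using \<rho>_le[of j] mult_pos_pos[OF L s_pos[of j]] by linarith
      then show "ball (\<gamma> t) (2 * \<rho> j) \<subseteq> V j"
        using t \<tau>(1)[of j] \<tau>(2)[of "j+1"] j by (intro inV ball_sub) auto
    qed auto
    have 2: "ennreal \<bar>ball_avg f (\<gamma> (\<tau> (j + 1))) (\<rho> j) - ball_avg f (\<gamma> (\<tau> (j + 1))) (\<rho> (j + 1))\<bar> \<le> ennreal (D * \<rho> j / (\<omega> * \<rho> j ^ DIM('a))) * ?N"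
      unfolding \<omega>_def
    proof (rule ball_avg_diff[OF f _ \<rho>_pos order.refl \<rho>_Suc(1)])
      show "dist (\<gamma> (\<tau> (j + 1))) (\<gamma> (\<tau> (j + 1))) + \<bar>\<rho> j - \<rho> (j + 1)\<bar> \<le> D * \<rho> j" using \<rho>_Suc[of j] \<rho>_pos[of j] by simp
      fix t :: real assume t: "0 \<le> t" "t \<le> 1"
      have "t * (\<rho> (j + 1) - \<rho> j) \<le> 1 * (\<rho> (j + 1) - \<rho> j)" using t \<rho>_Suc(1)[of j] by (intro mult_right_mono) auto
      then have "ball (\<gamma> (\<tau> (j + 1))) (\<rho> j + t * (\<rho> (j + 1) - \<rho> j)) \<subseteq> ball (\<gamma> (\<tau> (j + 1))) (\<rho> (j + 1))"
        by (intro subset_ball) simp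
      also have "\<dots> \<subseteq> V j"
      proof (rule inV)
        show "\<rho> (j + 1) \<le> L * s j" using \<rho>_le[of "j + 1"] mult_pos_pos[OF L s_pos[of j]] s_Suc[of j] \<rho>_pos[of "j+1"] by simp
        have "ball (\<gamma> (\<tau> (j + 1))) (\<rho> (j + 1)) \<subseteq> ball (\<gamma> (\<tau> (j + 1))) (2 * \<rho> (j + 1))"
          using \<rho>_pos[of "j+1"] by (intro subset_ball) simp
        also have "\<dots> \<subseteq> U" using \<tau>[of "j+1"] j by (intro ball_sub) auto
        finally show "ball (\<gamma> (\<tau> (j + 1))) (\<rho> (j + 1)) \<subseteq> U" .
      qed (use \<tau> in auto)
      finally show "ball (\<gamma> (\<tau> (j + 1)) + t *\<^sub>R (\<gamma> (\<tau> (j + 1)) - \<gamma> (\<tau> (j + 1)))) (\<rho> j + t * (\<rho> (j + 1) - \<rho> j)) \<subseteq> V j" by simp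
    qed auto
    have "ennreal \<bar>ball_avg f (\<gamma> (\<tau> j)) (\<rho> j) - ball_avg f (\<gamma> (\<tau> (j + 1))) (\<rho> (j + 1))\<bar>
       \<le> ennreal (\<bar>ball_avg f (\<gamma> (\<tau> j)) (\<rho> j) - ball_avg f (\<gamma> (\<tau> (j + 1))) (\<rho> j)\<bar> + 
           \<bar>ball_avg f (\<gamma> (\<tau> (j + 1))) (\<rho> j) - ball_avg f (\<gamma> (\<tau> (j + 1))) (\<rho> (j + 1))\<bar>)"
      by (intro ennreal_leI) linarith
    also have "\<dots> \<le> ennreal (2 * 5 ^ DIM('a) * ?q) * ?N + ennreal (D * ?q) * ?N"
      using add_mono[OF 1 2] by simp
    also have "\<dots> = (ennreal (2 * 5 ^ DIM('a) * ?q) + ennreal (D * ?q)) * ?N" by (simp only: distrib_right)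
    also have "ennreal (2 * 5 ^ DIM('a) * ?q) + ennreal (D * ?q) = ennreal (2 * 5 ^ DIM('a) * ?q + D * ?q)"
      using q D by (intro ennreal_plus[symmetric] mult_nonneg_nonneg) auto
    also have "2 * 5 ^ DIM('a) * ?q + D * ?q = (2 * 5 ^ DIM('a) + D) * ?q" by (simp only: distrib_right)
    also have "ennreal \<dots> * ?N = e j" by (simp only: e_def)
    finally show ?thesis .
  qed
  \<comment> \<open>\<open>z 0\<close> is the average over the end ball. As the index grows the
    balls shrink to x, so \<open>z\<close> tends to \<open>f x\<close> and the telescoping sum
    bounds \<open>f x - z 0\<close>.\<close>
  define z where "z i = ball_avg f (\<gamma> (\<tau> (N - int i))) (\<rho> (N - int i))" for i
  have "ennreal \<bar>z k - z 0\<bar> \<le> (\<Sum>i<k. e (N - 1 - int i))" for k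
  proof (induction k)
    case (Suc k)
    have le: "ennreal \<bar>z (Suc k) - z k\<bar> \<le> e (N - 1 - int k)"
      using step[of "N - 1 - int k"] by (simp add: z_def algebra_simps)
    have "ennreal \<bar>z (Suc k) - z k\<bar> + ennreal \<bar>z k - z 0\<bar> \<le> (\<Sum>i<Suc k. e (N - 1 - int i))"
      using add_mono[OF le Suc] by (simp add: add.commute)
    moreover have "ennreal \<bar>z (Suc k) - z 0\<bar> \<le> ennreal (\<bar>z (Suc k) - z k\<bar> + \<bar>z k - z 0\<bar>)" by (intro ennreal_leI) linarith
    ultimately show ?case by simp
  qed simp
  then have bound: "ennreal \<bar>z k - z 0\<bar> \<le> (\<Sum>i. e (N - 1 - int i))" for k
    by (rule order_trans) (rule sum_le_suminf, auto)
  have "z \<longlonglongrightarrow> f x"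
  proof (rule LIMSEQ_I)
    fix r :: real assume r: "0 < r"
    have "continuous_on UNIV f" by (rule C1_gradient_continuous[OF f])
    then obtain d where d: "0 < d" "\<And>y. dist y x < d \<Longrightarrow> dist (f y) (f x) < r/2"
      using r unfolding continuous_on_iff by (meson half_gt_zero UNIV_I)
    have "(\<lambda>i. (1/2) ^ i) \<longlonglongrightarrow> (0::real)" by (rule LIMSEQ_realpow_zero) auto
    then have "(\<lambda>i. (1 + L) * s N * (1/2) ^ i) \<longlonglongrightarrow> (1 + L) * s N * 0"
      by (rule tendsto_mult[OF tendsto_const])
    then have "\<forall>\<^sub>F i in sequentially. (1 + L) * s N * (1/2) ^ i < d"
      using d(1) by (intro order_tendstoD) auto
    then obtain k where k: "\<And>i. k \<le> i \<Longrightarrow> (1 + L) * s N * (1/2) ^ i < d" by (auto simp: eventually_sequentially)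
    show "\<exists>k. \<forall>i\<ge>k. norm (z i - f x) < r"
    proof (intro exI allI impI)
      fix i assume i: "k \<le> i"
      have si: "s (N - int i) = s N * (1/2) ^ i" by (simp add: s_def power_int_diff power_divide)
      have "\<bar>z i - f x\<bar> \<le> r / 2" unfolding z_def
      proof (rule ball_avg_near[OF C1_gradient_continuous[OF f] \<rho>_pos])
        fix y assume y: "y \<in> ball (\<gamma> (\<tau> (N - int i))) (\<rho> (N - int i))"
        have "dist x y \<le> dist x (\<gamma> (\<tau> (N - int i))) + dist (\<gamma> (\<tau> (N - int i))) y" by (rule dist_triangle)
        also have "\<dots> \<le> s (N - int i) + L * s (N - int i)"
          using y dist_le[of "\<tau> (N - int i)" "N - int i"] \<tau>(1)[of "N - int i"] \<rho>_le[of "N - int i"] \<rho>_pos[of "N - int i"] mult_pos_pos[OF L s_pos[of "N - int i"]]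
          by (intro add_mono) auto
        also have "\<dots> < d" using k[OF i] by (simp add: si algebra_simps)
        finally have "dist (f y) (f x) < r / 2" by (intro d(2)) (simp add: dist_commute)
        then show "\<bar>f y - f x\<bar> \<le> r / 2" by (simp add: dist_real_def)
      qed
      then show "norm (z i - f x) < r" using r by simp
    qed
  qed
  then have "(\<lambda>k. ennreal \<bar>z k - z 0\<bar>) \<longlonglongrightarrow> ennreal \<bar>f x - z 0\<bar>" by (intro tendsto_intros)
  then have "ennreal \<bar>f x - z 0\<bar> \<le> (\<Sum>i. e (N - 1 - int i))"
    by (rule LIMSEQ_le_const2) (use bound in blast)
  then show ?thesis by (simp add: z_def \<tau>_N e_def V_def \<rho>_def s_def \<omega>_def)
qed


section \<open>Arc length, dyadic scales and the estimate for a pair of points\<close>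

lemma curve_length_mono:
  assumes "a' \<le> a" "b \<le> b'" shows "curve_length \<gamma> a b \<le> curve_length \<gamma> a' b'"
  unfolding curve_length_def using assms by (intro SUP_subset_mono) auto

lemma dist_le_curve_length:
  assumes "a \<le> b" shows "ennreal (dist (\<gamma> a) (\<gamma> b)) \<le> curve_length \<gamma> a b"
proof -
  have "ennreal (\<Sum>i<length [a, b] - 1. dist (\<gamma> ([a, b] ! i)) (\<gamma> ([a, b] ! Suc i))) \<le> curve_length \<gamma> a b"
    unfolding curve_length_def using assms by (intro SUP_upper) auto
  then show ?thesis by simp
qed

text \<open>A carrot with top scale \<open>N\<close> uses only the scales below \<open>N\<close>. As
  the terms are nonnegative, the sum may be extended to all integers, and the bound then no longer
  depends on \<open>N\<close>, that is, on the size of the arc. The split at 0 separates the scales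
  below the reference radius from the others.\<close>

lemma suminf_int_shift_le:
  fixes e :: "int \<Rightarrow> ennreal"
  shows "(\<Sum>i. e (N - 1 - int i)) \<le> (\<Sum>i. e (- 1 - int i)) + (\<Sum>i. e (int i))"
proof (rule suminf_le_const[OF summableI])
  fix k :: nat
  define A where "A = (\<lambda>i. N - 1 - int i) ` {..<k}"
  define m where "m = k + nat \<bar>N\<bar>"
  have "(\<Sum>i<k. e (N - 1 - int i)) = sum e A"
    unfolding A_def by (subst sum.reindex) (auto simp: inj_on_def)
  also have "\<dots> \<le> sum e ((\<lambda>i. - 1 - int i) ` {..<m} \<union> int ` {..<m})"
  proof (rule sum_mono2)
    show "A \<subseteq> (\<lambda>i. - 1 - int i) ` {..<m} \<union> int ` {..<m}"
    proof
      fix j assume "j \<in> A"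
      then obtain i where i: "i < k" "j = N - 1 - int i" by (auto simp: A_def)
      show "j \<in> (\<lambda>i. - 1 - int i) ` {..<m} \<union> int ` {..<m}"
      proof (cases "0 \<le> j")
        case True
        then have "j = int (nat j)" "nat j < m" using i by (auto simp: m_def)
        then show ?thesis by blast
      next
        case False
        then have "j = - 1 - int (nat (- 1 - j))" "nat (- 1 - j) < m" using i by (auto simp: m_def)
        then show ?thesis by blast
      qed
    qed
  qed auto
  also have "\<dots> = sum e ((\<lambda>i. - 1 - int i) ` {..<m}) + sum e (int ` {..<m})"
    by (rule sum.union_disjoint) auto
  also have "\<dots> = (\<Sum>i<m. e (- 1 - int i)) + (\<Sum>i<m. e (int i))"
    by (subst (1 2) sum.reindex) (auto simp: inj_on_def)
  also have "\<dots> \<le> (\<Sum>i. e (- 1 - int i)) + (\<Sum>i. e (int i))"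
    by (intro add_mono sum_le_suminf) auto
  finally show "(\<Sum>i<k. e (N - 1 - int i)) \<le> (\<Sum>i. e (- 1 - int i)) + (\<Sum>i. e (int i))" .
qed

lemma ex_dyadic_scale: fixes M R :: real assumes "0 < M" "0 < R" shows "\<exists>N::int. M \<le> R * 2 powi N \<and> R * 2 powi N < 2 * M"
proof -
  define N where "N = \<lceil>log 2 (M / R)\<rceil>"
  have p: "2 powi N = 2 powr real_of_int N" by (simp add: powr_real_of_int')
  have "M / R = 2 powr log 2 (M / R)" using assms by simp
  also have "\<dots> \<le> 2 powi N" unfolding p by (intro powr_mono) (auto simp: N_def)
  finally have 1: "M / R \<le> 2 powi N" .
  have "2 powi N < 2 powr (1 + log 2 (M / R))" unfolding p N_def[symmetric] using of_int_ceiling_diff_one_le[of "log 2 (M / R)"]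
    by (intro powr_less_mono) (unfold N_def, linarith, simp)
  also have "\<dots> = 2 * (M / R)" using assms by (simp add: powr_add)
  finally have 2: "2 powi N < 2 * (M / R)" .
  show ?thesis using 1 2 assms by (intro exI[of _ N]) (simp add: field_simps)
qed

text \<open>
  Both carrots end in the same ball, centred at the point where the lengths of the two parts of
  the curve balance.
\<close>
lemma cigar_john_pair_estimate:
  fixes f :: "'a::euclidean_space \<Rightarrow> real" and \<theta> :: "real \<Rightarrow> real"
  assumes f: "C1_gradient f G" and U: "U \<in> sets borel" and john: "cigar_john \<phi> cJ U"
    and \<theta>: "\<And>s. 0 < s \<Longrightarrow> \<theta> s = psi \<phi> s / cJ"
    and \<theta>pos: "\<And>s. 0 < s \<Longrightarrow> 0 < \<theta> s" and \<theta>mono: "\<And>s t. 0 < s \<Longrightarrow> s \<le> t \<Longrightarrow> \<theta> s \<le> \<theta> t"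
    and \<theta>lin: "\<And>s. 0 < s \<Longrightarrow> \<theta> s \<le> L * s" and \<theta>dbl: "\<And>s. 0 < s \<Longrightarrow> \<theta> (2 * s) \<le> D * \<theta> s"
    and R: "0 < R" and xy: "x \<in> U" "y \<in> U" "x \<noteq> y"
    and e_def: "\<And>z j. e z j = ennreal ((2 * 5 ^ DIM('a) + D) * ((\<theta> (R * 2 powi j / 4) / 2)
              / (unit_ball_vol (real DIM('a)) * (\<theta> (R * 2 powi j / 4) / 2) ^ DIM('a))))
        * (\<integral>\<^sup>+w\<in>U \<inter> ball z ((2 + L) * (R * 2 powi j)). ennreal (norm (G w)) \<partial>lborel)"
  shows "ennreal \<bar>f x - f y\<bar> \<le> ((\<Sum>i. e x (- 1 - int i)) + (\<Sum>i. e x (int i)))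
     + ((\<Sum>i. e y (- 1 - int i)) + (\<Sum>i. e y (int i)))"
proof -
  obtain \<gamma> where arc: "arc \<gamma>" and ends: "\<gamma> 0 = x" "\<gamma> 1 = y" and fin: "curve_length \<gamma> 0 1 < \<infinity>"
    and cig: "\<And>t. t \<in> {0<..<1} \<Longrightarrow> 
       ball (\<gamma> t) (psi \<phi> (enn2real (min (curve_length \<gamma> 0 t) (curve_length \<gamma> t 1))) / cJ) \<subseteq> U"
    using john xy unfolding cigar_john_def pathstart_def pathfinish_def by metis
  have cont: "continuous_on {0..1} \<gamma>" using arc by (simp add: arc_def path_def)
  have inj: "\<gamma> s \<noteq> \<gamma> t" if "s \<in> {0..1}" "t \<in> {0..1}" "s \<noteq> t" for s t
    using arc that by (auto simp: arc_def inj_on_def)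
  define q1 where "q1 t = enn2real (curve_length \<gamma> 0 t)" for t
  define q2 where "q2 t = enn2real (curve_length \<gamma> t 1)" for t
  define q where "q t = min (q1 t) (q2 t)" for t
  define L0 where "L0 = enn2real (curve_length \<gamma> 0 1)"
  have fin': "curve_length \<gamma> a b < \<infinity>" if "0 \<le> a" "b \<le> 1" for a b
    using curve_length_mono[of 0 a b 1 \<gamma>] that fin by (metis le_less_trans)
  have q1_mono: "q1 s \<le> q1 t" if "s \<le> t" "t \<le> 1" for s t
    unfolding q1_def using that fin'[of 0 t] by (intro enn2real_mono curve_length_mono) auto
  have q2_mono: "q2 t \<le> q2 s" if "s \<le> t" "0 \<le> s" for s t
    unfolding q2_def using that fin'[of s 1] by (intro enn2real_mono curve_length_mono) auto
  have q1_le: "q1 t \<le> L0" if "t \<le> 1" for t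
    using q1_mono[of t 1] that by (simp add: q1_def L0_def)
  have q1_dist: "dist x (\<gamma> t) \<le> q1 t" if "0 \<le> t" "t \<le> 1" for t
  proof -
    have "enn2real (ennreal (dist x (\<gamma> t))) \<le> q1 t"
      unfolding q1_def using that fin'[of 0 t] dist_le_curve_length[of 0 t \<gamma>] ends by (intro enn2real_mono) auto
    then show ?thesis by simp
  qed
  have q2_dist: "dist y (\<gamma> t) \<le> q2 t" if "0 \<le> t" "t \<le> 1" for t
  proof -
    have "enn2real (ennreal (dist y (\<gamma> t))) \<le> q2 t"
      unfolding q2_def using that fin'[of t 1] dist_le_curve_length[of t 1 \<gamma>] ends 
      by (intro enn2real_mono) (auto simp: dist_commute)
    then show ?thesis by simp
  qed
  \<comment> \<open>An arc is injective, so interior points differ from both ends and both partial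
    lengths are positive; the formula for \<open>\<theta>\<close> is available for positive
    arguments only.\<close>
  have q_pos: "0 < q t" if "0 < t" "t < 1" for t
    using q1_dist[of t] q2_dist[of t] inj[of 0 t] inj[of 1 t] that ends
    unfolding q_def by (auto simp: less_le_trans[OF zero_less_dist_iff[THEN iffD2]])
  have ballU: "ball (\<gamma> t) (\<theta> (q t)) \<subseteq> U" if "0 < t" "t < 1" for t
  proof -
    have "enn2real (min (curve_length \<gamma> 0 t) (curve_length \<gamma> t 1)) = q t"
      unfolding q_def q1_def q2_def using that fin'[of 0 t] fin'[of t 1]
      by (cases "curve_length \<gamma> 0 t"; cases "curve_length \<gamma> t 1") (auto simp: min_def)
    then show ?thesis using cig[of t] that \<theta>[OF q_pos[OF that]] by simp
  qed
  \<comment> \<open>Before the supremum T of these times \<open>q\<close> is the nondecreasing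
    \<open>q1\<close>, after it the nonincreasing \<open>q2\<close>.\<close>
  define S where "S = insert 0 {t. 0 < t \<and> t < 1 \<and> q1 t \<le> q2 t}"
  define T where "T = Sup S"
  have bdd: "bdd_above S" by (rule bdd_aboveI[of _ 1]) (auto simp: S_def)
  have T: "0 \<le> T" "T \<le> 1" unfolding T_def by (auto intro!: cSup_upper bdd cSup_least) (auto simp: S_def)
  have lo: "q t = q1 t" if "0 < t" "t < T" for t
  proof -
    have "\<exists>u\<in>S. t < u" using that(2) by (intro less_cSupD) (auto simp: T_def S_def)
    then obtain u where u: "u \<in> S" "t < u" by blast
    then have "q1 t \<le> q1 u" "q1 u \<le> q2 u" "q2 u \<le> q2 t" using that by (auto simp: S_def intro: q1_mono q2_mono)
    then show ?thesis by (simp add: q_def)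
  qed
  have hi: "q t = q2 t" if "T < t" "t < 1" for t
  proof -
    have "t \<notin> S" using cSup_upper[OF _ bdd, of t] that by (auto simp: T_def)
    then show ?thesis using that T by (auto simp: S_def q_def)
  qed
  \<comment> \<open>The supremum is not assumed to be attained, hence the half: some t0 has
    \<open>q t0\<close> > M/2. Moving from t0 towards T, from either side, \<open>q\<close> does not
    decrease, so the ball of radius \<theta>(M/2) fits at T in the limit.\<close>
  define M where "M = Sup (q ` {0<..<1})"
  have bddq: "bdd_above (q ` {0<..<1})"
    by (rule bdd_aboveI[of _ L0]) (auto simp: q_def intro!: min.coboundedI1 q1_le)
  have q_le: "q t \<le> M" if "0 < t" "t < 1" for t
    unfolding M_def using that by (intro cSup_upper bddq) auto
  have M: "0 < M" using q_le[of "1/2"] q_pos[of "1/2"] by simp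
  have "M / 2 < Sup (q ` {0<..<1})" using M by (simp add: M_def)
  then obtain t0 where t0: "0 < t0" "t0 < 1" "M / 2 < q t0"
    using bddq by (subst (asm) less_cSup_iff) auto
  have subT: "ball (\<gamma> T) (\<theta> (M / 2)) \<subseteq> U"
  proof -
    have big: "ball (\<gamma> t) (\<theta> (M / 2)) \<subseteq> U" if "0 < t" "t < 1" "q t0 \<le> q t" for t
    proof -
      have "\<theta> (M / 2) \<le> \<theta> (q t)" using that t0 M by (intro \<theta>mono) auto
      then show ?thesis using ballU[of t] that by (meson order_trans subset_ball)
    qed
    consider "t0 = T" | "t0 < T" | "T < t0" by linarith
    then show ?thesis
    proof cases
      case 1 then show ?thesis using big[of T] t0 by simp
    next
      case 2
      show ?thesis
      proof (rule ball_subset_of_limit[OF cont])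
        show "T islimpt {t0<..<T}" by (rule islimpt_greaterThanLessThan2[OF 2])
        show "ball (\<gamma> t) (\<theta> (M / 2)) \<subseteq> U" if "t \<in> {t0<..<T}" for t
          using that t0 T 2 lo[of t] lo[of t0] q1_mono[of t0 t] by (intro big) auto
      qed (use t0 T in auto)
    next
      case 3
      show ?thesis
      proof (rule ball_subset_of_limit[OF cont])
        show "T islimpt {T<..<t0}" by (rule islimpt_greaterThanLessThan1[OF 3])
        show "ball (\<gamma> t) (\<theta> (M / 2)) \<subseteq> U" if "t \<in> {T<..<t0}" for t
          using that t0 T 3 hi[of t] hi[of t0] q2_mono[of t t0] by (intro big) auto
      qed (use t0 T in auto)
    qed
  qed
  \<comment> \<open>The top scale is fixed by \<open>M\<close> and \<open>R\<close>, so both carrots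
    end in the same average \<open>A\<close>, which cancels in the difference.\<close>
  obtain N :: int where N: "M \<le> R * 2 powi N" "R * 2 powi N < 2 * M"
    using ex_dyadic_scale[OF M R] by blast
  define A where "A = ball_avg f (\<gamma> T) (\<theta> (R * 2 powi N / 4) / 2)"
  have X: "ennreal \<bar>f x - A\<bar> \<le> (\<Sum>i. e x (N - 1 - int i))"
    unfolding A_def e_def
  proof (rule carrot_chain[where m = q1, OF f U \<theta>pos \<theta>mono \<theta>lin \<theta>dbl T(1) _ ends(1) _ _ _ _ subT R N])
    show "continuous_on {0..T} \<gamma>" using T by (intro continuous_on_subset[OF cont]) auto
    show "q1 s \<le> q1 t" if "0 < s" "s \<le> t" "t < T" for s t using that T by (intro q1_mono) auto
    show "dist x (\<gamma> t) \<le> q1 t" if "0 < t" "t < T" for t using that T by (intro q1_dist) auto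
    show "q1 t \<le> M" if "0 < t" "t < T" for t using q_le[of t] lo[of t] that T by auto
    show "ball (\<gamma> t) (\<theta> (q1 t)) \<subseteq> U" if "0 < t" "t < T" for t using ballU[of t] lo[of t] that T by auto
  qed
  \<comment> \<open>The second carrot runs along the reversed curve, whose end time 1 - T is the
    point of the curve at time T.\<close>
  have Y: "ennreal \<bar>f y - ball_avg f (\<gamma> (1 - (1 - T))) (\<theta> (R * 2 powi N / 4) / 2)\<bar> \<le> (\<Sum>i. e y (N - 1 - int i))"
    unfolding e_def
  proof (rule carrot_chain[where m = "\<lambda>t. q2 (1 - t)" and M = M and T = "1 - T" and \<gamma> = "\<lambda>t. \<gamma> (1 - t)", OF f U \<theta>pos \<theta>mono \<theta>lin \<theta>dbl _ _ _ _ _ _ _ _ R N])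
    show "continuous_on {0..1 - T} (\<lambda>t. \<gamma> (1 - t))" using T by (intro continuous_on_compose2[OF cont] continuous_intros) auto
    show "q2 (1 - s) \<le> q2 (1 - t)" if "0 < s" "s \<le> t" "t < 1 - T" for s t using that T by (intro q2_mono) auto
    show "dist y (\<gamma> (1 - t)) \<le> q2 (1 - t)" if "0 < t" "t < 1 - T" for t using that T by (intro q2_dist) auto
    show "q2 (1 - t) \<le> M" if "0 < t" "t < 1 - T" for t using q_le[of "1 - t"] hi[of "1 - t"] that T by auto
    show "ball (\<gamma> (1 - t)) (\<theta> (q2 (1 - t))) \<subseteq> U" if "0 < t" "t < 1 - T" for t using ballU[of "1 - t"] hi[of "1 - t"] that T by auto
  qed (use T ends subT in auto)
  then have Y: "ennreal \<bar>f y - A\<bar> \<le> (\<Sum>i. e y (N - 1 - int i))" by (simp add: A_def)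
  have "ennreal \<bar>f x - f y\<bar> \<le> ennreal (\<bar>f x - A\<bar> + \<bar>f y - A\<bar>)" by (intro ennreal_leI) linarith
  also have "\<dots> \<le> (\<Sum>i. e x (N - 1 - int i)) + (\<Sum>i. e y (N - 1 - int i))" using add_mono[OF X Y] by simp
  also have "\<dots> \<le> ((\<Sum>i. e x (- 1 - int i)) + (\<Sum>i. e x (int i)))
     + ((\<Sum>i. e y (- 1 - int i)) + (\<Sum>i. e y (int i)))"
    by (intro add_mono suminf_int_shift_le)
  finally show ?thesis .
qed

section \<open>The weak-type estimate\<close>


context orlicz_growth begin

text \<open>One dyadic shell, at distance about \<open>s\<close>, of the Riesz-type potential with kernel \<open>1 / \<psi> s ^ (n - 1)\<close>.\<close>
definition pot :: "real \<Rightarrow> 'a set \<Rightarrow> ('a::euclidean_space \<Rightarrow> 'a) \<Rightarrow> real \<Rightarrow> 'a \<Rightarrow> ennreal" where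
  "pot K U g s x = ennreal (1 / \<psi> s ^ (n - 1)) * (\<integral>\<^sup>+w\<in>U \<inter> ball x (K * s). ennreal (norm (g w)) \<partial>lborel)"

lemma Lam_pos: "0 < \<Lambda>"
  using lin[of 1] pos[of 1] by simp

lemma pot_pair_estimate:
  assumes n: "n = DIM('a::euclidean_space)" and \<psi>: "\<psi> = psi \<phi>" and cJ: "0 < cJ"
  shows "\<exists>C>0. \<exists>K>0. \<forall>(U :: 'a set) f g x y R. C1_gradient f g \<and> U \<in> sets borel \<and> cigar_john \<phi> cJ U \<and>
     0 < R \<and> x \<in> U \<and> y \<in> U \<and> x \<noteq> y \<longrightarrow>
     ennreal \<bar>f x - f y\<bar> \<le> ennreal C *
       (((\<Sum>i. pot K U g (R * 2 powi (- 1 - int i)) x) + (\<Sum>i. pot K U g (R * 2 powi (int i)) x))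
      + ((\<Sum>i. pot K U g (R * 2 powi (- 1 - int i)) y) + (\<Sum>i. pot K U g (R * 2 powi (int i)) y)))"
proof -
  define \<omega> where "\<omega> = unit_ball_vol (real DIM('a))"
  define D where "D = (2::real) powr \<alpha>"
  define L where "L = \<Lambda> / cJ"
  \<comment> \<open>By \<open>lower\<close> with the factor 1/4, the chain radius \<theta>(s/4)/2 is
    at least c \<psi>(s); this lets the kernel be written with \<psi>(s) itself.\<close>
  define c where "c = (1/4) powr \<alpha> / (2 * cJ)"
  define C where "C = (2 * 5 ^ DIM('a) + D) / (\<omega> * c ^ (n - 1))"
  define K where "K = 2 + L"
  define \<theta> where "\<theta> s = \<psi> s / cJ" for s
  have \<omega>: "0 < \<omega>" by (simp add: \<omega>_def)
  have c: "0 < c" using cJ by (simp add: c_def)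
  have D: "0 < D" by (simp add: D_def)
  have C: "0 < C" using D \<omega> c by (simp add: C_def add_pos_pos)
  have K: "0 < K" using Lam_pos cJ by (simp add: K_def L_def add_pos_pos)
  have main: "ennreal \<bar>f x - f y\<bar> \<le> ennreal C *
       (((\<Sum>i. pot K U g (R * 2 powi (- 1 - int i)) x) + (\<Sum>i. pot K U g (R * 2 powi (int i)) x))
      + ((\<Sum>i. pot K U g (R * 2 powi (- 1 - int i)) y) + (\<Sum>i. pot K U g (R * 2 powi (int i)) y)))"
    if A: "C1_gradient f g" "U \<in> sets borel" "cigar_john \<phi> cJ U" "0 < R" "x \<in> U" "y \<in> U" "x \<noteq> y"
    for U :: "'a set" and f g x y R
  proof -
    define e where "e z j = ennreal ((2 * 5 ^ DIM('a) + D) * ((\<theta> (R * 2 powi j / 4) / 2)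
              / (unit_ball_vol (real DIM('a)) * (\<theta> (R * 2 powi j / 4) / 2) ^ DIM('a))))
        * (\<integral>\<^sup>+w\<in>U \<inter> ball z ((2 + L) * (R * 2 powi j)). ennreal (norm (g w)) \<partial>lborel)" for z and j :: int
    have le: "e z j \<le> ennreal C * pot K U g (R * 2 powi j) z" for z j
    proof -
      define s where "s = R * 2 powi j"
      define \<rho> where "\<rho> = \<theta> (s / 4) / 2"
      have s: "0 < s" using A by (simp add: s_def)
      have ps: "0 < \<psi> s" using s by (rule pos)
      have "c * \<psi> s \<le> \<rho>" using lower[of "1/4" s] s cJ by (simp add: c_def \<rho>_def \<theta>_def field_simps)
      moreover have "0 < c * \<psi> s" using c ps by simp
      ultimately have \<rho>: "(c * \<psi> s) ^ (n - 1) \<le> \<rho> ^ (n - 1)" "0 < \<rho>"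
        by (auto intro!: power_mono simp: less_imp_le)
      have "\<rho> / (\<omega> * \<rho> ^ DIM('a)) = 1 / (\<omega> * \<rho> ^ (n - 1))"
        using \<rho> n2 \<omega> unfolding n[symmetric] by (cases n) auto
      also have "\<dots> \<le> 1 / (\<omega> * (c * \<psi> s) ^ (n - 1))"
        using \<rho> \<omega> c ps by (intro divide_left_mono mult_left_mono mult_pos_pos) auto
      finally have "(2 * 5 ^ DIM('a) + D) * (\<rho> / (\<omega> * \<rho> ^ DIM('a))) \<le> (2 * 5 ^ DIM('a) + D) * (1 / (\<omega> * (c * \<psi> s) ^ (n - 1)))"
        using D by (intro mult_left_mono) auto
      also have "\<dots> = C * (1 / \<psi> s ^ (n - 1))"
        by (simp add: C_def power_mult_distrib)
      finally have *: "(2 * 5 ^ DIM('a) + D) * (\<rho> / (\<omega> * \<rho> ^ DIM('a))) \<le> C * (1 / \<psi> s ^ (n - 1))" .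
      have "e z j = ennreal ((2 * 5 ^ DIM('a) + D) * (\<rho> / (\<omega> * \<rho> ^ DIM('a)))) * (\<integral>\<^sup>+w\<in>U \<inter> ball z (K * s). ennreal (norm (g w)) \<partial>lborel)"
        by (simp only: e_def \<rho>_def s_def \<omega>_def K_def)
      also have "\<dots> \<le> ennreal (C * (1 / \<psi> s ^ (n - 1))) * (\<integral>\<^sup>+w\<in>U \<inter> ball z (K * s). ennreal (norm (g w)) \<partial>lborel)"
        using * by (intro mult_right_mono ennreal_leI) auto
      also have "\<dots> = ennreal C * pot K U g s z"
      proof -
        have "ennreal (C * (1 / \<psi> s ^ (n - 1))) = ennreal C * ennreal (1 / \<psi> s ^ (n - 1))"
          using C by (intro ennreal_mult') auto
        then show ?thesis by (simp only: pot_def mult.assoc)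
      qed
      finally show ?thesis by (simp add: s_def)
    qed
    have sums: "(\<Sum>i. e z (h i)) \<le> ennreal C * (\<Sum>i. pot K U g (R * 2 powi (h i)) z)" for z and h :: "nat \<Rightarrow> int"
      unfolding ennreal_suminf_cmult[symmetric] by (intro suminf_le le summableI)
    have "ennreal \<bar>f x - f y\<bar> \<le> ((\<Sum>i. e x (- 1 - int i)) + (\<Sum>i. e x (int i)))
     + ((\<Sum>i. e y (- 1 - int i)) + (\<Sum>i. e y (int i)))"
    proof (rule cigar_john_pair_estimate[OF A(1-3) _ _ _ _ _ A(4-7) e_def])
      fix s :: real assume s: "0 < s"
      show "\<theta> s = psi \<phi> s / cJ" by (simp add: \<theta>_def \<psi>)
      show "0 < \<theta> s" using pos[OF s] cJ by (simp add: \<theta>_def)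
      show "\<theta> s \<le> \<theta> t" if "s \<le> t" for t using psi_mono[OF s that] cJ by (simp add: \<theta>_def divide_right_mono)
      show "\<theta> s \<le> L * s" using lin[OF s] cJ by (simp add: \<theta>_def L_def divide_right_mono)
      show "\<theta> (2 * s) \<le> D * \<theta> s" using psi_scale_le[of 2 s] s cJ by (simp add: \<theta>_def D_def divide_right_mono)
    qed
    also have "\<dots> \<le> (ennreal C * (\<Sum>i. pot K U g (R * 2 powi (- 1 - int i)) x) + ennreal C * (\<Sum>i. pot K U g (R * 2 powi (int i)) x))
      + (ennreal C * (\<Sum>i. pot K U g (R * 2 powi (- 1 - int i)) y) + ennreal C * (\<Sum>i. pot K U g (R * 2 powi (int i)) y))"
      by (intro add_mono sums)
    finally show ?thesis by (simp only: distrib_left)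
  qed
  show ?thesis
    by (rule exI[of _ C], rule conjI[OF C], rule exI[of _ K], rule conjI[OF K]) (use main in blast)
qed

section \<open>Uniform and weak-type bounds for a single shell\<close>

lemma young_split: assumes "0 \<le> h" "0 < \<kappa>'" shows "h \<le> \<kappa>' + \<kappa>' powr (1 - p) * h powr p"
proof (cases "h \<le> \<kappa>'")
  case True
  moreover have "0 \<le> \<kappa>' powr (1 - p) * h powr p" by simp
  ultimately show ?thesis by linarith
next
  case False
  then have "h = h powr (1 - p) * h powr p" using assms by (simp flip: powr_add)
  also have "\<dots> \<le> \<kappa>' powr (1 - p) * h powr p"
    using False assms p1 by (intro mult_right_mono powr_mono2') auto
  finally show ?thesis using assms by linarith
qed

text \<open>This replaces Hoelder's inequality. Integrating the pointwise split leaves a free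
  parameter \<open>\<kappa>'\<close> (unrelated to the exponent \<open>\<kappa>\<close>), which is
  chosen once to balance the two terms and once to absorb the first one. The case p = 1 is
  included.\<close>

lemma local_young:
  fixes g :: "'a::euclidean_space \<Rightarrow> 'a"
  assumes [measurable]: "U \<in> sets borel" "g \<in> borel_measurable borel" and \<kappa>: "0 < \<kappa>'" and r: "0 \<le> r"
  shows "(\<integral>\<^sup>+w\<in>U \<inter> ball x r. ennreal (norm (g w)) \<partial>lborel)
    \<le> ennreal (\<kappa>' * (unit_ball_vol (real DIM('a)) * r ^ DIM('a)))
      + ennreal (\<kappa>' powr (1 - p)) * (\<integral>\<^sup>+w\<in>U \<inter> ball x r. ennreal (norm (g w) powr p) \<partial>lborel)"
proof -
  define V where "V = U \<inter> ball x r"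
  have [measurable]: "V \<in> sets borel" unfolding V_def by (intro sets.Int assms) auto
  have "(\<integral>\<^sup>+w\<in>V. ennreal (norm (g w)) \<partial>lborel)
    \<le> (\<integral>\<^sup>+w. ennreal \<kappa>' * indicator V w + ennreal (\<kappa>' powr (1 - p)) * (ennreal (norm (g w) powr p) * indicator V w) \<partial>lborel)"
  proof (intro nn_integral_mono)
    fix w
    have "ennreal (norm (g w)) \<le> ennreal (\<kappa>' + \<kappa>' powr (1 - p) * norm (g w) powr p)"
      using young_split[of "norm (g w)" \<kappa>'] \<kappa> by (intro ennreal_leI) auto
    also have "\<dots> = ennreal \<kappa>' + ennreal (\<kappa>' powr (1 - p)) * ennreal (norm (g w) powr p)"
      using \<kappa> by (simp add: ennreal_mult')
    finally show "ennreal (norm (g w)) * indicator V w \<le> ennreal \<kappa>' * indicator V w + ennreal (\<kappa>' powr (1 - p)) * (ennreal (norm (g w) powr p) * indicator V w)"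
      by (auto simp: indicator_def)
  qed
  also have "\<dots> = ennreal \<kappa>' * emeasure lborel V + ennreal (\<kappa>' powr (1 - p)) * (\<integral>\<^sup>+w\<in>V. ennreal (norm (g w) powr p) \<partial>lborel)"
    by (subst nn_integral_add) (auto simp: nn_integral_cmult nn_integral_cmult_indicator)
  also have "emeasure lborel V \<le> emeasure lborel (ball x r)" by (intro emeasure_mono) (auto simp: V_def)
  also have "ennreal \<kappa>' * emeasure lborel (ball x r) = ennreal (\<kappa>' * (unit_ball_vol (real DIM('a)) * r ^ DIM('a)))"
    using r \<kappa> by (simp add: emeasure_ball ennreal_mult')
  finally show ?thesis unfolding V_def by (simp add: add_mono mult_left_mono)
qed

text \<open>Up to constants the right-hand side is the volume of a ball of radius s to the power 1 -
  1/p, divided by \<psi>(s)^(n-1): the value that Hoelder's inequality gives for a shell of unit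
  energy.\<close>

lemma F_at_scale: assumes "0 < s" shows "F (s powr - real n) = s powr (real n - real n / p) / \<psi> s ^ (n - 1)"
proof -
  have "(s powr - real n) powr (1 / p - 1) = s powr (real n - real n / p)"
    unfolding powr_powr by (rule arg_cong[where f="\<lambda>e. s powr e"]) (simp add: algebra_simps)
  moreover have "(s powr - real n) powr (- 1 / real n) = s"
    unfolding powr_powr using n2 assms by simp
  ultimately show ?thesis unfolding F_def by simp
qed

lemma pot_le:
  fixes g :: "'a::euclidean_space \<Rightarrow> 'a"
  assumes n: "n = DIM('a)" and U[measurable]: "U \<in> sets borel" and g[measurable]: "g \<in> borel_measurable borel"
    and K: "0 < K" and s: "0 < s" and A: "0 < A" 
    and int: "(\<integral>\<^sup>+w\<in>U. ennreal (norm (g w) powr p) \<partial>lborel) \<le> ennreal (A powr p)"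
  shows "pot K U g s x \<le> ennreal (2 * (unit_ball_vol (real n) * K ^ n) powr (1 - 1 / p) * A * F (s powr - real n))"
proof -
  define w where "w = unit_ball_vol (real n) * K ^ n"
  define v where "v = w * s ^ n"
  have w: "0 < w" using K by (simp add: w_def)
  have v: "0 < v" using w s by (simp add: v_def)
  \<comment> \<open>This value makes the two terms of \<open>local_young\<close> equal: both become
    A v^(1 - 1/p).\<close>
  define k where "k = A * v powr (- 1 / p)"
  have k: "0 < k" using A v by (simp add: k_def)
  have p0: "p \<noteq> 0" using p1 by simp
  have vr: "unit_ball_vol (real DIM('a)) * (K * s) ^ DIM('a) = v" by (simp add: v_def w_def n power_mult_distrib)
  have "(\<integral>\<^sup>+w\<in>U \<inter> ball x (K * s). ennreal (norm (g w) powr p) \<partial>lborel) \<le> (\<integral>\<^sup>+w\<in>U. ennreal (norm (g w) powr p) \<partial>lborel)"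
    by (intro nn_integral_mono) (auto simp: indicator_def)
  then have B: "(\<integral>\<^sup>+w\<in>U \<inter> ball x (K * s). ennreal (norm (g w) powr p) \<partial>lborel) \<le> ennreal (A powr p)" 
    using int by (rule order_trans)
  have "(\<integral>\<^sup>+w\<in>U \<inter> ball x (K * s). ennreal (norm (g w)) \<partial>lborel) \<le> ennreal (k * v) + ennreal (k powr (1 - p)) * ennreal (A powr p)"
  proof (rule order_trans)
    show "(\<integral>\<^sup>+w\<in>U \<inter> ball x (K * s). ennreal (norm (g w)) \<partial>lborel)
      \<le> ennreal (k * v) + ennreal (k powr (1 - p)) * (\<integral>\<^sup>+w\<in>U \<inter> ball x (K * s). ennreal (norm (g w) powr p) \<partial>lborel)"
      using local_young[OF U g k, of "K * s" x] K s unfolding vr by simp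
  qed (intro add_mono mult_left_mono B, auto)
  also have "\<dots> = ennreal (k * v + k powr (1 - p) * A powr p)" using k v by (simp add: ennreal_mult')
  also have "k * v + k powr (1 - p) * A powr p = 2 * A * v powr (1 - 1 / p)"
  proof -
    have "k * v = A * (v powr (- 1 / p) * v powr 1)" using v by (simp add: k_def)
    also have "v powr (- 1 / p) * v powr 1 = v powr (1 - 1 / p)" unfolding powr_add[symmetric] by simp
    finally have 1: "k * v = A * v powr (1 - 1 / p)" .
    have "k powr (1 - p) * A powr p = (A powr (1 - p) * A powr p) * v powr (- 1 / p * (1 - p))"
      using A v by (simp add: k_def powr_mult powr_powr)
    also have "A powr (1 - p) * A powr p = A" using A by (simp flip: powr_add)
    also have "- 1 / p * (1 - p) = 1 - 1 / p" using p0 by (simp add: field_simps)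
    finally show ?thesis using 1 by simp
  qed
  finally have "pot K U g s x \<le> ennreal (1 / \<psi> s ^ (n - 1)) * ennreal (2 * A * v powr (1 - 1 / p))"
    unfolding pot_def by (rule mult_left_mono) simp
  also have "\<dots> = ennreal (2 * A * v powr (1 - 1 / p) / \<psi> s ^ (n - 1))"
    using pos[OF s] A by (simp add: ennreal_mult'[symmetric])
  also have "v powr (1 - 1 / p) = w powr (1 - 1 / p) * s powr (real n - real n / p)"
  proof -
    have "(s ^ n) powr (1 - 1 / p) = (s powr real n) powr (1 - 1 / p)" using s by (simp add: powr_realpow)
    also have "\<dots> = s powr (real n - real n / p)" unfolding powr_powr by (simp add: right_diff_distrib)
    finally show ?thesis using w s by (simp add: v_def powr_mult)
  qed
  finally show ?thesis unfolding F_at_scale[OF s] w_def by (simp add: mult_ac)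
qed

lemma pot_measurable [measurable]:
  fixes g :: "'a::euclidean_space \<Rightarrow> 'a"
  assumes [measurable]: "U \<in> sets borel" "g \<in> borel_measurable borel"
  shows "pot K U g s \<in> borel_measurable borel"
proof -
  \<comment> \<open>With the ball written as a condition on the distance, the integrand is jointly
    measurable in the centre and the integration variable.\<close>
  have eq: "indicator (U \<inter> ball x r) w = (indicator U w * (if dist x w < r then 1 else 0) :: ennreal)" for x w r
    by (simp add: indicator_def)
  have "(\<lambda>x. \<integral>\<^sup>+w. ennreal (norm (g w)) * (indicator U w * (if dist x w < K * s then 1 else 0)) \<partial>lborel) \<in> borel_measurable borel"
    by (rule lborel.borel_measurable_nn_integral) measurable
  then show ?thesis unfolding pot_def eq by measurable
qed

text \<open>Chebyshev's inequality for small scales, where the uniform bound \<open>pot_le\<close>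
  grows as s decreases. The energy in a moving ball of volume v integrates, by Fubini, to v times
  the total energy. The bound is phrased with F(s^(-n)) s^(n/p), which equals s^n / \<psi>(s)^(n-1),
  so that the scaling of \<open>F\<close> applies.\<close>

lemma pot_weak:
  fixes g :: "'a::euclidean_space \<Rightarrow> 'a"
  assumes n: "n = DIM('a)" and U[measurable]: "U \<in> sets borel" and g[measurable]: "g \<in> borel_measurable borel"
    and K: "0 < K" and s: "0 < s" and A: "0 < A" and \<mu>: "0 < \<mu>"
    and int: "(\<integral>\<^sup>+w\<in>U. ennreal (norm (g w) powr p) \<partial>lborel) \<le> ennreal (A powr p)"
  shows "emeasure lborel {x. ennreal \<mu> < pot K U g s x}
    \<le> ennreal ((2 * (unit_ball_vol (real n) * K ^ n) * (F (s powr - real n) * s powr (real n / p)) * A / \<mu>) powr p)"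
proof -
  define w where "w = unit_ball_vol (real n) * K ^ n"
  define v where "v = w * s ^ n"
  define P where "P = \<psi> s ^ (n - 1)"
  have w: "0 < w" using K by (simp add: w_def)
  have v: "0 < v" using w s by (simp add: v_def)
  have P: "0 < P" using pos[OF s] by (simp add: P_def)
  define \<nu> where "\<nu> = \<mu> * P"
  \<comment> \<open>With this value the first term of \<open>local_young\<close> is \<nu>/2, which
    the left side absorbs wherever the shell exceeds \<mu>.\<close>
  define k where "k = \<nu> / (2 * v)"
  have \<nu>: "0 < \<nu>" using \<mu> P by (simp add: \<nu>_def)
  have k: "0 < k" using \<nu> v by (simp add: k_def)
  define c where "c = 2 / \<nu> * k powr (1 - p)"
  have c: "0 < c" using \<nu> k by (simp add: c_def)
  have vr: "unit_ball_vol (real DIM('a)) * (K * s) ^ DIM('a) = v" by (simp add: v_def w_def n power_mult_distrib)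
  define I where "I x = (\<integral>\<^sup>+w\<in>U \<inter> ball x (K * s). ennreal (norm (g w) powr p) \<partial>lborel)" for x
  have eq: "indicator (U \<inter> ball x r) w = (indicator U w * (if dist x w < r then 1 else 0) :: ennreal)" for x w r
    by (simp add: indicator_def)
  have I_eq: "I x = (\<integral>\<^sup>+w. ennreal (norm (g w) powr p) * indicator U w * (if dist x w < K * s then 1 else 0) \<partial>lborel)" for x
    unfolding I_def eq by (simp add: mult.assoc)
  have [measurable]: "I \<in> borel_measurable borel"
    unfolding I_eq[abs_def] by (rule lborel.borel_measurable_nn_integral) measurable
  have sub: "{x. ennreal \<mu> < pot K U g s x} \<subseteq> {x \<in> UNIV. 1 \<le> ennreal c * I x}"
  proof clarsimp
    fix x assume x: "ennreal \<mu> < pot K U g s x"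
    let ?h = "\<integral>\<^sup>+w\<in>U \<inter> ball x (K * s). ennreal (norm (g w)) \<partial>lborel"
    have "ennreal \<nu> = ennreal P * ennreal \<mu>" using P \<mu> by (simp add: \<nu>_def ennreal_mult'[symmetric] mult.commute)
    also have "\<dots> \<le> ennreal P * pot K U g s x" using x by (intro mult_left_mono) auto
    also have "\<dots> = ?h" using P pos[OF s] by (simp add: pot_def P_def mult.assoc[symmetric] ennreal_mult'[symmetric])
    also have "\<dots> \<le> ennreal (k * v) + ennreal (k powr (1 - p)) * I x"
      using local_young[OF U g k, of "K * s" x] K s unfolding vr I_def by simp
    also have "k * v = \<nu> / 2" using v by (simp add: k_def)
    finally have *: "ennreal \<nu> \<le> ennreal (\<nu> / 2) + ennreal (k powr (1 - p)) * I x" .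
    have "ennreal (\<nu> / 2) \<le> ennreal (k powr (1 - p)) * I x"
    proof (cases "ennreal (k powr (1 - p)) * I x")
      case (real r)
      then show ?thesis using * \<nu> by (simp add: ennreal_plus[symmetric] del: ennreal_plus)
    qed simp
    then have "ennreal (2 / \<nu>) * ennreal (\<nu> / 2) \<le> ennreal (2 / \<nu>) * (ennreal (k powr (1 - p)) * I x)" by (rule mult_left_mono) simp
    then show "1 \<le> ennreal c * I x" using \<nu> by (simp add: c_def ennreal_mult'[symmetric] mult.assoc[symmetric])
  qed
  have "emeasure lborel {x. ennreal \<mu> < pot K U g s x} \<le> emeasure lborel {x \<in> UNIV. 1 \<le> ennreal c * I x}"
    by (rule emeasure_mono[OF sub]) measurable
  also have "\<dots> \<le> ennreal c * (\<integral>\<^sup>+x\<in>UNIV. I x \<partial>lborel)"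
    by (rule nn_integral_Markov_inequality) auto
  also have "(\<integral>\<^sup>+x\<in>UNIV. I x \<partial>lborel) = (\<integral>\<^sup>+x. \<integral>\<^sup>+w. ennreal (norm (g w) powr p) * indicator U w * (if dist x w < K * s then 1 else 0) \<partial>lborel \<partial>lborel)"
    by (simp add: I_eq)
  also have "\<dots> = (\<integral>\<^sup>+w. \<integral>\<^sup>+x. ennreal (norm (g w) powr p) * indicator U w * (if dist x w < K * s then 1 else 0) \<partial>lborel \<partial>lborel)"
    by (rule lborel_pair.Fubini'[symmetric]) measurable
  also have "\<dots> = (\<integral>\<^sup>+w. ennreal v * (ennreal (norm (g w) powr p) * indicator U w) \<partial>lborel)"
  proof (rule nn_integral_cong)
    fix w :: 'a
    have "(if dist x w < K * s then 1 else 0 :: ennreal) = indicator (ball w (K * s)) x" for x by (simp add: indicator_def dist_commute)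
    then have "(\<integral>\<^sup>+x. ennreal (norm (g w) powr p) * indicator U w * (if dist x w < K * s then 1 else 0) \<partial>lborel)
      = (\<integral>\<^sup>+x. ennreal (norm (g w) powr p) * indicator U w * indicator (ball w (K * s)) x \<partial>lborel)" by simp
    also have "\<dots> = ennreal (norm (g w) powr p) * indicator U w * emeasure lborel (ball w (K * s))"
      by (subst nn_integral_cmult_indicator) auto
    also have "emeasure lborel (ball w (K * s)) = ennreal v" using K s vr by (simp add: emeasure_ball)
    finally show "(\<integral>\<^sup>+x. ennreal (norm (g w) powr p) * indicator U w * (if dist x w < K * s then 1 else 0) \<partial>lborel)
      = ennreal v * (ennreal (norm (g w) powr p) * indicator U w)" by (simp add: mult_ac)
  qed
  also have "\<dots> = ennreal v * (\<integral>\<^sup>+w\<in>U. ennreal (norm (g w) powr p) \<partial>lborel)"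
    by (rule nn_integral_cmult) measurable
  also have "ennreal c * \<dots> \<le> ennreal c * (ennreal v * ennreal (A powr p))" by (intro mult_left_mono int) auto
  also have "\<dots> = ennreal (c * v * A powr p)" using c v by (simp add: ennreal_mult'[symmetric] mult.assoc)
  also have "c * v * A powr p = (2 * v * A / \<nu>) powr p"
  proof -
    have "k powr (1 - p) = (2 * v / \<nu>) powr (p - 1)"
    proof -
      have "2 * v / \<nu> = k powr (- 1)" using k v \<nu> by (simp add: powr_minus_divide) (simp add: k_def)
      moreover have "k powr (1 - p) = (k powr (- 1)) powr (p - 1)" unfolding powr_powr by simp
      ultimately show ?thesis by simp
    qed
    then have "c * v = (2 * v / \<nu>) powr 1 * (2 * v / \<nu>) powr (p - 1)" using v \<nu> by (simp add: c_def)
    also have "\<dots> = (2 * v / \<nu>) powr p" unfolding powr_add[symmetric] by simp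
    finally have "c * v * A powr p = (2 * v / \<nu> * A) powr p" using A v \<nu> by (simp only: powr_mult)
    moreover have "2 * v / \<nu> * A = 2 * v * A / \<nu>" by simp
    ultimately show ?thesis by simp
  qed
  also have "2 * v * A / \<nu> = 2 * w * (F (s powr - real n) * s powr (real n / p)) * A / \<mu>"
  proof -
    have "F (s powr - real n) * s powr (real n / p) = s powr real n / P"
      unfolding F_at_scale[OF s] P_def by (simp flip: powr_add)
    then show ?thesis using s by (simp add: v_def \<nu>_def powr_realpow mult_ac)
  qed
  finally show ?thesis unfolding w_def .
qed

end


section \<open>Summation over the scales\<close>

lemma suminf_ennreal_geometric:
  assumes "0 \<le> a" "0 < r" "r < 1" shows "(\<Sum>i. ennreal (a * r ^ i)) = ennreal (a / (1 - r))"
proof (rule suminf_ennreal_eq)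
  show "(\<lambda>i. a * r ^ i) sums (a / (1 - r))"
    using sums_mult[OF geometric_sums[of r], of a] assms by simp
qed (use assms in simp)

context orlicz_growth begin

text \<open>Let a point be bad if one of its small shells exceeds its threshold. If x with f x \<ge>
  l and y in Z were both good, the pair estimate would give l < l. So the bad set contains {l \<le>
  f} or all of \<open>Z\<close>. In either case its measure, of order 1/t, controls {l \<le> f},
  because \<open>Z\<close> carries half of the measure of \<open>U\<close>.\<close>

lemma weak_type_estimate:
  assumes n: "n = DIM('a::euclidean_space)" and \<psi>: "\<psi> = psi \<phi>" and cJ: "0 < cJ"
  shows "\<exists>C0>0. \<exists>C1>0. \<forall>(U :: 'a set) f g A t l Z. C1_gradient f g \<and> U \<in> sets borel \<and> cigar_john \<phi> cJ U \<and>
     0 < A \<and> (\<integral>\<^sup>+w\<in>U. ennreal (norm (g w) powr p) \<partial>lborel) \<le> ennreal (A powr p) \<and>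
     0 < t \<and> 0 < l \<and> C0 * A * F t \<le> l \<and> Z \<subseteq> U \<and> Z \<in> sets borel \<and> emeasure lborel U \<le> 2 * emeasure lborel Z \<and>
     (\<forall>z\<in>Z. f z = 0) \<longrightarrow> emeasure lborel {x \<in> U. l \<le> f x} \<le> ennreal (C1 / t)"
proof -
  obtain C K where C: "0 < C" and K: "0 < K" and pair: "\<forall>(U :: 'a set) f g x y R. C1_gradient f g \<and> U \<in> sets borel \<and> cigar_john \<phi> cJ U \<and>
     0 < R \<and> x \<in> U \<and> y \<in> U \<and> x \<noteq> y \<longrightarrow>
     ennreal \<bar>f x - f y\<bar> \<le> ennreal C *
       (((\<Sum>i. pot K U g (R * 2 powi (- 1 - int i)) x) + (\<Sum>i. pot K U g (R * 2 powi (int i)) x))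
      + ((\<Sum>i. pot K U g (R * 2 powi (- 1 - int i)) y) + (\<Sum>i. pot K U g (R * 2 powi (int i)) y)))"
    using pot_pair_estimate[OF n \<psi> cJ] by metis
  define w where "w = unit_ball_vol (real n) * K ^ n"
  have w: "0 < w" using K by (simp add: w_def)
  define cF where "cF = 2 * w powr (1 - 1 / p)"
  have cF: "0 < cF" using w by (simp add: cF_def)
  have n0: "0 < real n" using n2 by simp
  \<comment> \<open>At radius R 2^i the argument of \<open>F\<close> is divided by 2^(n i), which
    lowers \<open>F\<close> at least by the factor r1^i.\<close>
  define r1 where "r1 = 2 powr (- real n * \<kappa>)"
  have "r1 < 2 powr 0" unfolding r1_def using kappa_pos n0 by (intro powr_less_mono) auto
  then have r1: "0 < r1" "r1 < 1" by (auto simp: r1_def)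
  define \<delta> where "\<delta> = 1 / p - \<beta>"
  have \<delta>: "0 < \<delta>" using beta_less by (simp add: \<delta>_def)
  \<comment> \<open>Small scales gain the factor 2^(-n \<delta>) per step. One half of this gain,
    r2, makes the thresholds summable; the other half makes the measures of the bad sets decay like
    powers of r3.\<close>
  define r2 where "r2 = 2 powr (- real n * \<delta> / 2)"
  have "r2 < 2 powr 0" unfolding r2_def using \<delta> n0 by (intro powr_less_mono) auto
  then have r2: "0 < r2" "r2 < 1" by (auto simp: r2_def)
  define r3 where "r3 = r2 powr p"
  have "r3 < r2 powr 0" unfolding r3_def using r2 p1 by (intro powr_less_mono') auto
  then have r3: "0 < r3" "r3 < 1" using r2 by (auto simp: r3_def)
  define S1 where "S1 = 1 / (1 - r1)"
  define S2 where "S2 = r2 / (1 - r2)"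
  define S3 where "S3 = r3 / (1 - r3)"
  have S: "0 < S1" "0 < S2" "0 < S3" using r1 r2 r3 by (auto simp: S1_def S2_def S3_def)
  \<comment> \<open>The first entry keeps the large scales of both points together below l/2; the
    second makes the measure bound for each bad set free of l and A. The small scales of both points
    add l/4, so the total stays below l.\<close>
  define C0 where "C0 = max (4 * C * cF * S1) (16 * w * C * S2)"
  have C0: "0 < C0" "4 * C * cF * S1 \<le> C0" "16 * w * C * S2 \<le> C0"
    using C cF S by (auto simp: C0_def less_max_iff_disj)
  have main: "emeasure lborel {x \<in> U. l \<le> f x} \<le> ennreal (2 * S3 / t)"
    if f: "C1_gradient f g" and U: "U \<in> sets borel" and john: "cigar_john \<phi> cJ U" and A: "0 < A"
      and int: "(\<integral>\<^sup>+w\<in>U. ennreal (norm (g w) powr p) \<partial>lborel) \<le> ennreal (A powr p)"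
      and t: "0 < t" and l: "0 < l" and le: "C0 * A * F t \<le> l" and Z: "Z \<subseteq> U" "Z \<in> sets borel"
      and half: "emeasure lborel U \<le> 2 * emeasure lborel Z" and f0: "\<forall>z\<in>Z. f z = 0"
    for U :: "'a set" and f g A t l Z
  proof -
    have g: "g \<in> borel_measurable borel" 
      using f by (auto simp: C1_gradient_def intro: borel_measurable_continuous_onI)
    \<comment> \<open>The radius with R^(-n) = t, so that the shell of radius R has the gauge value
      \<open>F t\<close>.\<close>
    define R where "R = t powr (- 1 / real n)"
    have R: "0 < R" using t by (simp add: R_def)
    have Ft: "0 < F t" using t by (rule F_pos)
    have scale: "(R * 2 powi j) powr (- real n) = t * 2 powr (- real n * real_of_int j)" for j
    proof -
      have "(R * 2 powi j) powr (- real n) = R powr (- real n) * (2 powr real_of_int j) powr (- real n)"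
        using R by (simp add: powr_mult powr_real_of_int')
      also have "R powr (- real n) = t" unfolding R_def powr_powr using n0 t by simp
      finally show ?thesis by (simp add: powr_powr mult.commute)
    qed
    have far: "(\<Sum>i. pot K U g (R * 2 powi (int i)) x) \<le> ennreal (cF * A * F t * S1)" for x
    proof -
      have "pot K U g (R * 2 powi (int i)) x \<le> ennreal (cF * A * F t * r1 ^ i)" for i
      proof -
        define c where "c = 2 powr (real n * real i)"
        have "2 powr 0 \<le> c" unfolding c_def by (intro powr_mono) auto
        then have c: "1 \<le> c" by simp
        have "c powr \<kappa> * F (t / c) \<le> F t" using F_scale_ge[of c "t / c"] c t by simp
        then have "F (t / c) \<le> c powr (- \<kappa>) * F t" using c by (simp add: powr_minus_divide field_simps)
        also have "c powr (- \<kappa>) = r1 ^ i" by (simp add: c_def r1_def powr_powr powr_power mult_ac)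
        finally have F: "F (t / c) \<le> r1 ^ i * F t" .
        have "t * 2 powr (- real n * real_of_int (int i)) = t / c" by (simp add: c_def powr_minus_divide)
        then have "pot K U g (R * 2 powi (int i)) x \<le> ennreal (cF * A * F (t / c))"
          using pot_le[OF n U g K _ A int, of "R * 2 powi (int i)" x] R scale[of "int i"] by (simp add: cF_def w_def)
        also have "\<dots> \<le> ennreal (cF * A * (r1 ^ i * F t))"
          using F cF A by (intro ennreal_leI mult_left_mono) auto
        finally show ?thesis by (simp add: mult_ac)
      qed
      then have "(\<Sum>i. pot K U g (R * 2 powi (int i)) x) \<le> (\<Sum>i. ennreal (cF * A * F t * r1 ^ i))"
        by (intro suminf_le summableI)
      also have "\<dots> = ennreal (cF * A * F t * S1)"
      proof (subst suminf_ennreal_geometric[OF _ r1])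
        show "0 \<le> cF * A * F t" using cF A Ft by simp
        show "ennreal (cF * A * F t / (1 - r1)) = ennreal (cF * A * F t * S1)" unfolding S1_def by simp
      qed
      finally show ?thesis .
    qed
    \<comment> \<open>The thresholds l' r2^(i+1) add up to l/(8 C).\<close>
    define l' where "l' = l / (8 * C * S2)"
    have l': "0 < l'" using l C S by (simp add: l'_def)
    define B where "B i = {x. ennreal (l' * r2 ^ Suc i) < pot K U g (R * 2 powi (- 1 - int i)) x}" for i
    have Bm: "B i \<in> sets lborel" for i 
      unfolding B_def using pot_measurable[OF U g, of K "R * 2 powi (- 1 - int i)"] by measurable
    have "emeasure lborel (B i) \<le> ennreal (r3 / t * r3 ^ i)" for i
    proof -
      define s where "s = R * 2 powi (- 1 - int i)"
      define c where "c = 2 powr (real n * (1 + real i))"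
      have s: "0 < s" using R by (simp add: s_def)
      have "2 powr 0 \<le> c" unfolding c_def by (intro powr_mono) auto
      then have c: "1 \<le> c" by simp
      have sn: "s powr (- real n) = c * t" unfolding s_def scale by (simp add: c_def algebra_simps)
      have "s powr (real n / p) = (s powr (- real n)) powr (- 1 / p)" unfolding powr_powr by simp
      also have "\<dots> = c powr (- 1 / p) * t powr (- 1 / p)" using c t by (simp add: sn powr_mult)
      finally have snp: "s powr (real n / p) = c powr (- 1 / p) * t powr (- 1 / p)" .
      have "F (s powr (- real n)) * s powr (real n / p) \<le> (c powr \<beta> * F t) * (c powr (- 1 / p) * t powr (- 1 / p))"
        unfolding sn snp using F_scale_le[OF c t] by (intro mult_right_mono) auto
      also have "\<dots> = (c powr \<beta> * c powr (- 1 / p)) * (F t * t powr (- 1 / p))" by (simp only: mult_ac)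
      also have "c powr \<beta> * c powr (- 1 / p) = c powr (- \<delta>)" unfolding powr_add[symmetric] by (simp add: \<delta>_def)
      also have "c powr (- \<delta>) = r2 ^ Suc i * r2 ^ Suc i"
      proof -
        have "r2 ^ Suc i = 2 powr (real (Suc i) * (- real n * \<delta> / 2))" unfolding r2_def by (subst powr_power) auto
        then have "r2 ^ Suc i * r2 ^ Suc i = 2 powr (real (Suc i) * (- real n * \<delta> / 2) + real (Suc i) * (- real n * \<delta> / 2))"
          by (simp only: powr_add)
        also have "real (Suc i) * (- real n * \<delta> / 2) + real (Suc i) * (- real n * \<delta> / 2) = real n * (1 + real i) * - \<delta>"
          by (simp add: algebra_simps)
        finally show ?thesis by (simp only: c_def powr_powr)
      qed
      finally have X: "F (s powr (- real n)) * s powr (real n / p) \<le> r2 ^ Suc i * r2 ^ Suc i * (F t * t powr (- 1 / p))" .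
      have \<mu>: "0 < l' * r2 ^ Suc i" using l' r2 by simp
      have "emeasure lborel (B i) \<le> ennreal ((2 * w * (F (s powr - real n) * s powr (real n / p)) * A / (l' * r2 ^ Suc i)) powr p)"
        unfolding B_def s_def[symmetric] w_def by (rule pot_weak[OF n U g K s A \<mu> int])
      also have "\<dots> \<le> ennreal ((r2 ^ Suc i * t powr (- 1 / p)) powr p)"
      proof (intro ennreal_leI powr_mono2)
        have "2 * w * (F (s powr - real n) * s powr (real n / p)) * A / (l' * r2 ^ Suc i)
          \<le> 2 * w * (r2 ^ Suc i * r2 ^ Suc i * (F t * t powr (- 1 / p))) * A / (l' * r2 ^ Suc i)"
          using X w A \<mu> by (intro divide_right_mono mult_right_mono mult_left_mono) auto
        also have "\<dots> = (2 * w * A * F t / l') * (r2 ^ Suc i * t powr (- 1 / p))"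
          using r2 l' by (simp add: field_simps)
        also have "\<dots> \<le> 1 * (r2 ^ Suc i * t powr (- 1 / p))"
        proof (rule mult_right_mono)
          have "16 * w * C * S2 * (A * F t) \<le> C0 * (A * F t)" using C0 A Ft by (intro mult_right_mono) auto
          then have "16 * w * C * S2 * (A * F t) \<le> l" using le by simp
          then show "2 * w * A * F t / l' \<le> 1" using l C S by (simp add: l'_def field_simps)
        qed (use r2 in auto)
        finally show "2 * w * (F (s powr - real n) * s powr (real n / p)) * A / (l' * r2 ^ Suc i) \<le> r2 ^ Suc i * t powr (- 1 / p)" by simp
        have "0 \<le> F (s powr - real n)" using F_pos[of "s powr - real n"] s by simp
        then show "0 \<le> 2 * w * (F (s powr - real n) * s powr (real n / p)) * A / (l' * r2 ^ Suc i)"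
          using w A \<mu> by (intro divide_nonneg_pos mult_nonneg_nonneg) auto
      qed (use p1 in auto)
      also have "(r2 ^ Suc i * t powr (- 1 / p)) powr p = r3 / t * r3 ^ i"
      proof -
        have "(r2 ^ Suc i) powr p = r3 ^ Suc i" unfolding r3_def using r2 by (simp add: powr_mult powr_realpow[symmetric] powr_powr mult.commute)
        moreover have "(t powr (- 1 / p)) powr p = 1 / t" unfolding powr_powr using t p1 by (simp add: powr_minus_divide)
        ultimately show ?thesis using r2 t by (simp add: powr_mult)
      qed
      finally show ?thesis .
    qed
    then have "(\<Sum>i. emeasure lborel (B i)) \<le> (\<Sum>i. ennreal (r3 / t * r3 ^ i))"
      by (intro suminf_le summableI)
    also have "\<dots> = ennreal (S3 / t)"
    proof (subst suminf_ennreal_geometric[OF _ r3])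
      show "0 \<le> r3 / t" using r3 t by simp
      show "ennreal (r3 / t / (1 - r3)) = ennreal (S3 / t)" unfolding S3_def by (simp add: mult.commute)
    qed
    finally have "emeasure lborel (\<Union>i. B i) \<le> ennreal (S3 / t)"
      using emeasure_subadditive_countably[of B lborel] Bm by (auto intro: order_trans)
    moreover have near: "(\<Sum>i. pot K U g (R * 2 powi (- 1 - int i)) x) \<le> ennreal (l / (8 * C))" if "x \<notin> (\<Union>i. B i)" for x
    proof -
      have "(\<Sum>i. pot K U g (R * 2 powi (- 1 - int i)) x) \<le> (\<Sum>i. ennreal (l' * r2 * r2 ^ i))"
        using that by (intro suminf_le summableI) (auto simp: B_def not_less mult_ac)
      also have "\<dots> = ennreal (l' * S2)"
      proof (subst suminf_ennreal_geometric[OF _ r2])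
        show "0 \<le> l' * r2" using r2 l' by simp
        show "ennreal (l' * r2 / (1 - r2)) = ennreal (l' * S2)" unfolding S2_def by simp
      qed
      also have "l' * S2 = l / (8 * C)" using S by (simp add: l'_def)
      finally show ?thesis .
    qed
    have "x \<in> (\<Union>i. B i) \<or> y \<in> (\<Union>i. B i)" if x: "x \<in> U" "l \<le> f x" and y: "y \<in> Z" for x y
    proof (rule ccontr)
      assume not: "\<not> (x \<in> (\<Union>i. B i) \<or> y \<in> (\<Union>i. B i))"
      have fy: "f y = 0" using f0 y by simp
      then have "x \<noteq> y" using x l by auto
      have "ennreal l \<le> ennreal \<bar>f x - f y\<bar>" using x l fy by (intro ennreal_leI) auto
      also have "\<dots> \<le> ennreal C * (((\<Sum>i. pot K U g (R * 2 powi (- 1 - int i)) x) + (\<Sum>i. pot K U g (R * 2 powi (int i)) x))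
          + ((\<Sum>i. pot K U g (R * 2 powi (- 1 - int i)) y) + (\<Sum>i. pot K U g (R * 2 powi (int i)) y)))"
        using pair f U john R x y Z \<open>x \<noteq> y\<close> by blast
      also have "\<dots> \<le> ennreal C * ((ennreal (l / (8 * C)) + ennreal (cF * A * F t * S1)) + (ennreal (l / (8 * C)) + ennreal (cF * A * F t * S1)))"
        using not by (intro mult_left_mono add_mono near far) auto
      also have "\<dots> = ennreal (C * ((l / (8 * C) + cF * A * F t * S1) + (l / (8 * C) + cF * A * F t * S1)))"
      proof -
        have "ennreal C * ((ennreal a + ennreal b) + (ennreal a + ennreal b)) = ennreal (C * ((a + b) + (a + b)))"
          if "0 \<le> a" "0 \<le> b" for a b
          using that C by (simp add: ennreal_mult' ennreal_plus[symmetric] del: ennreal_plus)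
        then show ?thesis using C l cF A Ft S by simp
      qed
      also have "C * ((l / (8 * C) + cF * A * F t * S1) + (l / (8 * C) + cF * A * F t * S1)) = l / 4 + (4 * C * cF * S1) * (A * F t) / 2"
        using C by (simp add: field_simps)
      finally have "l \<le> l / 4 + (4 * C * cF * S1) * (A * F t) / 2"
        using l C cF S A Ft by (subst (asm) ennreal_le_iff) auto
      moreover have "(4 * C * cF * S1) * (A * F t) \<le> C0 * (A * F t)"
        using C0 A Ft by (intro mult_right_mono) auto
      ultimately have "l \<le> l / 4 + C0 * (A * F t) / 2" by linarith
      then show False using le l by (simp add: mult.assoc)
    qed
    then consider "{x \<in> U. l \<le> f x} \<subseteq> (\<Union>i. B i)" | "Z \<subseteq> (\<Union>i. B i)" by blast
    then show ?thesis
    proof cases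
      case 1
      then have "emeasure lborel {x \<in> U. l \<le> f x} \<le> emeasure lborel (\<Union>i. B i)" using Bm by (intro emeasure_mono) auto
      also have "\<dots> \<le> ennreal (S3 / t)" by fact
      also have "\<dots> \<le> ennreal (2 * S3 / t)" using S t by (intro ennreal_leI divide_right_mono) auto
      finally show ?thesis .
    next
      case 2
      have "emeasure lborel {x \<in> U. l \<le> f x} \<le> emeasure lborel U" using U by (intro emeasure_mono) auto
      also have "\<dots> \<le> 2 * emeasure lborel Z" by fact
      also have "\<dots> \<le> 2 * emeasure lborel (\<Union>i. B i)" using 2 Bm by (intro mult_left_mono emeasure_mono) auto
      also have "\<dots> \<le> 2 * ennreal (S3 / t)" by (intro mult_left_mono) (fact, simp)
      also have "\<dots> = ennreal (2 * S3 / t)" using S t by (simp add: ennreal_mult'[symmetric] flip: ennreal_numeral)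
      finally show ?thesis .
    qed
  qed
  show ?thesis
    by (rule exI[of _ C0], rule conjI[OF C0(1)], rule exI[of _ "2 * S3"], rule conjI) (use S main in \<open>simp, blast\<close>)
qed

end

section \<open>Truncation\<close>


lemma has_real_derivative_pos_part_sq:
  "((\<lambda>x::real. (max 0 x)\<^sup>2) has_real_derivative 2 * max 0 x) (at x)"
proof -
  consider "x < 0" | "x > 0" | "x = 0" by linarith
  then show ?thesis
  proof cases
    case 1
    have "((\<lambda>x::real. 0) has_real_derivative 0) (at x)" by simp
    then show ?thesis
      using 1 by (rule_tac has_field_derivative_transform_within_open[of "\<lambda>_. 0" _ x "{..<0}"]) auto
  next
    case 2
    have "((\<lambda>x::real. x\<^sup>2) has_real_derivative 2 * x) (at x)" by (auto intro!: derivative_eq_intros)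
    then show ?thesis
      using 2 by (rule_tac has_field_derivative_transform_within_open[of "\<lambda>x. x\<^sup>2" _ x "{0<..}"]) auto
  next
    case 3
    have "((\<lambda>h::real. (max 0 h)\<^sup>2 / h) \<longlongrightarrow> 0) (at 0)"
    proof (rule Lim_null_comparison)
      show "\<forall>\<^sub>F h::real in at 0. norm ((max 0 h)\<^sup>2 / h) \<le> \<bar>h\<bar>"
        by (intro always_eventually allI) (auto simp: max_def power2_eq_square)
      show "((\<lambda>h::real. \<bar>h\<bar>) \<longlongrightarrow> 0) (at 0)" by (auto intro!: tendsto_eq_intros)
    qed
    then show ?thesis using 3 by (simp add: DERIV_def)
  qed
qed

text \<open>The integral of a tent over [1, 2] with height 2 at 3/2, written as a second difference
  of squared positive parts. A sharp truncation would leave the class \<open>C1_gradient\<close>;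
  this one stays in it, at the price of a gradient factor 2.\<close>

definition smooth_step :: "real \<Rightarrow> real" where
  "smooth_step x = 2 * ((max 0 (x - 1))\<^sup>2 - 2 * (max 0 (x - 3/2))\<^sup>2 + (max 0 (x - 2))\<^sup>2)"

definition smooth_step' :: "real \<Rightarrow> real" where
  "smooth_step' x = 4 * (max 0 (x - 1) - 2 * max 0 (x - 3/2) + max 0 (x - 2))"

lemma smooth_step_derivative: "(smooth_step has_real_derivative smooth_step' x) (at x)"
proof -
  have "((\<lambda>x. (max 0 (x - c))\<^sup>2) has_real_derivative 2 * max 0 (x - c)) (at x)" for c
    using has_real_derivative_pos_part_sq[of "x - c"] DERIV_shift[of "\<lambda>x. (max 0 x)\<^sup>2" _ x "- c"] by simp
  note d = this
  show ?thesis unfolding smooth_step_def[abs_def] smooth_step'_def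
    by (rule derivative_eq_intros d refl | simp)+
qed

lemma smooth_step_props:
  "x \<le> 1 \<Longrightarrow> smooth_step x = 0" "2 \<le> x \<Longrightarrow> smooth_step x = 1"
  "0 \<le> smooth_step' x" "smooth_step' x \<le> 2" "smooth_step' x \<noteq> 0 \<Longrightarrow> 1 < x \<and> x < 2"
  unfolding smooth_step_def smooth_step'_def
  by (auto simp: max_def power2_eq_square algebra_simps split: if_splits)

lemma smooth_step'_continuous: "continuous_on UNIV smooth_step'"
  unfolding smooth_step'_def[abs_def] by (intro continuous_intros)

section \<open>Medians\<close>

lemma ex_median:
  fixes f :: "'a::euclidean_space \<Rightarrow> real"
  assumes f: "continuous_on UNIV f" and U: "open U" "bounded U"
  shows "\<exists>b. emeasure lborel U \<le> 2 * emeasure lborel {x \<in> U. f x \<le> b} \<and>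
    emeasure lborel U \<le> 2 * emeasure lborel {x \<in> U. b \<le> f x}"
proof (cases "U = {}")
  case True then show ?thesis by simp
next
  case False
  have [measurable]: "f \<in> borel_measurable borel" using f by (rule borel_measurable_continuous_onI)
  have [measurable]: "U \<in> sets borel" using U by auto
  have fin: "emeasure lborel U < \<infinity>" using U by (rule_tac emeasure_bounded_finite)
  have pos: "0 < emeasure lborel U"
  proof -
    obtain x r where "0 < r" "ball x r \<subseteq> U" using False U(1) open_contains_ball by blast
    have "0 < emeasure lborel (ball x r)" using \<open>0 < r\<close> by (simp add: emeasure_ball)
    also have "\<dots> \<le> emeasure lborel U" using \<open>ball x r \<subseteq> U\<close> by (intro emeasure_mono) auto
    finally show ?thesis .
  qed
  have fin': "emeasure lborel {x \<in> U. P x} < \<infinity>" for P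
    using emeasure_mono[of "{x \<in> U. P x}" U lborel] fin by (simp add: le_less_trans subset_eq)
  have "compact (f ` closure U)" 
    using U by (intro compact_continuous_image continuous_on_subset[OF f]) (auto simp: compact_closure)
  then have "bounded (f ` closure U)" by (rule compact_imp_bounded)
  then obtain B where B: "\<And>x. x \<in> U \<Longrightarrow> \<bar>f x\<bar> \<le> B" using closure_subset[of U] by (auto simp: bounded_iff)
  define S where "S = {t. emeasure lborel U \<le> 2 * emeasure lborel {x \<in> U. f x \<le> t}}"
  have "{x \<in> U. f x \<le> B} = U" using B by (auto dest!: abs_le_D1)
  then have BS: "B \<in> S" using mult_right_mono[of 1 2 "emeasure lborel U"] by (simp add: S_def)
  have up: "t \<in> S" if "s \<in> S" "s \<le> t" for s t
  proof -
    have "emeasure lborel {x \<in> U. f x \<le> s} \<le> emeasure lborel {x \<in> U. f x \<le> t}" using that by (intro emeasure_mono) auto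
    then show ?thesis using that mult_left_mono[of _ _ "2::ennreal"] unfolding S_def by (fastforce intro: order_trans)
  qed
  have bdd: "bdd_below S"
  proof (rule bdd_belowI)
    fix t assume t: "t \<in> S"
    show "- B \<le> t"
    proof (rule ccontr)
      assume "\<not> - B \<le> t"
      then have empty: "{x \<in> U. f x \<le> t} = {}" using B by fastforce
      have "emeasure lborel U \<le> 2 * emeasure lborel {x \<in> U. f x \<le> t}" using t by (simp add: S_def)
      then show False using pos unfolding empty by simp
    qed
  qed
  \<comment> \<open>The infimum of the levels whose sublevel set carries half of \<open>U\<close>.
    Levels decreasing to \<open>b\<close> give the bound for {f \<le> b} by continuity from above,
    where finite measure enters. Levels increasing to \<open>b\<close> lie outside \<open>S\<close>,
    which bounds {f < b} by one half and leaves one half for {b \<le> f}.\<close>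
  define b where "b = Inf S"
  define d where "d k = 1 / real (Suc k)" for k
  have d: "0 < d k" for k by (simp add: d_def)
  have d0: "d \<longlonglongrightarrow> 0" unfolding d_def using LIMSEQ_inverse_real_of_nat by (simp add: inverse_eq_divide)
  have dmono: "d (Suc k) \<le> d k" for k by (simp add: d_def frac_le)
  have "(\<lambda>k. 2 * emeasure lborel {x \<in> U. f x \<le> b + d k}) \<longlonglongrightarrow> 2 * emeasure lborel (\<Inter>k. {x \<in> U. f x \<le> b + d k})"
  proof (intro ennreal_tendsto_cmult Lim_emeasure_decseq)
    show "decseq (\<lambda>k. {x \<in> U. f x \<le> b + d k})"
      unfolding decseq_Suc_iff using dmono by (force intro: order_trans)
    show "emeasure lborel {x \<in> U. f x \<le> b + d k} \<noteq> \<infinity>" for k using fin'[of "\<lambda>x. f x \<le> b + d k"] by simp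
  qed auto
  moreover have "(\<Inter>k. {x \<in> U. f x \<le> b + d k}) = {x \<in> U. f x \<le> b}"
  proof safe
    fix x assume x: "x \<in> (\<Inter>k. {x \<in> U. f x \<le> b + d k})"
    then show "x \<in> U" by auto
    have "(\<lambda>k. b + d k) \<longlonglongrightarrow> b + 0" by (intro tendsto_intros d0)
    then show "f x \<le> b" using x by (intro LIMSEQ_le_const[of "\<lambda>k. b + d k"]) auto
  next
    fix x k assume "f x \<le> b" then show "f x \<le> b + d k" using d[of k] by linarith
  qed
  moreover have "emeasure lborel U \<le> 2 * emeasure lborel {x \<in> U. f x \<le> b + d k}" for k
  proof -
    obtain s where "s \<in> S" "s < b + d k" using cInf_lessD[of S "b + d k"] BS d[of k] by (auto simp: b_def)
    then show ?thesis using up[of s "b + d k"] by (simp add: S_def)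
  qed
  ultimately have 1: "emeasure lborel U \<le> 2 * emeasure lborel {x \<in> U. f x \<le> b}"
    by (intro LIMSEQ_le_const[of "\<lambda>k. 2 * emeasure lborel {x \<in> U. f x \<le> b + d k}"]) auto
  have "(\<lambda>k. 2 * emeasure lborel {x \<in> U. f x \<le> b - d k}) \<longlonglongrightarrow> 2 * emeasure lborel (\<Union>k. {x \<in> U. f x \<le> b - d k})"
  proof (intro ennreal_tendsto_cmult Lim_emeasure_incseq)
    show "incseq (\<lambda>k. {x \<in> U. f x \<le> b - d k})"
      unfolding incseq_Suc_iff using dmono by (force intro: order_trans)
  qed auto
  moreover have "(\<Union>k. {x \<in> U. f x \<le> b - d k}) = {x \<in> U. f x < b}"
  proof safe
    fix x k assume "f x \<le> b - d k" then show "f x < b" using d[of k] by linarith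
  next
    fix x assume x: "x \<in> U" "f x < b"
    have "\<forall>\<^sub>F k in sequentially. d k < b - f x" using d0 x by (intro order_tendstoD) auto
    then obtain k where "d k < b - f x" by (auto simp: eventually_sequentially)
    then have "f x \<le> b - d k" by linarith
    then show "x \<in> (\<Union>k. {x \<in> U. f x \<le> b - d k})" using x by blast
  qed
  moreover have "2 * emeasure lborel {x \<in> U. f x \<le> b - d k} \<le> emeasure lborel U" for k
  proof -
    have "b - d k \<notin> S" using cInf_lower[OF _ bdd, of "b - d k"] d[of k] by (auto simp: b_def)
    then show ?thesis by (simp add: S_def)
  qed
  ultimately have 2: "2 * emeasure lborel {x \<in> U. f x < b} \<le> emeasure lborel U"
    by (intro LIMSEQ_le_const2[of "\<lambda>k. 2 * emeasure lborel {x \<in> U. f x \<le> b - d k}"]) auto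
  have "emeasure lborel U = emeasure lborel {x \<in> U. f x < b} + emeasure lborel {x \<in> U. b \<le> f x}"
    by (subst plus_emeasure) (auto intro!: arg_cong[where f="emeasure lborel"])
  moreover obtain u where "emeasure lborel {x \<in> U. f x < b} = ennreal u" "0 \<le> u"
    using fin'[of "\<lambda>x. f x < b"] by (cases "emeasure lborel {x \<in> U. f x < b}") auto
  moreover obtain v where "emeasure lborel {x \<in> U. b \<le> f x} = ennreal v" "0 \<le> v"
    using fin'[of "\<lambda>x. b \<le> f x"] by (cases "emeasure lborel {x \<in> U. b \<le> f x}") auto
  ultimately have "emeasure lborel U \<le> 2 * emeasure lborel {x \<in> U. b \<le> f x}"
    using 2 by (simp add: ennreal_plus[symmetric] ennreal_mult'[symmetric] del: ennreal_plus flip: ennreal_numeral)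
  then show ?thesis using 1 by blast
qed


section \<open>Level sets and the strong estimate\<close>

lemma C1_gradient_compose:
  assumes f: "C1_gradient f g" and h: "\<And>x. (h has_real_derivative h' x) (at x)" and h': "continuous_on UNIV h'"
  shows "C1_gradient (\<lambda>x. h (f x)) (\<lambda>x. h' (f x) *\<^sub>R g x)"
  unfolding C1_gradient_def
proof (intro conjI allI)
  fix x
  have "((\<lambda>x. h (f x)) has_derivative (\<lambda>d. h' (f x) * (g x \<bullet> d))) (at x)"
    using f h[of "f x"] unfolding C1_gradient_def has_field_derivative_def
    by (intro has_derivative_compose[of f _ x UNIV h]) auto
  then show "((\<lambda>x. h (f x)) has_derivative (\<lambda>d. (h' (f x) *\<^sub>R g x) \<bullet> d)) (at x)" by simp
  show "continuous_on UNIV (\<lambda>x. h' (f x) *\<^sub>R g x)"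
    using f C1_gradient_continuous[OF f] unfolding C1_gradient_def
    by (intro continuous_intros continuous_on_compose2[OF h']) auto
qed

context orlicz_growth begin

text \<open>The weak estimate is applied to a truncation of \<open>f\<close> whose gradient lives on
  the layer l < f < 2 l. If e is the energy of the layer, the L^p norm is of order e^(1/p), and
  G(e^(-1/p) s) \<ge> G(s)/e for e \<le> 1 turns the weak bound into one that is linear in e. The
  normalisation of the total energy is what guarantees e \<le> 1.\<close>

lemma level_estimate:
  assumes n: "n = DIM('a::euclidean_space)" and \<psi>: "\<psi> = psi \<phi>" and cJ: "0 < cJ"
  shows "\<exists>C0>0. \<exists>C1>0. \<forall>(U :: 'a set) f g l. C1_gradient f g \<and> U \<in> sets borel \<and> cigar_john \<phi> cJ U \<and>
     (\<integral>\<^sup>+w\<in>U. ennreal (norm (g w) powr p) \<partial>lborel) \<le> 1 \<and> 0 < l \<and>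
     emeasure lborel U \<le> 2 * emeasure lborel {x \<in> U. f x \<le> 0} \<longrightarrow>
     emeasure lborel {x \<in> U. 2 * l \<le> f x} \<le> ennreal (C1 / G (l / C0))
        * (\<integral>\<^sup>+w\<in>{x \<in> U. l < f x \<and> f x < 2 * l}. ennreal (norm (g w) powr p) \<partial>lborel)"
proof -
  obtain C0 C1 where C0: "0 < C0" and C1: "0 < C1" and weak: "\<forall>(U :: 'a set) f g A t l Z. C1_gradient f g \<and> U \<in> sets borel \<and> cigar_john \<phi> cJ U \<and>
     0 < A \<and> (\<integral>\<^sup>+w\<in>U. ennreal (norm (g w) powr p) \<partial>lborel) \<le> ennreal (A powr p) \<and>
     0 < t \<and> 0 < l \<and> C0 * A * F t \<le> l \<and> Z \<subseteq> U \<and> Z \<in> sets borel \<and> emeasure lborel U \<le> 2 * emeasure lborel Z \<and>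
     (\<forall>z\<in>Z. f z = 0) \<longrightarrow> emeasure lborel {x \<in> U. l \<le> f x} \<le> ennreal (C1 / t)"
    using weak_type_estimate[OF n \<psi> cJ] by (elim exE conjE) (rule that; assumption)
  have main: "emeasure lborel {x \<in> U. 2 * l \<le> f x} \<le> ennreal (C1 / G (l / (2 * C0)))
        * (\<integral>\<^sup>+w\<in>{x \<in> U. l < f x \<and> f x < 2 * l}. ennreal (norm (g w) powr p) \<partial>lborel)"
    if f: "C1_gradient f g" and U[measurable]: "U \<in> sets borel" and john: "cigar_john \<phi> cJ U"
      and int: "(\<integral>\<^sup>+w\<in>U. ennreal (norm (g w) powr p) \<partial>lborel) \<le> 1" and l: "0 < l"
      and half: "emeasure lborel U \<le> 2 * emeasure lborel {x \<in> U. f x \<le> 0}"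
    for U :: "'a set" and f g l
  proof -
    have [measurable]: "g \<in> borel_measurable borel" "f \<in> borel_measurable borel"
      using f C1_gradient_continuous[OF f] by (auto simp: C1_gradient_def intro: borel_measurable_continuous_onI)
    define E where "E = {x \<in> U. l < f x \<and> f x < 2 * l}"
    have [measurable]: "E \<in> sets borel" unfolding E_def by measurable
    let ?e = "\<integral>\<^sup>+w\<in>E. ennreal (norm (g w) powr p) \<partial>lborel"
    define c where "c = C1 / G (l / (2 * C0))"
    have G0: "0 < G (l / (2 * C0))" using l C0 by (intro G_pos) auto
    have c: "0 < c" using C1 G0 by (simp add: c_def)
    \<comment> \<open>\<open>v\<close> vanishes where f \<le> l and equals l where f \<ge> 2
      l.\<close>
    define v where "v x = l * smooth_step (f x / l)" for x
    define v' where "v' x = smooth_step' (f x / l) *\<^sub>R g x" for x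
    have v: "C1_gradient v v'"
      unfolding v_def[abs_def] v'_def[abs_def]
    proof (rule C1_gradient_compose[OF f, of "\<lambda>y. l * smooth_step (y / l)" "\<lambda>y. smooth_step' (y / l)"])
      show "((\<lambda>y. l * smooth_step (y / l)) has_real_derivative smooth_step' (y / l)) (at y)" for y
      proof -
        have "((\<lambda>y. smooth_step (y / l)) has_real_derivative smooth_step' (y / l) * (1 / l)) (at y)"
          using l by (intro DERIV_chain2[OF smooth_step_derivative]) (auto intro!: derivative_eq_intros)
        from DERIV_cmult[OF this, of l] show ?thesis using l by simp
      qed
      show "continuous_on UNIV (\<lambda>y. smooth_step' (y / l))"
        using l by (intro continuous_on_compose2[OF smooth_step'_continuous] continuous_intros) auto
    qed
    have bound: "emeasure lborel {x \<in> U. 2 * l \<le> f x} \<le> ennreal (c * e)" if e: "0 < e" "e \<le> 1" "?e \<le> ennreal e" for e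
    proof -
      \<comment> \<open>The 2 is the bound on \<open>smooth_step'\<close>; it turns the constant of
        the weak estimate into \<open>2 * C0\<close>.\<close>
      define A where "A = 2 * e powr (1 / p)"
      define t where "t = G (l / (C0 * A))"
      have A: "0 < A" using e by (simp add: A_def)
      have t: "0 < t" using l C0 A by (simp add: t_def G_pos)
      have Ft: "C0 * A * F t = l" using C0 A l by (simp add: t_def F_G)
      have "(\<integral>\<^sup>+w\<in>U. ennreal (norm (v' w) powr p) \<partial>lborel) \<le> (\<integral>\<^sup>+w. ennreal (2 powr p) * (ennreal (norm (g w) powr p) * indicator E w) \<partial>lborel)"
      proof (rule nn_integral_mono)
        fix w
        show "ennreal (norm (v' w) powr p) * indicator U w \<le> ennreal (2 powr p) * (ennreal (norm (g w) powr p) * indicator E w)"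
        proof (cases "w \<in> U \<and> smooth_step' (f w / l) \<noteq> 0")
          case True
          then have "w \<in> E" using smooth_step_props(5)[of "f w / l"] l by (auto simp: E_def field_simps)
          have "norm (v' w) powr p \<le> (2 * norm (g w)) powr p"
            using smooth_step_props(3,4)[of "f w / l"] p1 by (intro powr_mono2) (auto simp: v'_def intro!: mult_right_mono)
          then have "ennreal (norm (v' w) powr p) \<le> ennreal (2 powr p) * ennreal (norm (g w) powr p)"
            by (simp add: powr_mult ennreal_mult'[symmetric])
          then show ?thesis using True \<open>w \<in> E\<close> by simp
        qed (auto simp: v'_def)
      qed
      also have "\<dots> = ennreal (2 powr p) * ?e" by (rule nn_integral_cmult) measurable
      also have "\<dots> \<le> ennreal (2 powr p) * ennreal e" by (intro mult_left_mono e) simp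
      also have "\<dots> = ennreal (A powr p)"
        using e p1 by (simp add: A_def powr_mult powr_powr ennreal_mult'[symmetric])
      finally have intv: "(\<integral>\<^sup>+w\<in>U. ennreal (norm (v' w) powr p) \<partial>lborel) \<le> ennreal (A powr p)" .
      have v0: "\<forall>z\<in>{x \<in> U. f x \<le> 0}. v z = 0"
      proof
        fix z assume "z \<in> {x \<in> U. f x \<le> 0}"
        then have "f z / l \<le> 0" using l by (simp add: divide_le_0_iff)
        then show "v z = 0" using smooth_step_props(1)[of "f z / l"] by (simp add: v_def)
      qed
      have Zm: "{x \<in> U. f x \<le> 0} \<in> sets borel" by measurable
      have "emeasure lborel {x \<in> U. l \<le> v x} \<le> ennreal (C1 / t)"
        using weak[rule_format, of v v' U A t l "{x \<in> U. f x \<le> 0}"] v U john A intv t l Ft half v0 Zm by auto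
      moreover have "emeasure lborel {x \<in> U. 2 * l \<le> f x} \<le> emeasure lborel {x \<in> U. l \<le> v x}"
      proof (rule emeasure_mono)
        have "v \<in> borel_measurable borel" using C1_gradient_continuous[OF v] by (rule borel_measurable_continuous_onI)
        then show "{x \<in> U. l \<le> v x} \<in> sets lborel" by measurable
        show "{x \<in> U. 2 * l \<le> f x} \<subseteq> {x \<in> U. l \<le> v x}"
        proof clarsimp
          fix x assume "2 * l \<le> f x"
          then have "2 \<le> f x / l" using l by (simp add: field_simps)
          then show "l \<le> v x" using smooth_step_props(2)[of "f x / l"] by (simp add: v_def)
        qed
      qed
      moreover have "C1 / t \<le> c * e"
      proof -
        have "1 \<le> e powr (- 1 / p)"
          using e p1 powr_mono2'[of "- 1 / p" e 1] by simp
        then have "(e powr (- 1 / p)) powr p * G (l / (2 * C0)) \<le> G (e powr (- 1 / p) * (l / (2 * C0)))"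
          by (rule G_scale_ge')
        also have "(e powr (- 1 / p)) powr p = 1 / e" unfolding powr_powr using e p1 by (simp add: powr_minus_divide)
        also have "e powr (- 1 / p) * (l / (2 * C0)) = l / (C0 * A)" using e by (simp add: A_def powr_minus_divide)
        finally have "G (l / (2 * C0)) / e \<le> t" by (simp add: t_def)
        then have "C1 / t \<le> C1 / (G (l / (2 * C0)) / e)" using C1 G0 e t by (intro divide_left_mono) auto
        then show ?thesis by (simp add: c_def)
      qed
      ultimately show ?thesis by (meson ennreal_leI order_trans)
    qed
    have e1: "?e \<le> 1"
    proof -
      have "?e \<le> (\<integral>\<^sup>+w\<in>U. ennreal (norm (g w) powr p) \<partial>lborel)"
        by (intro nn_integral_mono) (auto simp: indicator_def E_def)
      then show ?thesis using int by (rule order_trans)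
    qed
    then obtain e where e: "?e = ennreal e" "0 \<le> e" by (cases ?e) (auto simp: top_unique)
    have "emeasure lborel {x \<in> U. 2 * l \<le> f x} \<le> ennreal c * ?e"
    proof (cases "e = 0")
      case False
      then show ?thesis using bound[of e] e e1 c by (simp add: ennreal_mult')
    next
      case True
      have "(\<lambda>i. ennreal (c * inverse (real (Suc i)))) \<longlonglongrightarrow> ennreal (c * 0)"
        by (intro tendsto_intros LIMSEQ_inverse_real_of_nat)
      moreover have "emeasure lborel {x \<in> U. 2 * l \<le> f x} \<le> ennreal (c * inverse (real (Suc i)))" for i
        using e True by (intro bound) (auto simp: inverse_le_1_iff)
      ultimately have "emeasure lborel {x \<in> U. 2 * l \<le> f x} \<le> ennreal (c * 0)"
        by (intro LIMSEQ_le_const) auto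
      then show ?thesis by simp
    qed
    then show ?thesis by (simp add: c_def E_def)
  qed
  show ?thesis
    by (rule exI[of _ "2 * C0"], rule conjI, use C0 in simp, rule exI[of _ C1], rule conjI[OF C1]) (use main in blast)
qed

text \<open>Maz'ya's truncation: the weak estimates on the dyadic level sets add up to a strong one.
  Since \<open>G\<close> vanishes on negative arguments, only the part where \<open>f > 0\<close> enters.\<close>
lemma one_sided_estimate:
  assumes n: "n = DIM('a::euclidean_space)" and \<psi>: "\<psi> = psi \<phi>" and cJ: "0 < cJ"
  shows "\<exists>C>0. \<exists>C1>0. \<forall>(U :: 'a set) f g. C1_gradient f g \<and> U \<in> sets borel \<and> cigar_john \<phi> cJ U \<and>
     (\<integral>\<^sup>+w\<in>U. ennreal (norm (g w) powr p) \<partial>lborel) \<le> 1 \<and>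
     emeasure lborel U \<le> 2 * emeasure lborel {x \<in> U. f x \<le> 0} \<longrightarrow>
     (\<integral>\<^sup>+x\<in>U. ennreal (G (f x / C)) \<partial>lborel) \<le> ennreal C1"
proof -
  obtain C0 C1 where C0: "0 < C0" and C1: "0 < C1" and lev: "\<forall>(U :: 'a set) f g l. C1_gradient f g \<and> U \<in> sets borel \<and> cigar_john \<phi> cJ U \<and>
     (\<integral>\<^sup>+w\<in>U. ennreal (norm (g w) powr p) \<partial>lborel) \<le> 1 \<and> 0 < l \<and>
     emeasure lborel U \<le> 2 * emeasure lborel {x \<in> U. f x \<le> 0} \<longrightarrow>
     emeasure lborel {x \<in> U. 2 * l \<le> f x} \<le> ennreal (C1 / G (l / C0))
        * (\<integral>\<^sup>+w\<in>{x \<in> U. l < f x \<and> f x < 2 * l}. ennreal (norm (g w) powr p) \<partial>lborel)"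
    using level_estimate[OF n \<psi> cJ] by (elim exE conjE) (rule that; assumption)
  have main: "(\<integral>\<^sup>+x\<in>U. ennreal (G (f x / (4 * C0))) \<partial>lborel) \<le> ennreal C1"
    if f: "C1_gradient f g" and U[measurable]: "U \<in> sets borel" and john: "cigar_john \<phi> cJ U"
      and int: "(\<integral>\<^sup>+w\<in>U. ennreal (norm (g w) powr p) \<partial>lborel) \<le> 1"
      and half: "emeasure lborel U \<le> 2 * emeasure lborel {x \<in> U. f x \<le> 0}"
    for U :: "'a set" and f g
  proof -
    have [measurable]: "g \<in> borel_measurable borel" "f \<in> borel_measurable borel"
      using f C1_gradient_continuous[OF f] by (auto simp: C1_gradient_def intro: borel_measurable_continuous_onI)
    \<comment> \<open>All levels 2^j with j an integer, enumerated by the natural numbers.\<close>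
    define l where "l i = (2::real) powi (int_decode i)" for i
    have l: "0 < l i" for i by (simp add: l_def)
    define S where "S i = {x \<in> U. 2 * l i \<le> f x}" for i
    define E where "E i = {x \<in> U. l i < f x \<and> f x < 2 * l i}" for i
    have [measurable]: "S i \<in> sets borel" "E i \<in> sets borel" for i unfolding S_def E_def by measurable
    have G0: "0 < G (l i / C0)" for i using l C0 by (intro G_pos) auto
    have "(\<integral>\<^sup>+x\<in>U. ennreal (G (f x / (4 * C0))) \<partial>lborel) \<le> (\<integral>\<^sup>+x. (\<Sum>i. ennreal (G (l i / C0)) * indicator (S i) x) \<partial>lborel)"
    proof (rule nn_integral_mono)
      fix x
      show "ennreal (G (f x / (4 * C0))) * indicator U x \<le> (\<Sum>i. ennreal (G (l i / C0)) * indicator (S i) x)"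
      proof (cases "x \<in> U \<and> 0 < f x")
        case True
        \<comment> \<open>The level l = 2^(N-1) satisfies 2 l < f x \<le> 4 l, which explains the 4
          in the argument of \<open>G\<close>.\<close>
        then obtain N :: int where N: "f x / 2 \<le> 1 * 2 powi N" "1 * 2 powi N < 2 * (f x / 2)"
          using ex_dyadic_scale[of "f x / 2" 1] by auto
        define i where "i = int_encode (N - 1)"
        have li: "2 * l i = 2 powi N" by (simp add: l_def i_def power_int_diff)
        have "x \<in> S i" using True N li by (simp add: S_def)
        have "G (f x / (4 * C0)) \<le> G (l i / C0)"
          using N li C0 by (intro G_mono) (simp add: field_simps)
        then have "ennreal (G (f x / (4 * C0))) * indicator U x \<le> ennreal (G (l i / C0)) * indicator (S i) x"
          using True \<open>x \<in> S i\<close> by (simp add: ennreal_leI)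
        also have "\<dots> \<le> (\<Sum>i. ennreal (G (l i / C0)) * indicator (S i) x)"
        proof -
          define h where "h j = ennreal (G (l j / C0)) * indicator (S j) x" for j
          have "h i \<le> suminf h" using sum_le_suminf[OF summableI, of "{i}" h] by simp
          then show ?thesis by (simp only: h_def[abs_def])
        qed
        finally show ?thesis .
      next
        case False
        then have "x \<notin> U \<or> G (f x / (4 * C0)) = 0" using C0 by (auto simp: G_def zero_less_divide_iff)
        then show ?thesis by auto
      qed
    qed
    also have "\<dots> = (\<Sum>i. \<integral>\<^sup>+x. ennreal (G (l i / C0)) * indicator (S i) x \<partial>lborel)"
      by (rule nn_integral_suminf) measurable
    also have "\<dots> = (\<Sum>i. ennreal (G (l i / C0)) * emeasure lborel (S i))"
      by (subst nn_integral_cmult_indicator) auto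
    also have "\<dots> \<le> (\<Sum>i. ennreal C1 * (\<integral>\<^sup>+w. ennreal (norm (g w) powr p) * indicator (E i) w \<partial>lborel))"
    proof (intro suminf_le summableI)
      fix i
      have "ennreal (G (l i / C0)) * emeasure lborel (S i) \<le> ennreal (G (l i / C0)) * (ennreal (C1 / G (l i / C0)) * (\<integral>\<^sup>+w\<in>E i. ennreal (norm (g w) powr p) \<partial>lborel))"
        unfolding S_def E_def using lev f U john int l half by (intro mult_left_mono) auto
      also have "\<dots> = ennreal (G (l i / C0) * (C1 / G (l i / C0))) * (\<integral>\<^sup>+w\<in>E i. ennreal (norm (g w) powr p) \<partial>lborel)"
        using G_nonneg by (simp only: ennreal_mult' mult.assoc)
      also have "G (l i / C0) * (C1 / G (l i / C0)) = C1" using G0[of i] by simp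
      finally show "ennreal (G (l i / C0)) * emeasure lborel (S i) \<le> ennreal C1 * (\<integral>\<^sup>+w\<in>E i. ennreal (norm (g w) powr p) \<partial>lborel)" .
    qed
    also have "\<dots> = ennreal C1 * (\<integral>\<^sup>+w. (\<Sum>i. ennreal (norm (g w) powr p) * indicator (E i) w) \<partial>lborel)"
    proof (subst nn_integral_suminf)
      show "(\<lambda>w. ennreal (norm (g w) powr p) * indicator (E i) w) \<in> borel_measurable lborel" for i by measurable
    qed (rule ennreal_suminf_cmult)
    also have "\<dots> \<le> ennreal C1 * (\<integral>\<^sup>+w\<in>U. ennreal (norm (g w) powr p) \<partial>lborel)"
    proof (intro mult_left_mono nn_integral_mono)
      fix w
      have disj: "disjoint_family E"
        unfolding disjoint_family_on_def
      proof (intro ballI impI)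
        fix i j :: nat assume "i \<noteq> j"
        then have "int_decode i \<noteq> int_decode j" using inj_int_decode by (auto simp: inj_on_def)
        then have "int_decode i + 1 \<le> int_decode j \<or> int_decode j + 1 \<le> int_decode i" by linarith
        then have "2 * l i \<le> l j \<or> 2 * l j \<le> l i"
          using power_int_increasing[of "int_decode i + 1" "int_decode j" "2::real"] power_int_increasing[of "int_decode j + 1" "int_decode i" "2::real"]
          by (auto simp: l_def power_int_add_1)
        then show "E i \<inter> E j = {}" by (auto simp: E_def)
      qed
      show "(\<Sum>i. ennreal (norm (g w) powr p) * indicator (E i) w) \<le> ennreal (norm (g w) powr p) * indicator U w"
      proof (cases "\<exists>i. w \<in> E i")
        case True
        then obtain i where i: "w \<in> E i" by blast
        have "(\<Sum>i. ennreal (norm (g w) powr p) * indicator (E i) w) = ennreal (norm (g w) powr p)"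
          by (rule suminf_cmult_indicator[OF disj i])
        then show ?thesis using i by (simp add: E_def)
      qed simp
    qed simp
    also have "\<dots> \<le> ennreal C1 * 1" by (intro mult_left_mono int) simp
    finally show ?thesis by simp
  qed
  show ?thesis
    by (rule exI[of _ "4 * C0"], rule conjI, use C0 in simp, rule exI[of _ C1], rule conjI[OF C1]) (use main in blast)
qed

lemma C1_gradient_affine:
  assumes "C1_gradient f g" shows "C1_gradient (\<lambda>x. a * f x + b) (\<lambda>x. a *\<^sub>R g x)"
  by (rule C1_gradient_compose[OF assms, of "\<lambda>y. a * y + b" "\<lambda>_. a"])
    (auto intro!: derivative_eq_intros)

text \<open>About a median b both (f - b)/A and (b - f)/A are nonpositive on at least half of
  \<open>U\<close>, so the one-sided estimate applies to each. The constant is chosen before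
  \<open>U\<close>, hence is shared by all bounded open cigar John sets with the same
  \<open>cJ\<close>.\<close>

lemma smooth_orlicz_sobolev:
  assumes n: "n = DIM('a::euclidean_space)" and \<psi>: "\<psi> = psi \<phi>" and cJ: "0 < cJ"
  shows "\<exists>C>0. \<forall>(U :: 'a set) f g A. C1_gradient f g \<and> open U \<and> bounded U \<and> cigar_john \<phi> cJ U \<and> 0 < A \<and>
     (\<integral>\<^sup>+w\<in>U. ennreal (norm (g w) powr p) \<partial>lborel) \<le> ennreal (A powr p) \<longrightarrow>
     (\<exists>b. (\<integral>\<^sup>+x\<in>U. ennreal (H (\<bar>f x - b\<bar> / (C * A))) \<partial>lborel) \<le> 1)"
proof -
  obtain C C1 where C: "0 < C" and C1: "0 < C1" and one: "\<forall>(U :: 'a set) f g. C1_gradient f g \<and> U \<in> sets borel \<and> cigar_john \<phi> cJ U \<and>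
     (\<integral>\<^sup>+w\<in>U. ennreal (norm (g w) powr p) \<partial>lborel) \<le> 1 \<and>
     emeasure lborel U \<le> 2 * emeasure lborel {x \<in> U. f x \<le> 0} \<longrightarrow>
     (\<integral>\<^sup>+x\<in>U. ennreal (G (f x / C)) \<partial>lborel) \<le> ennreal C1"
    using one_sided_estimate[OF n \<psi> cJ] by (elim exE conjE) (rule that; assumption)
  \<comment> \<open>For c \<ge> 1 one has G(s/c) \<le> G(s)/c, so enlarging the denominator by c
    brings the sum 2 C1 of the two one-sided integrals down to at most 1.\<close>
  define c where "c = max 1 (2 * C1)"
  have c: "1 \<le> c" "2 * C1 \<le> c" by (auto simp: c_def)
  have main: "\<exists>b. (\<integral>\<^sup>+x\<in>U. ennreal (H (\<bar>f x - b\<bar> / (c * C * A))) \<partial>lborel) \<le> 1"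
    if f: "C1_gradient f g" and U: "open U" "bounded U" and john: "cigar_john \<phi> cJ U" and A: "0 < A"
      and int: "(\<integral>\<^sup>+w\<in>U. ennreal (norm (g w) powr p) \<partial>lborel) \<le> ennreal (A powr p)" for U :: "'a set" and f g A
  proof -
    have [measurable]: "U \<in> sets borel" using U by auto
    have [measurable]: "g \<in> borel_measurable borel" "f \<in> borel_measurable borel"
      using f C1_gradient_continuous[OF f] by (auto simp: C1_gradient_def intro: borel_measurable_continuous_onI)
    obtain b where b: "emeasure lborel U \<le> 2 * emeasure lborel {x \<in> U. f x \<le> b}"
       "emeasure lborel U \<le> 2 * emeasure lborel {x \<in> U. b \<le> f x}"
      using ex_median[OF C1_gradient_continuous[OF f] U] by blast
    have Gm: "(\<lambda>x. ennreal (G x)) \<in> borel_measurable borel"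
      by (intro measurable_compose[OF _ measurable_ennreal] borel_measurable_mono) (auto simp: mono_def G_mono)
    have side: "(\<integral>\<^sup>+x\<in>U. ennreal (G (s * (f x - b) / (C * A))) \<partial>lborel) \<le> ennreal C1"
      if s: "\<bar>s\<bar> = 1" "emeasure lborel U \<le> 2 * emeasure lborel {x \<in> U. s * (f x - b) \<le> 0}" for s
    proof -
      define h where "h x = (s / A) * f x + - (s / A) * b" for x
      have h: "C1_gradient h (\<lambda>x. (s / A) *\<^sub>R g x)" unfolding h_def[abs_def] by (rule C1_gradient_affine[OF f])
      have h_eq: "h x = s * (f x - b) / A" for x using A by (simp add: h_def field_simps)
      have "(\<integral>\<^sup>+w\<in>U. ennreal (norm ((s / A) *\<^sub>R g w) powr p) \<partial>lborel) = (\<integral>\<^sup>+w. ennreal (1 / A powr p) * (ennreal (norm (g w) powr p) * indicator U w) \<partial>lborel)"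
        using s A by (intro nn_integral_cong) (simp add: powr_mult powr_divide ennreal_mult'[symmetric] mult.assoc[symmetric])
      also have "\<dots> = ennreal (1 / A powr p) * (\<integral>\<^sup>+w\<in>U. ennreal (norm (g w) powr p) \<partial>lborel)"
        by (rule nn_integral_cmult) measurable
      also have "\<dots> \<le> ennreal (1 / A powr p) * ennreal (A powr p)" by (intro mult_left_mono int) simp
      also have "\<dots> = 1" using A by (simp add: ennreal_mult'[symmetric])
      finally have hint: "(\<integral>\<^sup>+w\<in>U. ennreal (norm ((s / A) *\<^sub>R g w) powr p) \<partial>lborel) \<le> 1" .
      have "{x \<in> U. h x \<le> 0} = {x \<in> U. s * (f x - b) \<le> 0}" using A by (auto simp: h_eq divide_le_0_iff)
      then have "(\<integral>\<^sup>+x\<in>U. ennreal (G (h x / C)) \<partial>lborel) \<le> ennreal C1"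
        using one[rule_format, of h "\<lambda>x. (s / A) *\<^sub>R g x" U] h hint john s by simp
      then show ?thesis by (simp add: h_eq mult.commute)
    qed
    have p1: "(\<integral>\<^sup>+x\<in>U. ennreal (G (1 * (f x - b) / (C * A))) \<partial>lborel) \<le> ennreal C1" using b by (intro side) auto
    have p2: "(\<integral>\<^sup>+x\<in>U. ennreal (G (- 1 * (f x - b) / (C * A))) \<partial>lborel) \<le> ennreal C1" using b by (intro side) auto
    have "(\<integral>\<^sup>+x\<in>U. ennreal (H (\<bar>f x - b\<bar> / (c * C * A))) \<partial>lborel) \<le>
      (\<integral>\<^sup>+x. ennreal (1 / c) * (ennreal (G (1 * (f x - b) / (C * A))) * indicator U x + ennreal (G (- 1 * (f x - b) / (C * A))) * indicator U x) \<partial>lborel)"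
    proof (rule nn_integral_mono)
      fix x
      let ?s = "\<bar>f x - b\<bar> / (C * A)"
      have "H (\<bar>f x - b\<bar> / (c * C * A)) \<le> G (?s / c)" using H_le_G[of "?s / c"] c C A by (simp add: mult_ac)
      also have "\<dots> \<le> (1 / c) * G ?s"
      proof -
        have "c * G (?s / c) \<le> c powr p * G (?s / c)" using c orlicz_growth.p1[OF orlicz_growth_axioms] G_nonneg powr_mono[of 1 p c] by (intro mult_right_mono) auto
        also have "\<dots> \<le> G (c * (?s / c))" using c by (intro G_scale_ge') auto
        finally show ?thesis using c by (simp add: field_simps)
      qed
      \<comment> \<open>One of the two arguments on the right is \<open>?s\<close>, and the other
        term is nonnegative.\<close>
      also have "G ?s \<le> G (1 * (f x - b) / (C * A)) + G (- 1 * (f x - b) / (C * A))"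
        using G_nonneg by (cases "0 \<le> f x - b") auto
      finally have "H (\<bar>f x - b\<bar> / (c * C * A)) \<le> (1 / c) * (G (1 * (f x - b) / (C * A)) + G (- 1 * (f x - b) / (C * A)))"
        using c by (simp add: divide_right_mono)
      then have "ennreal (H (\<bar>f x - b\<bar> / (c * C * A))) \<le> ennreal ((1 / c) * (G (1 * (f x - b) / (C * A)) + G (- 1 * (f x - b) / (C * A))))"
        by (rule ennreal_leI)
      also have "\<dots> = ennreal (1 / c) * (ennreal (G (1 * (f x - b) / (C * A))) + ennreal (G (- 1 * (f x - b) / (C * A))))"
      proof -
        have gen: "ennreal (k * (u + v)) = ennreal k * (ennreal u + ennreal v)" if "0 \<le> k" "0 \<le> u" "0 \<le> v" for k u v
          using that by (simp add: ennreal_mult')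
        show ?thesis by (rule gen) (use G_nonneg c in auto)
      qed
      finally have "ennreal (H (\<bar>f x - b\<bar> / (c * C * A))) \<le> ennreal (1 / c) * (ennreal (G (1 * (f x - b) / (C * A))) + ennreal (G (- 1 * (f x - b) / (C * A))))" .
      then show "ennreal (H (\<bar>f x - b\<bar> / (c * C * A))) * indicator U x \<le> ennreal (1 / c) * (ennreal (G (1 * (f x - b) / (C * A))) * indicator U x + ennreal (G (- 1 * (f x - b) / (C * A))) * indicator U x)"
        by (auto simp: indicator_def)
    qed
    also have "\<dots> = ennreal (1 / c) * ((\<integral>\<^sup>+x\<in>U. ennreal (G (1 * (f x - b) / (C * A))) \<partial>lborel) + (\<integral>\<^sup>+x\<in>U. ennreal (G (- 1 * (f x - b) / (C * A))) \<partial>lborel))"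
    proof -
      have m: "(\<lambda>x. ennreal (G (s * (f x - b) / (C * A))) * indicator U x) \<in> borel_measurable lborel" for s
        by (intro borel_measurable_times_ennreal measurable_compose[OF _ Gm]) measurable
      show ?thesis using m[of 1] m[of "- 1"] by (subst nn_integral_cmult) (auto simp: nn_integral_add)
    qed
    also have "\<dots> \<le> ennreal (1 / c) * (ennreal C1 + ennreal C1)" by (intro mult_left_mono add_mono p1 p2) simp
    also have "\<dots> = ennreal (2 * C1 / c)" using C1 c by (simp add: ennreal_plus[symmetric] ennreal_mult'[symmetric] del: ennreal_plus)
    also have "\<dots> \<le> 1" using c by simp
    finally show ?thesis by blast
  qed
  show ?thesis
    by (rule exI[of _ "c * C"], rule conjI) (use c C main in \<open>simp, blast\<close>)
qed

end

section \<open>Mollification\<close>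


text \<open>The functions t^(-k) exp(-1/t), extended by 0. Differentiation maps member k to a
  combination of members k + 1 and k + 2. A merely C^1 kernel would not do, since the test functions
  in a weak gradient are infinitely differentiable.\<close>

definition bump :: "nat \<Rightarrow> real \<Rightarrow> real" where
  "bump k t = (if t \<le> 0 then 0 else (1 / t) ^ k * exp (- (1 / t)))"

lemma bump_derivative:
  "(bump k has_real_derivative (bump (k + 2) t - real k * bump (k + 1) t)) (at t)"
proof -
  consider "t < 0" | "0 < t" | "t = 0" by linarith
  then show ?thesis
  proof cases
    case 1
    have "((\<lambda>_::real. 0) has_real_derivative bump (k + 2) t - real k * bump (k + 1) t) (at t)"
      using 1 by (simp add: bump_def)
    then show ?thesis
      by (rule has_field_derivative_transform_within_open[of _ _ _ "{..<0}"]) (use 1 in \<open>auto simp: bump_def\<close>)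
  next
    case 2
    have "((\<lambda>t. (1 / t) ^ k * exp (- (1 / t))) has_real_derivative
      (real k * (1 / t) ^ (k - 1) * (- ((1 / t) ^ 2)) * exp (- (1 / t)) + (1 / t) ^ k * (exp (- (1 / t)) * (1 / t) ^ 2))) (at t)"
    proof -
      have d: "((\<lambda>t. 1 / t) has_real_derivative - ((1 / t) ^ 2)) (at t)"
        using 2 by (auto intro!: derivative_eq_intros simp: power2_eq_square)
      show ?thesis
        using DERIV_mult[OF DERIV_power[OF d, of k] DERIV_chain2[OF DERIV_exp DERIV_minus[OF d]]]
        by (simp add: algebra_simps)
    qed
    also have "real k * (1 / t) ^ (k - 1) * (- ((1 / t) ^ 2)) * exp (- (1 / t)) + (1 / t) ^ k * (exp (- (1 / t)) * (1 / t) ^ 2)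
      = bump (k + 2) t - real k * bump (k + 1) t"
      using 2 by (cases k) (auto simp: bump_def power2_eq_square algebra_simps add_divide_distrib)
    finally show ?thesis
      by (rule has_field_derivative_transform_within_open[of _ _ _ "{0<..}"]) (use 2 in \<open>auto simp: bump_def\<close>)
  next
    case 3
    \<comment> \<open>With y = 1/h the one-sided difference quotient is y^(k+1) / exp y.\<close>
    have "((\<lambda>h::real. (1 / h) ^ (k + 1) / exp (1 / h)) \<longlongrightarrow> 0) (at_right 0)"
      by (rule filterlim_compose[OF tendsto_power_div_exp_0]) (simp add: filterlim_inverse_at_top_right flip: inverse_eq_divide)
    then have r: "((\<lambda>h. bump k h / h) \<longlongrightarrow> 0) (at_right 0)"
      by (rule Lim_transform_eventually)
        (auto simp: bump_def exp_minus field_simps eventually_at_filter)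
    have l: "((\<lambda>h. bump k h / h) \<longlongrightarrow> 0) (at_left 0)"
      by (rule Lim_transform_eventually[OF tendsto_const]) (auto simp: bump_def eventually_at_filter)
    have "((\<lambda>h. bump k h / h) \<longlongrightarrow> 0) (at 0)" using l r by (simp add: filterlim_at_split)
    then show ?thesis using 3 by (simp add: DERIV_def bump_def)
  qed
qed

lemma bump_continuous: "continuous_on A (bump k)"
  by (intro continuous_at_imp_continuous_on ballI) (rule DERIV_isCont[OF bump_derivative])

text \<open>A class containing the bump that is closed under partial derivatives: the invariant for coinduction on \<open>smooth_fun\<close>.\<close>
inductive bumpy :: "'a::euclidean_space \<Rightarrow> real \<Rightarrow> ('a \<Rightarrow> real) \<Rightarrow> bool" for a e where
  base: "bumpy a e (\<lambda>x. bump k (e\<^sup>2 - (x - a) \<bullet> (x - a)))"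
| add: "bumpy a e f \<Longrightarrow> bumpy a e h \<Longrightarrow> bumpy a e (\<lambda>x. f x + h x)"
| scale: "bumpy a e f \<Longrightarrow> bumpy a e (\<lambda>x. c * f x)"
| coord: "bumpy a e f \<Longrightarrow> bumpy a e (\<lambda>x. ((x - a) \<bullet> i) * f x)"

text \<open>The derivative is exhibited as an explicit map whose value in each fixed direction is
  again \<open>bumpy\<close>. Uniqueness of derivatives then identifies it with
  \<open>frechet_derivative\<close>, and the coinduction can proceed.\<close>

lemma bumpy_derivative:
  "bumpy a e f \<Longrightarrow> \<exists>f'. (\<forall>x. (f has_derivative f' x) (at x)) \<and> (\<forall>i. bumpy a e (\<lambda>x. f' x i))"
proof (induction rule: bumpy.induct)
  case (base k)
  let ?q = "\<lambda>x. e\<^sup>2 - (x - a) \<bullet> (x - a)"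
  let ?d = "\<lambda>x. bump (k + 2) (?q x) - real k * bump (k + 1) (?q x)"
  show ?case
  proof (intro exI[of _ "\<lambda>x h. ?d x * (- 2 * ((x - a) \<bullet> h))"] conjI allI)
    fix x
    have q: "(?q has_derivative (\<lambda>h. - 2 * ((x - a) \<bullet> h))) (at x)"
      by (auto intro!: derivative_eq_intros simp: inner_commute algebra_simps)
    show "((\<lambda>x. bump k (?q x)) has_derivative (\<lambda>h. ?d x * (- 2 * ((x - a) \<bullet> h)))) (at x)"
      using has_derivative_compose[OF q, of "bump k" "(*) (?d x)"] bump_derivative[of k "?q x"]
      by (simp add: has_field_derivative_def)
  next
    fix i
    have "bumpy a e (\<lambda>x. - 2 * (((x - a) \<bullet> i) * (bump (k + 2) (?q x) + (- real k) * bump (k + 1) (?q x))))"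
      by (intro bumpy.intros)
    then show "bumpy a e (\<lambda>x. ?d x * (- 2 * ((x - a) \<bullet> i)))" by (simp add: algebra_simps)
  qed
next
  case (add f h)
  then obtain f' h' where *: "\<forall>x. (f has_derivative f' x) (at x)" "\<forall>i. bumpy a e (\<lambda>x. f' x i)"
    "\<forall>x. (h has_derivative h' x) (at x)" "\<forall>i. bumpy a e (\<lambda>x. h' x i)" by blast
  show ?case
    by (intro exI[of _ "\<lambda>x d. f' x d + h' x d"]) (use * in \<open>auto intro!: has_derivative_add bumpy.add\<close>)
next
  case (scale f c)
  then obtain f' where *: "\<forall>x. (f has_derivative f' x) (at x)" "\<forall>i. bumpy a e (\<lambda>x. f' x i)" by blast
  show ?case
    by (intro exI[of _ "\<lambda>x d. c * f' x d"]) (use * in \<open>auto intro!: has_derivative_mult_right bumpy.scale\<close>)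
next
  case (coord f j)
  then obtain f' where *: "\<forall>x. (f has_derivative f' x) (at x)" "\<forall>i. bumpy a e (\<lambda>x. f' x i)" by blast
  show ?case
  proof (intro exI[of _ "\<lambda>x d. ((x - a) \<bullet> j) * f' x d + (d \<bullet> j) * f x"] conjI allI)
    fix x
    have "((\<lambda>x. (x - a) \<bullet> j) has_derivative (\<lambda>d. d \<bullet> j)) (at x)" by (auto intro!: derivative_eq_intros)
    from has_derivative_mult[OF this *(1)[rule_format, of x]]
    show "((\<lambda>x. ((x - a) \<bullet> j) * f x) has_derivative (\<lambda>d. ((x - a) \<bullet> j) * f' x d + (d \<bullet> j) * f x)) (at x)" .
    show "bumpy a e (\<lambda>x. ((x - a) \<bullet> j) * f' x i + (i \<bullet> j) * f x)" for i
      using * coord by (intro bumpy.intros) auto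
  qed
qed

lemma bumpy_smooth: assumes "bumpy a e f" shows "smooth_fun f"
  using assms
proof (coinduction arbitrary: f)
  case smooth_fun
  then obtain f' where *: "\<forall>x. (f has_derivative f' x) (at x)" "\<forall>i. bumpy a e (\<lambda>x. f' x i)"
    using bumpy_derivative by blast
  then have "frechet_derivative f (at x) = f' x" for x using frechet_derivative_at by metis
  then show ?case using * by (auto simp: differentiable_def)
qed

text \<open>Collects what the convolution arguments use, so that the particular bump is not seen
  again. Smoothness is required of the reflected translates because these serve as test
  functions.\<close>

definition mollifier :: "real \<Rightarrow> ('a::euclidean_space \<Rightarrow> real) \<Rightarrow> ('a \<Rightarrow> 'a) \<Rightarrow> bool" where
  "mollifier e \<eta> \<Gamma> \<longleftrightarrow> C1_gradient \<eta> \<Gamma> \<and> (\<forall>z. 0 \<le> \<eta> z) \<and> (\<forall>z. e \<le> norm z \<longrightarrow> \<eta> z = 0 \<and> \<Gamma> z = 0) \<and>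
     (\<integral>\<^sup>+z. ennreal (\<eta> z) \<partial>lborel) = 1 \<and> (\<forall>x. smooth_fun (\<lambda>y. \<eta> (x - y)))"

lemma ex_mollifier: assumes e: "0 < e" shows "\<exists>\<eta> (\<Gamma> :: 'a::euclidean_space \<Rightarrow> 'a). mollifier e \<eta> \<Gamma>"
proof -
  define B where "B z = bump 0 (e\<^sup>2 - z \<bullet> z)" for z :: 'a
  have pos: "e\<^sup>2 - z \<bullet> z > 0 \<longleftrightarrow> norm z < e" for z :: 'a
    using e by (simp add: dot_square_norm power_mono_iff[of "norm z" e 2] not_le[symmetric] abs_le_square_iff[symmetric])
  have B: "0 \<le> B z" "B z \<noteq> 0 \<longleftrightarrow> norm z < e" for z
    using pos[of z] by (auto simp: B_def bump_def)
  have Bc: "continuous_on UNIV B"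
    unfolding B_def by (intro continuous_on_compose2[OF bump_continuous[of UNIV]] continuous_intros) auto
  then have [measurable]: "B \<in> borel_measurable borel" by (rule borel_measurable_continuous_onI)
  define I where "I = (\<integral>\<^sup>+z. ennreal (B z) \<partial>lborel)"
  have "I \<le> (\<integral>\<^sup>+z. indicator (ball (0::'a) e) z \<partial>lborel)"
    unfolding I_def
  proof (rule nn_integral_mono)
    fix z :: 'a
    have "B z \<le> 1" by (simp add: B_def bump_def)
    then show "ennreal (B z) \<le> indicator (ball 0 e) z"
      using B(2)[of z] by (auto simp: indicator_def)
  qed
  also have "\<dots> < \<infinity>" using emeasure_lborel_ball_finite[of "0::'a" e] by simp
  finally have fin: "I < \<infinity>" .
  have "I \<noteq> 0"
  proof
    assume "I = 0"
    then have "AE z in lborel. ennreal (B z) = 0" unfolding I_def by (subst (asm) nn_integral_0_iff_AE) auto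
    then have "AE z in lborel. z \<notin> ball (0::'a) e"
    proof eventually_elim
      case (elim z)
      then have "B z = 0" using B(1)[of z] by (simp add: ennreal_eq_0_iff)
      then show ?case using B(2)[of z] by simp
    qed
    then have "emeasure lborel (ball (0::'a) e) = 0" by (subst (asm) AE_iff_measurable) auto
    then show False using e unit_ball_vol_pos[of "real DIM('a)"] by (simp add: emeasure_ball)
  qed
  then obtain i where i: "I = ennreal i" "0 < i" using fin by (cases I) (auto simp: zero_less_iff_neq_zero less_le)
  define \<eta> where "\<eta> z = 1 / i * B z" for z
  \<comment> \<open>For k = 0 the second term of \<open>bump_derivative\<close> vanishes, so the
    gradient of \<open>B\<close> is -2 bump 2 (e^2 - |z|^2) z.\<close>
  define \<Gamma> where "\<Gamma> z = (1 / i * (bump 2 (e\<^sup>2 - z \<bullet> z) * - 2)) *\<^sub>R z" for z :: 'a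
  have "mollifier e \<eta> \<Gamma>"
    unfolding mollifier_def C1_gradient_def
  proof (intro conjI allI impI)
    fix z :: 'a
    have q: "((\<lambda>z. e\<^sup>2 - z \<bullet> z) has_derivative (\<lambda>h. - 2 * (z \<bullet> h))) (at z)"
      by (auto intro!: derivative_eq_intros simp: inner_commute)
    have dB: "(B has_derivative (\<lambda>h. bump 2 (e\<^sup>2 - z \<bullet> z) * (- 2 * (z \<bullet> h)))) (at z)"
      unfolding B_def
      using has_derivative_compose[OF q, of "bump 0" "(*) (bump 2 (e\<^sup>2 - z \<bullet> z))"] bump_derivative[of 0 "e\<^sup>2 - z \<bullet> z"]
      by (simp add: has_field_derivative_def numeral_2_eq_2)
    show "(\<eta> has_derivative (\<bullet>) (\<Gamma> z)) (at z)"
    proof -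
      have "(\<bullet>) (\<Gamma> z) = (\<lambda>h. 1 / i * (bump 2 (e\<^sup>2 - z \<bullet> z) * (- 2 * (z \<bullet> h))))"
        by (simp add: \<Gamma>_def fun_eq_iff)
      then show ?thesis
        using has_derivative_mult_right[OF dB, of "1 / i"] by (simp only: \<eta>_def[abs_def])
    qed
    show "0 \<le> \<eta> z" using B i by (simp add: \<eta>_def)
    show "\<eta> z = 0" if "e \<le> norm z" using B(2)[of z] that by (simp add: \<eta>_def)
    show "\<Gamma> z = 0" if "e \<le> norm z" using pos[of z] that by (simp add: \<Gamma>_def bump_def not_less)
  next
    show "continuous_on UNIV \<Gamma>" unfolding \<Gamma>_def
      by (intro continuous_intros continuous_on_compose2[OF bump_continuous[of UNIV]]) auto
    have "(\<integral>\<^sup>+z. ennreal (\<eta> z) \<partial>lborel) = (\<integral>\<^sup>+z. ennreal (1 / i) * ennreal (B z) \<partial>lborel)"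
      using i B by (intro nn_integral_cong) (simp add: \<eta>_def ennreal_mult'[symmetric])
    also have "\<dots> = ennreal (1 / i) * ennreal i" by (subst nn_integral_cmult) (simp_all add: i(1)[symmetric] I_def)
    also have "\<dots> = 1" using i by (simp add: ennreal_mult'[symmetric])
    finally show "(\<integral>\<^sup>+z. ennreal (\<eta> z) \<partial>lborel) = 1" .
  next
    fix x :: 'a
    have "bumpy x e (\<lambda>y. 1 / i * bump 0 (e\<^sup>2 - (y - x) \<bullet> (y - x)))" by (intro bumpy.intros)
    moreover have "(y - x) \<bullet> (y - x) = (x - y) \<bullet> (x - y)" for y by (simp add: dot_square_norm norm_minus_commute)
    ultimately have "bumpy x e (\<lambda>y. \<eta> (x - y))" by (simp add: \<eta>_def B_def)
    then show "smooth_fun (\<lambda>y. \<eta> (x - y))" by (rule bumpy_smooth)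
  qed
  then show ?thesis by blast
qed


section \<open>Convolution with a mollifier\<close>

lemma compact_support_uniformly_continuous:
  fixes h :: "'a::euclidean_space \<Rightarrow> 'b::metric_space"
  assumes h: "continuous_on UNIV h" and z: "\<And>z. e \<le> norm z \<Longrightarrow> h z = c" and \<epsilon>: "0 < \<epsilon>"
  shows "\<exists>d>0. \<forall>z z'. dist z z' < d \<longrightarrow> dist (h z) (h z') < \<epsilon>"
proof -
  have "uniformly_continuous_on (cball 0 (e + 1)) h"
    by (intro compact_uniformly_continuous continuous_on_subset[OF h]) auto
  then obtain d where d: "0 < d" "\<And>z z'. z \<in> cball 0 (e + 1) \<Longrightarrow> z' \<in> cball 0 (e + 1) \<Longrightarrow> dist z' z < d \<Longrightarrow> dist (h z') (h z) < \<epsilon>"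
    using \<epsilon> unfolding uniformly_continuous_on_def by meson
  have "dist (h z) (h z') < \<epsilon>" if zz: "dist z z' < min d 1" for z z'
  proof (cases "e \<le> norm z \<and> e \<le> norm z'")
    case True then show ?thesis using assms by simp
  next
    case False
    have "norm z \<le> norm z' + dist z z'" "norm z' \<le> norm z + dist z z'"
      using norm_triangle_ineq2[of z z'] norm_triangle_ineq2[of z' z] by (simp_all add: dist_norm norm_minus_commute)
    then have "z \<in> cball 0 (e + 1)" "z' \<in> cball 0 (e + 1)" using False zz by auto
    then show ?thesis using d(2)[of z' z] zz by simp
  qed
  then show ?thesis using d(1) by (intro exI[of _ "min d 1"]) auto
qed

lemma compact_support_bounded:
  fixes h :: "'a::euclidean_space \<Rightarrow> 'b::real_normed_vector"
  assumes h: "continuous_on UNIV h" and z: "\<And>z. e \<le> norm z \<Longrightarrow> h z = 0"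
  shows "\<exists>B\<ge>0. \<forall>z. norm (h z) \<le> B"
proof -
  have "compact (h ` cball 0 e)" by (intro compact_continuous_image continuous_on_subset[OF h]) auto
  then obtain B where B: "\<And>z. z \<in> cball 0 e \<Longrightarrow> norm (h z) \<le> B"
    using compact_imp_bounded by (metis bounded_iff imageI)
  have "norm (h z) \<le> max B 0" for z
    using B[of z] assms(2)[of z] by (cases "norm z \<le> e") auto
  then show ?thesis by (intro exI[of _ "max B 0"]) auto
qed

lemma measurable_lebesgue_reflect:
  fixes h :: "'a::euclidean_space \<Rightarrow> 'b::topological_space"
  assumes "h \<in> borel_measurable borel" shows "(\<lambda>y. h (x - y)) \<in> borel_measurable lebesgue"
proof -
  have "(\<lambda>y. h (x - y)) \<in> borel_measurable lborel"
    by (rule measurable_compose[OF _ assms]) measurable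
  then show ?thesis by (rule measurable_completion)
qed

lemma integrable_convolution:
  fixes h :: "'a::euclidean_space \<Rightarrow> 'b::euclidean_space"
  assumes u: "integrable lebesgue u" and h: "continuous_on UNIV h" "\<And>z. e \<le> norm z \<Longrightarrow> h z = 0"
  shows "integrable lebesgue (\<lambda>y. (u y :: real) *\<^sub>R h (x - y))"
proof -
  obtain B where B: "0 \<le> B" "\<And>z. norm (h z) \<le> B" using compact_support_bounded[OF h] by blast
  show ?thesis
  proof (rule Bochner_Integration.integrable_bound[of _ "\<lambda>y. B * u y"])
    show "integrable lebesgue (\<lambda>y. B * u y)" using u by simp
    show "(\<lambda>y. u y *\<^sub>R h (x - y)) \<in> borel_measurable lebesgue"
      using u borel_measurable_continuous_onI[OF h(1)]
      by (intro borel_measurable_scaleR measurable_lebesgue_reflect) auto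
    show "AE y in lebesgue. norm (u y *\<^sub>R h (x - y)) \<le> norm (B * u y)"
    proof (rule AE_I2)
      fix y
      have "\<bar>u y\<bar> * norm (h (x - y)) \<le> \<bar>u y\<bar> * B" using B by (intro mult_left_mono) auto
      then show "norm (u y *\<^sub>R h (x - y)) \<le> norm (B * u y)" using B by (simp add: abs_mult mult.commute)
    qed
  qed
qed

text \<open>\<open>\<Gamma>\<close> has compact support and is therefore uniformly continuous, so
  the linearisation error of \<open>\<eta>\<close> for an increment h is at most k |h| at every base
  point. Integration against |u| gives the derivative of the convolution; the same modulus gives
  continuity of its gradient.\<close>

lemma convolution_C1:
  fixes \<eta> :: "'a::euclidean_space \<Rightarrow> real"
  assumes m: "mollifier e \<eta> \<Gamma>" and u: "integrable lebesgue u"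
  shows "C1_gradient (\<lambda>x. LINT y|lebesgue. u y * \<eta> (x - y)) (\<lambda>x. LINT y|lebesgue. u y *\<^sub>R \<Gamma> (x - y))"
proof -
  have C: "C1_gradient \<eta> \<Gamma>" and z: "\<And>z. e \<le> norm z \<Longrightarrow> \<eta> z = 0" "\<And>z. e \<le> norm z \<Longrightarrow> \<Gamma> z = 0"
    using m by (auto simp: mollifier_def)
  have c\<Gamma>: "continuous_on UNIV \<Gamma>" and d\<eta>: "\<And>z. (\<eta> has_derivative (\<bullet>) (\<Gamma> z)) (at z)"
    using C by (auto simp: C1_gradient_def)
  have c\<eta>: "continuous_on UNIV \<eta>" using C by (rule C1_gradient_continuous)
  have I\<eta>: "integrable lebesgue (\<lambda>y. u y * \<eta> (x - y))" for x
    using integrable_convolution[OF u c\<eta> z(1)] by simp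
  have I\<Gamma>: "integrable lebesgue (\<lambda>y. u y *\<^sub>R \<Gamma> (x - y))" for x
    by (rule integrable_convolution[OF u c\<Gamma> z(2)])
  define w where "w x = (LINT y|lebesgue. u y * \<eta> (x - y))" for x
  define W where "W x = (LINT y|lebesgue. u y *\<^sub>R \<Gamma> (x - y))" for x
  define M where "M = (LINT y|lebesgue. \<bar>u y\<bar>)"
  have M: "0 \<le> M" by (simp add: M_def)
  have Iabs: "integrable lebesgue (\<lambda>y. \<bar>u y\<bar>)" using u by simp
  show ?thesis
    unfolding C1_gradient_def w_def[symmetric] W_def[symmetric]
  proof (intro conjI allI)
    fix x
    show "(w has_derivative (\<bullet>) (W x)) (at x)"
      unfolding has_derivative_at_alt
    proof (intro conjI allI impI)
      show "bounded_linear ((\<bullet>) (W x))" by (rule bounded_linear_inner_right)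
      fix \<epsilon> :: real assume \<epsilon>: "0 < \<epsilon>"
      \<comment> \<open>\<open>M + 1\<close> in place of \<open>M\<close> keeps the quotient
        meaningful when \<open>u\<close> vanishes almost everywhere.\<close>
      define k where "k = \<epsilon> / (M + 1)"
      have k: "0 < k" "k * M \<le> \<epsilon>" using \<epsilon> M by (auto simp: k_def field_simps)
      obtain d where d: "0 < d" "\<And>z z'. dist z z' < d \<Longrightarrow> dist (\<Gamma> z) (\<Gamma> z') < k"
        using compact_support_uniformly_continuous[OF c\<Gamma> z(2) k(1)] by blast
      show "\<exists>d>0. \<forall>y. norm (y - x) < d \<longrightarrow> norm (w y - w x - W x \<bullet> (y - x)) \<le> \<epsilon> * norm (y - x)"
      proof (intro exI[of _ d] conjI d(1) allI impI)
        fix x' assume x': "norm (x' - x) < d"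
        define h where "h = x' - x"
        have lin: "\<bar>\<eta> (a + h) - \<eta> a - \<Gamma> a \<bullet> h\<bar> \<le> k * norm h" for a
        proof -
          have "norm (\<eta> (a + h) - \<eta> a - \<Gamma> a \<bullet> ((a + h) - a)) \<le> norm ((a + h) - a) * k"
          proof (rule differentiable_bound_linearization[where S="cball a (norm h)" and f'="\<lambda>z. (\<bullet>) (\<Gamma> z)"])
            show "a + t *\<^sub>R (a + h - a) \<in> cball a (norm h)" if "t \<in> {0..1}" for t
              using that by (auto simp: dist_norm mult_left_le_one_le)
            show "(\<eta> has_derivative (\<bullet>) (\<Gamma> b)) (at b within cball a (norm h))" for b
              by (rule has_derivative_at_withinI[OF d\<eta>])
            show "onorm ((\<bullet>) (\<Gamma> b) - (\<bullet>) (\<Gamma> a)) \<le> k" if b: "b \<in> cball a (norm h)" for b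
            proof (rule onorm_le)
              fix v :: 'a
              have "norm (\<Gamma> b - \<Gamma> a) \<le> k" using d(2)[of b a] b x' by (auto simp: dist_norm h_def norm_minus_commute)
              then have "norm (\<Gamma> b - \<Gamma> a) * norm v \<le> k * norm v" by (intro mult_right_mono) auto
              then have "\<bar>(\<Gamma> b - \<Gamma> a) \<bullet> v\<bar> \<le> k * norm v" by (rule order_trans[OF Cauchy_Schwarz_ineq2])
              then show "norm (((\<bullet>) (\<Gamma> b) - (\<bullet>) (\<Gamma> a)) v) \<le> k * norm v" by (simp add: inner_diff_left)
            qed
          qed auto
          then show ?thesis by (simp add: mult.commute)
        qed
        have Ih: "integrable lebesgue (\<lambda>y. (u y *\<^sub>R \<Gamma> (x - y)) \<bullet> h)" by (rule integrable_inner_left[OF I\<Gamma>])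
        have eq: "w x' - w x - W x \<bullet> h = (LINT y|lebesgue. u y * \<eta> (x' - y) - u y * \<eta> (x - y) - (u y *\<^sub>R \<Gamma> (x - y)) \<bullet> h)"
          unfolding w_def W_def
          by (subst integral_inner_left[OF I\<Gamma>, symmetric])
             (simp add: Bochner_Integration.integral_diff[OF Bochner_Integration.integrable_diff[OF I\<eta> I\<eta>] Ih[unfolded inner_scaleR_left]] Bochner_Integration.integral_diff[OF I\<eta> I\<eta>])
        have "norm (w x' - w x - W x \<bullet> h) \<le> (LINT y|lebesgue. norm (u y * \<eta> (x' - y) - u y * \<eta> (x - y) - (u y *\<^sub>R \<Gamma> (x - y)) \<bullet> h))"
          unfolding eq by (rule integral_norm_bound)
        also have "\<dots> \<le> (LINT y|lebesgue. k * norm h * \<bar>u y\<bar>)"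
        proof (rule integral_mono)
          show "integrable lebesgue (\<lambda>y. norm (u y * \<eta> (x' - y) - u y * \<eta> (x - y) - (u y *\<^sub>R \<Gamma> (x - y)) \<bullet> h))"
            by (intro integrable_norm Bochner_Integration.integrable_diff I\<eta> Ih)
          show "integrable lebesgue (\<lambda>y. k * norm h * \<bar>u y\<bar>)" using Iabs by simp
          fix y
          have "u y * \<eta> (x' - y) - u y * \<eta> (x - y) - (u y *\<^sub>R \<Gamma> (x - y)) \<bullet> h = u y * (\<eta> ((x - y) + h) - \<eta> (x - y) - \<Gamma> (x - y) \<bullet> h)"
            by (simp add: h_def algebra_simps)
          then have "norm (u y * \<eta> (x' - y) - u y * \<eta> (x - y) - (u y *\<^sub>R \<Gamma> (x - y)) \<bullet> h) = \<bar>u y\<bar> * \<bar>\<eta> ((x - y) + h) - \<eta> (x - y) - \<Gamma> (x - y) \<bullet> h\<bar>"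
            by (simp add: abs_mult)
          also have "\<dots> \<le> \<bar>u y\<bar> * (k * norm h)" by (intro mult_left_mono lin) auto
          finally show "norm (u y * \<eta> (x' - y) - u y * \<eta> (x - y) - (u y *\<^sub>R \<Gamma> (x - y)) \<bullet> h) \<le> k * norm h * \<bar>u y\<bar>" by (simp add: mult_ac)
        qed
        also have "\<dots> = (k * M) * norm h" by (simp add: M_def)
        also have "\<dots> \<le> \<epsilon> * norm h" using k by (intro mult_right_mono) auto
        finally show "norm (w x' - w x - W x \<bullet> (x' - x)) \<le> \<epsilon> * norm (x' - x)" by (simp add: h_def)
      qed
    qed
  next
    show "continuous_on UNIV W"
      unfolding continuous_on_iff
    proof (intro ballI allI impI)
      fix x and \<epsilon> :: real assume \<epsilon>: "0 < \<epsilon>"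
      define k where "k = \<epsilon> / (M + 1)"
      have k: "0 < k" "k * M < \<epsilon>" using \<epsilon> M by (auto simp: k_def field_simps)
      obtain d where d: "0 < d" "\<And>z z'. dist z z' < d \<Longrightarrow> dist (\<Gamma> z) (\<Gamma> z') < k"
        using compact_support_uniformly_continuous[OF c\<Gamma> z(2) k(1)] by blast
      show "\<exists>d>0. \<forall>x'\<in>UNIV. dist x' x < d \<longrightarrow> dist (W x') (W x) < \<epsilon>"
      proof (intro exI[of _ d] conjI d(1) ballI impI)
        fix x' assume x': "dist x' x < d"
        have "dist (W x') (W x) = norm (LINT y|lebesgue. u y *\<^sub>R \<Gamma> (x' - y) - u y *\<^sub>R \<Gamma> (x - y))"
          by (simp add: W_def dist_norm Bochner_Integration.integral_diff[OF I\<Gamma> I\<Gamma>])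
        also have "\<dots> \<le> (LINT y|lebesgue. norm (u y *\<^sub>R \<Gamma> (x' - y) - u y *\<^sub>R \<Gamma> (x - y)))" by (rule integral_norm_bound)
        also have "\<dots> \<le> (LINT y|lebesgue. k * \<bar>u y\<bar>)"
        proof (rule integral_mono)
          show "integrable lebesgue (\<lambda>y. norm (u y *\<^sub>R \<Gamma> (x' - y) - u y *\<^sub>R \<Gamma> (x - y)))"
            by (intro integrable_norm Bochner_Integration.integrable_diff I\<Gamma>)
          show "integrable lebesgue (\<lambda>y. k * \<bar>u y\<bar>)" using Iabs by simp
          fix y
          have "norm (\<Gamma> (x' - y) - \<Gamma> (x - y)) \<le> k" using d(2)[of "x' - y" "x - y"] x' by (simp add: dist_norm)
          then have "\<bar>u y\<bar> * norm (\<Gamma> (x' - y) - \<Gamma> (x - y)) \<le> \<bar>u y\<bar> * k" by (intro mult_left_mono) auto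
          then show "norm (u y *\<^sub>R \<Gamma> (x' - y) - u y *\<^sub>R \<Gamma> (x - y)) \<le> k * \<bar>u y\<bar>"
            by (simp flip: scaleR_diff_right add: mult.commute)
        qed
        also have "\<dots> = k * M" by (simp add: M_def)
        finally show "dist (W x') (W x) < \<epsilon>" using k by simp
      qed
    qed
  qed
qed

text \<open>A Lebesgue measurable \<open>k\<close> is replaced by a Borel function equal to it
  almost everywhere, because Fubini requires joint Borel measurability. The inner integral over x is
  then the total mass 1 of \<open>\<eta>\<close>.\<close>

lemma nn_integral_convolution:
  fixes \<eta> :: "'a::euclidean_space \<Rightarrow> real"
  assumes m: "mollifier e \<eta> \<Gamma>" and k: "k \<in> borel_measurable lebesgue"
  shows "(\<integral>\<^sup>+x. (\<integral>\<^sup>+y. k y * ennreal (\<eta> (x - y)) \<partial>lebesgue) \<partial>lborel) = (\<integral>\<^sup>+y. k y \<partial>lebesgue)"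
    "(\<lambda>x. \<integral>\<^sup>+y. k y * ennreal (\<eta> (x - y)) \<partial>lebesgue) \<in> borel_measurable borel"
proof -
  have C: "C1_gradient \<eta> \<Gamma>" and i1: "(\<integral>\<^sup>+z. ennreal (\<eta> z) \<partial>lborel) = 1" using m by (auto simp: mollifier_def)
  have [measurable]: "\<eta> \<in> borel_measurable borel"
    using C1_gradient_continuous[OF C] by (rule borel_measurable_continuous_onI)
  obtain k' where [measurable]: "k' \<in> borel_measurable lborel" and ae: "AE y in lborel. k y = k' y"
    using completion_ex_borel_measurable[OF k] by blast
  have eq: "(\<integral>\<^sup>+y. k y * ennreal (\<eta> (x - y)) \<partial>lebesgue) = (\<integral>\<^sup>+y. k' y * ennreal (\<eta> (x - y)) \<partial>lborel)" for x
    unfolding nn_integral_completion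
  proof (rule nn_integral_cong_AE)
    show "AE y in lborel. k y * ennreal (\<eta> (x - y)) = k' y * ennreal (\<eta> (x - y))"
      using ae by eventually_elim simp
  qed
  show "(\<lambda>x. \<integral>\<^sup>+y. k y * ennreal (\<eta> (x - y)) \<partial>lebesgue) \<in> borel_measurable borel"
    unfolding eq by (rule lborel.borel_measurable_nn_integral) measurable
  have "(\<integral>\<^sup>+x. (\<integral>\<^sup>+y. k y * ennreal (\<eta> (x - y)) \<partial>lebesgue) \<partial>lborel) = (\<integral>\<^sup>+x. \<integral>\<^sup>+y. k' y * ennreal (\<eta> (x - y)) \<partial>lborel \<partial>lborel)"
    unfolding eq ..
  also have "\<dots> = (\<integral>\<^sup>+y. \<integral>\<^sup>+x. k' y * ennreal (\<eta> (x - y)) \<partial>lborel \<partial>lborel)"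
    by (rule lborel_pair.Fubini'[symmetric]) measurable
  also have "\<dots> = (\<integral>\<^sup>+y. k' y \<partial>lborel)"
  proof (rule nn_integral_cong)
    fix y :: 'a
    have "(\<integral>\<^sup>+x. ennreal (\<eta> (x - y)) \<partial>lborel) = 1"
      using nn_integral_lborel_affine[of "\<lambda>z. ennreal (\<eta> z)" 1 "- y"] i1 by simp
    then show "(\<integral>\<^sup>+x. k' y * ennreal (\<eta> (x - y)) \<partial>lborel) = k' y"
      by (subst nn_integral_cmult) auto
  qed
  also have "\<dots> = (\<integral>\<^sup>+y. k y \<partial>lborel)" using ae by (intro nn_integral_cong_AE) (auto elim: eventually_mono)
  finally show "(\<integral>\<^sup>+x. (\<integral>\<^sup>+y. k y * ennreal (\<eta> (x - y)) \<partial>lebesgue) \<partial>lborel) = (\<integral>\<^sup>+y. k y \<partial>lebesgue)"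
    unfolding nn_integral_completion .
qed


section \<open>Energy bound and convergence of mollified functions\<close>

lemma powr_tangent:
  fixes p s t :: real
  assumes p: "1 \<le> p" and s: "0 < s" and t: "0 \<le> t"
  shows "p * s powr (p - 1) * t \<le> t powr p + (p - 1) * s powr p"
proof (cases "t = 0")
  case True then show ?thesis using p by simp
next
  case False
  have "t powr p - s powr p \<ge> (p * s powr (p - 1)) * (t - s)"
  proof (rule convex_on_imp_above_tangent[OF powr_convex[OF p]])
    show "((\<lambda>x. x powr p) has_real_derivative p * s powr (p - 1)) (at s within {0<..})"
      using s by (auto intro!: derivative_eq_intros)
  qed (use s t False in \<open>auto simp: interior_open\<close>)
  moreover have "s powr (p - 1) * s = s powr p" using s by (simp add: powr_diff)
  ultimately show ?thesis by (simp add: algebra_simps)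
qed

lemma nn_integral_reflect:
  fixes h :: "'a::euclidean_space \<Rightarrow> ennreal"
  assumes [measurable]: "h \<in> borel_measurable borel"
  shows "(\<integral>\<^sup>+y. h (x - y) \<partial>lborel) = (\<integral>\<^sup>+y. h y \<partial>lborel)"
  by (subst (2) lborel_affine[of "- 1" x])
    (simp_all add: nn_integral_density nn_integral_distr)

lemma mollifier_integral:
  fixes \<eta> :: "'a::euclidean_space \<Rightarrow> real"
  assumes m: "mollifier e \<eta> \<Gamma>"
  shows "(\<integral>\<^sup>+y. ennreal (\<eta> (x - y)) \<partial>lebesgue) = 1"
    "integrable lebesgue (\<lambda>y. \<eta> (x - y))" "(LINT y|lebesgue. \<eta> (x - y)) = 1"
proof -
  have C: "C1_gradient \<eta> \<Gamma>" and i1: "(\<integral>\<^sup>+z. ennreal (\<eta> z) \<partial>lborel) = 1" and p: "\<And>z. 0 \<le> \<eta> z" using m by (auto simp: mollifier_def)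
  have [measurable]: "\<eta> \<in> borel_measurable borel"
    using C1_gradient_continuous[OF C] by (rule borel_measurable_continuous_onI)
  show 1: "(\<integral>\<^sup>+y. ennreal (\<eta> (x - y)) \<partial>lebesgue) = 1"
    unfolding nn_integral_completion using nn_integral_reflect[of "\<lambda>z. ennreal (\<eta> z)" x] i1 by simp
  have ms: "(\<lambda>y. \<eta> (x - y)) \<in> borel_measurable lebesgue"
    by (rule measurable_lebesgue_reflect) measurable
  show "integrable lebesgue (\<lambda>y. \<eta> (x - y))"
    using 1 p by (intro integrableI_nonneg ms) auto
  then have "ennreal (LINT y|lebesgue. \<eta> (x - y)) = 1"
    using 1 p by (subst nn_integral_eq_integral[symmetric]) auto
  then show "(LINT y|lebesgue. \<eta> (x - y)) = 1" by (simp add: ennreal_eq_1)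
qed

text \<open>Since \<open>\<eta>\<close> (x - y) is a test function of y, convolving \<open>u\<close>
  with \<open>\<Gamma>\<close> is the same as convolving \<open>g\<close> with
  \<open>\<eta>\<close>; the sign in the weak derivative cancels the one from the reflection. What
  remains is Jensen's inequality for a probability density, obtained by integrating the tangent of
  t^p at the mean s. In this form it makes sense also when the right-hand side is infinite.\<close>

lemma convolution_gradient_bound:
  fixes \<eta> :: "'a::euclidean_space \<Rightarrow> real"
  assumes m: "mollifier e \<eta> \<Gamma>" and wg: "weak_gradient D u g" and p: "1 \<le> p"
    and sub: "cball x e \<subseteq> S'" "S' \<subseteq> D"
    and u0: "integrable lebesgue (\<lambda>y. u y * indicator S' y)"
  shows "ennreal (norm (LINT y|lebesgue. (u y * indicator S' y) *\<^sub>R \<Gamma> (x - y)) powr p)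
    \<le> (\<integral>\<^sup>+y. (ennreal (norm (g y) powr p) * indicator D y) * ennreal (\<eta> (x - y)) \<partial>lebesgue)"
proof -
  have C: "C1_gradient \<eta> \<Gamma>" and z: "\<And>z. e \<le> norm z \<Longrightarrow> \<eta> z = 0" "\<And>z. e \<le> norm z \<Longrightarrow> \<Gamma> z = 0"
    and \<eta>0: "\<And>z. 0 \<le> \<eta> z" and smooth: "smooth_fun (\<lambda>y. \<eta> (x - y))"
    using m by (auto simp: mollifier_def)
  have c\<Gamma>: "continuous_on UNIV \<Gamma>" and d\<eta>: "\<And>z. (\<eta> has_derivative (\<bullet>) (\<Gamma> z)) (at z)"
    using C by (auto simp: C1_gradient_def)
  have c\<eta>: "continuous_on UNIV \<eta>" using C by (rule C1_gradient_continuous)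
  have \<eta>m: "(\<lambda>y. \<eta> (x - y)) \<in> borel_measurable lebesgue"
    by (intro measurable_lebesgue_reflect borel_measurable_continuous_onI c\<eta>)
  have gm: "g \<in> borel_measurable lebesgue" using wg by (simp add: weak_gradient_def)
  have inD: "y \<in> S'" "y \<in> D" if "\<eta> (x - y) \<noteq> 0 \<or> \<Gamma> (x - y) \<noteq> 0" for y
  proof -
    have "\<not> e \<le> norm (x - y)" using that z by blast
    then have "y \<in> cball x e" by (simp add: dist_norm)
    then show "y \<in> S'" "y \<in> D" using sub by auto
  qed
  have "set_integrable lebesgue (cball x e) (\<lambda>y. norm (g y))"
    using wg sub by (auto simp: weak_gradient_def locally_integrable_def)
  then have "integrable lebesgue (\<lambda>y. indicator (cball x e) y * norm (g y))" by (simp add: set_integrable_def)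
  from integrable_convolution[OF this c\<eta> z(1), where x=x]
  have "integrable lebesgue (\<lambda>y. indicator (cball x e) y * norm (g y) * \<eta> (x - y))" by simp
  moreover have "indicator (cball x e) y * norm (g y) * \<eta> (x - y) = \<eta> (x - y) * norm (g y)" for y
    using z(1)[of "x - y"] by (auto simp: indicator_def dist_norm)
  ultimately have Im: "integrable lebesgue (\<lambda>y. \<eta> (x - y) * norm (g y))" by simp
  have IV: "integrable lebesgue (\<lambda>y. \<eta> (x - y) *\<^sub>R g y)"
    by (rule Bochner_Integration.integrable_bound[OF Im]) (use \<eta>m gm in \<open>auto intro!: borel_measurable_scaleR\<close>)
  have IW: "integrable lebesgue (\<lambda>y. (u y * indicator S' y) *\<^sub>R \<Gamma> (x - y))"
    by (rule integrable_convolution[OF u0 c\<Gamma> z(2)])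
  define s where "s = (LINT y|lebesgue. \<eta> (x - y) * norm (g y))"
  have "(LINT y|lebesgue. (u y * indicator S' y) *\<^sub>R \<Gamma> (x - y)) = (LINT y|lebesgue. \<eta> (x - y) *\<^sub>R g y)"
  proof (rule euclidean_eqI)
    fix i :: 'a assume i: "i \<in> Basis"
    have test: "test_fun D (\<lambda>y. \<eta> (x - y))"
    proof -
      have "{y. \<eta> (x - y) \<noteq> 0} \<subseteq> cball x e" using z(1) by (auto simp: dist_norm) (meson linorder_le_cases)
      then have "closure {y. \<eta> (x - y) \<noteq> 0} \<subseteq> cball x e" by (rule closure_minimal) simp
      moreover from this have "compact (closure {y. \<eta> (x - y) \<noteq> 0})"
        using bounded_cball bounded_subset compact_eq_bounded_closed by blast
      ultimately show ?thesis using smooth sub by (auto simp: test_fun_def)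
    qed
    have fd: "frechet_derivative (\<lambda>y. \<eta> (x - y)) (at y) i = - (\<Gamma> (x - y) \<bullet> i)" for y
    proof -
      have "((\<lambda>y. \<eta> (x - y)) has_derivative (\<lambda>h. \<Gamma> (x - y) \<bullet> (- h))) (at y)"
        by (rule has_derivative_compose[OF _ d\<eta>]) (auto intro!: derivative_eq_intros)
      then show ?thesis using frechet_derivative_at[of "\<lambda>y. \<eta> (x - y)" _ y] by (metis inner_minus_right)
    qed
    have "(LINT y:D|lebesgue. u y * frechet_derivative (\<lambda>y. \<eta> (x - y)) (at y) i) = - (LINT y:D|lebesgue. (g y \<bullet> i) * \<eta> (x - y))"
      using wg test i unfolding weak_gradient_def by blast
    moreover have "(LINT y:D|lebesgue. u y * frechet_derivative (\<lambda>y. \<eta> (x - y)) (at y) i) = (LINT y|lebesgue. - (((u y * indicator S' y) *\<^sub>R \<Gamma> (x - y)) \<bullet> i))"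
      unfolding set_lebesgue_integral_def fd
    proof (rule Bochner_Integration.integral_cong[OF refl])
      fix y :: 'a show "indicator D y *\<^sub>R (u y * - (\<Gamma> (x - y) \<bullet> i)) = - (((u y * indicator S' y) *\<^sub>R \<Gamma> (x - y)) \<bullet> i)"
        using inD[of y] by (cases "\<Gamma> (x - y) = 0") auto
    qed
    moreover have "(LINT y:D|lebesgue. (g y \<bullet> i) * \<eta> (x - y)) = (LINT y|lebesgue. (\<eta> (x - y) *\<^sub>R g y) \<bullet> i)"
      unfolding set_lebesgue_integral_def
    proof (rule Bochner_Integration.integral_cong[OF refl])
      fix y :: 'a show "indicator D y *\<^sub>R ((g y \<bullet> i) * \<eta> (x - y)) = (\<eta> (x - y) *\<^sub>R g y) \<bullet> i"
        using inD[of y] by (cases "\<eta> (x - y) = 0") auto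
    qed
    ultimately have "(LINT y|lebesgue. ((u y * indicator S' y) *\<^sub>R \<Gamma> (x - y)) \<bullet> i) = (LINT y|lebesgue. (\<eta> (x - y) *\<^sub>R g y) \<bullet> i)"
      by simp
    then show "(LINT y|lebesgue. (u y * indicator S' y) *\<^sub>R \<Gamma> (x - y)) \<bullet> i = (LINT y|lebesgue. \<eta> (x - y) *\<^sub>R g y) \<bullet> i"
      using integral_inner_left[OF IW, of i] integral_inner_left[OF IV, of i] by (simp only:)
  qed
  moreover have "norm (LINT y|lebesgue. \<eta> (x - y) *\<^sub>R g y) \<le> (LINT y|lebesgue. norm (\<eta> (x - y) *\<^sub>R g y))"
    by (rule integral_norm_bound)
  ultimately have le_s: "norm (LINT y|lebesgue. (u y * indicator S' y) *\<^sub>R \<Gamma> (x - y)) \<le> s"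
    using \<eta>0 by (simp add: s_def)
  define X where "X = (\<integral>\<^sup>+y. (ennreal (norm (g y) powr p) * indicator D y) * ennreal (\<eta> (x - y)) \<partial>lebesgue)"
  have s0: "0 \<le> s" unfolding s_def using \<eta>0 by (intro integral_nonneg_AE) auto
  have Xm: "(\<lambda>y. ennreal (norm (g y) powr p) * ennreal (\<eta> (x - y))) \<in> borel_measurable lebesgue"
    using gm \<eta>m by measurable
  have X_eq: "X = (\<integral>\<^sup>+y. ennreal (norm (g y) powr p) * ennreal (\<eta> (x - y)) \<partial>lebesgue)"
    unfolding X_def
  proof (rule nn_integral_cong)
    fix y show "(ennreal (norm (g y) powr p) * indicator D y) * ennreal (\<eta> (x - y)) = ennreal (norm (g y) powr p) * ennreal (\<eta> (x - y))"
      using inD[of y] by (cases "\<eta> (x - y) = 0") auto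
  qed
  have "ennreal (s powr p) \<le> X"
  proof (cases "s = 0")
    case False
    then have s: "0 < s" using s0 by simp
    \<comment> \<open>The left side is p s^p. The tangent inequality returns (p - 1) s^p on the
      right, and s^p remains after cancellation.\<close>
    have "ennreal (p * s powr (p - 1)) * ennreal s = (\<integral>\<^sup>+y. ennreal (p * s powr (p - 1)) * ennreal (\<eta> (x - y) * norm (g y)) \<partial>lebesgue)"
      using Im \<eta>0 by (subst nn_integral_cmult) (auto simp: s_def nn_integral_eq_integral)
    also have "\<dots> \<le> (\<integral>\<^sup>+y. ennreal (norm (g y) powr p) * ennreal (\<eta> (x - y)) + ennreal ((p - 1) * s powr p) * ennreal (\<eta> (x - y)) \<partial>lebesgue)"
    proof (rule nn_integral_mono)
      fix y
      have "(p * s powr (p - 1) * norm (g y)) * \<eta> (x - y) \<le> (norm (g y) powr p + (p - 1) * s powr p) * \<eta> (x - y)"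
        using powr_tangent[OF p s] \<eta>0 by (intro mult_right_mono) auto
      then have "ennreal ((p * s powr (p - 1) * norm (g y)) * \<eta> (x - y)) \<le> ennreal ((norm (g y) powr p + (p - 1) * s powr p) * \<eta> (x - y))"
        by (rule ennreal_leI)
      moreover have "ennreal ((norm (g y) powr p + (p - 1) * s powr p) * \<eta> (x - y)) = ennreal (norm (g y) powr p) * ennreal (\<eta> (x - y)) + ennreal ((p - 1) * s powr p) * ennreal (\<eta> (x - y))"
        using p \<eta>0 by (simp add: ennreal_mult ennreal_plus distrib_right)
      moreover have "ennreal ((p * s powr (p - 1) * norm (g y)) * \<eta> (x - y)) = ennreal (p * s powr (p - 1)) * ennreal (\<eta> (x - y) * norm (g y))"
        using p \<eta>0 by (simp add: ennreal_mult'[symmetric] mult_ac)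
      ultimately show "ennreal (p * s powr (p - 1)) * ennreal (\<eta> (x - y) * norm (g y)) \<le> ennreal (norm (g y) powr p) * ennreal (\<eta> (x - y)) + ennreal ((p - 1) * s powr p) * ennreal (\<eta> (x - y))"
        by simp
    qed
    also have "\<dots> = X + ennreal ((p - 1) * s powr p) * (\<integral>\<^sup>+y. ennreal (\<eta> (x - y)) \<partial>lebesgue)"
      using Xm \<eta>m by (simp add: nn_integral_add nn_integral_cmult X_eq)
    also have "\<dots> = X + ennreal ((p - 1) * s powr p)" using mollifier_integral(1)[OF m] by simp
    finally have le: "ennreal (p * s powr (p - 1)) * ennreal s \<le> X + ennreal ((p - 1) * s powr p)" .
    have "ennreal (p * s powr (p - 1)) * ennreal s = ennreal (p * s powr p)"
      using p s by (simp add: ennreal_mult'[symmetric] powr_diff)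
    also have "p * s powr p = s powr p + (p - 1) * s powr p" by (simp add: algebra_simps)
    also have "ennreal \<dots> = ennreal (s powr p) + ennreal ((p - 1) * s powr p)" using p by (intro ennreal_plus) auto
    finally show ?thesis using le by (simp add: ennreal_add_left_cancel_le add.commute)
  qed simp
  moreover have "ennreal (norm (LINT y|lebesgue. (u y * indicator S' y) *\<^sub>R \<Gamma> (x - y)) powr p) \<le> ennreal (s powr p)"
    using le_s p by (intro ennreal_leI powr_mono2) auto
  ultimately show ?thesis unfolding X_def by (rule order_trans[rotated])
qed

text \<open>Clamping \<open>u\<close> to [-k, k] costs little in the mean. The continuous functions
  converging to \<open>u\<close> almost everywhere are clamped likewise and cut to the ball, so that
  2 k on a set of finite measure is a majorant for dominated convergence. The cut-off stays outside
  \<open>v\<close> in order that \<open>v\<close> itself be continuous.\<close>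

lemma L1_approx_continuous:
  fixes u :: "'a::euclidean_space \<Rightarrow> real"
  assumes u: "integrable lebesgue u" and supp: "\<And>x. x \<notin> cball 0 M \<Longrightarrow> u x = 0" and \<epsilon>: "0 < \<epsilon>"
  shows "\<exists>v. continuous_on UNIV v \<and>
    (\<integral>\<^sup>+x. ennreal \<bar>u x - v x * indicator (cball 0 M) x\<bar> \<partial>lebesgue) < ennreal \<epsilon>"
proof -
  let ?T = "cball (0::'a) M"
  have um: "u \<in> borel_measurable lebesgue" using u by simp
  define cl where "cl k y = max (- real k) (min (real k) y)" for k and y :: real
  have clc: "continuous_on UNIV (cl k)" for k unfolding cl_def by (intro continuous_intros)
  then have clm: "cl k \<in> borel_measurable borel" for k by (rule borel_measurable_continuous_onI)
  have "(\<lambda>k. LINT x|lebesgue. \<bar>u x - cl k (u x)\<bar>) \<longlonglongrightarrow> (LINT x::'a|lebesgue. 0)"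
  proof (rule integral_dominated_convergence[where w="\<lambda>x. \<bar>u x\<bar>"])
    show "AE x in lebesgue. (\<lambda>k. \<bar>u x - cl k (u x)\<bar>) \<longlonglongrightarrow> 0"
    proof (rule AE_I2)
      fix x
      obtain K where "\<bar>u x\<bar> \<le> real K" using real_arch_simple by blast
      then have "\<bar>u x - cl k (u x)\<bar> = 0" if "K \<le> k" for k using that by (auto simp: cl_def)
      then have "\<forall>\<^sub>F k in sequentially. \<bar>u x - cl k (u x)\<bar> = 0" by (auto simp: eventually_sequentially)
      then show "(\<lambda>k. \<bar>u x - cl k (u x)\<bar>) \<longlonglongrightarrow> 0" by (rule tendsto_eventually)
    qed
    show "AE x in lebesgue. norm \<bar>u x - cl k (u x)\<bar> \<le> \<bar>u x\<bar>" for k by (intro AE_I2) (auto simp: cl_def)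
  qed (use u um measurable_compose[OF um clm] in auto)
  then have "\<forall>\<^sub>F k in sequentially. (LINT x|lebesgue. \<bar>u x - cl k (u x)\<bar>) < \<epsilon> / 2"
    using \<epsilon> by (intro order_tendstoD(2)) auto
  then obtain k where k: "(LINT x|lebesgue. \<bar>u x - cl k (u x)\<bar>) < \<epsilon> / 2" by (auto simp: eventually_sequentially)
  have "u measurable_on UNIV" using um by (intro lebesgue_measurable_imp_measurable_on) auto
  then obtain N h where N: "negligible N" and h: "\<And>n. continuous_on UNIV (h n)" and lim: "\<And>x. x \<notin> N \<Longrightarrow> (\<lambda>n. h n x) \<longlonglongrightarrow> u x"
    unfolding measurable_on_def by auto
  have hm: "(\<lambda>x. cl k (h n x)) \<in> borel_measurable lebesgue" for n
    by (intro measurable_compose[OF _ clm] measurable_completion) (use borel_measurable_continuous_onI[OF h] in simp)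
  have clu: "cl k (u x) = cl k (u x) * indicator ?T x" for x using supp[of x] by (auto simp: indicator_def cl_def)
  have IT: "integrable lebesgue (indicator ?T :: 'a \<Rightarrow> real)"
    using emeasure_bounded_finite[OF bounded_cball, of "0::'a" M] by (intro integrable_real_indicator) auto
  have Ih: "integrable lebesgue (\<lambda>x. cl k (h n x) * indicator ?T x)" for n
  proof (rule Bochner_Integration.integrable_bound)
    show "integrable lebesgue (\<lambda>x. real k * indicator ?T x)" using IT by simp
    show "AE x in lebesgue. norm (cl k (h n x) * indicator ?T x) \<le> norm (real k * indicator ?T x)"
      by (intro AE_I2) (auto simp: indicator_def cl_def)
  qed (use hm borel_measurable_integrable[OF IT] in \<open>auto intro!: borel_measurable_times\<close>)
  have "(\<lambda>n. LINT x|lebesgue. \<bar>cl k (u x) - cl k (h n x) * indicator ?T x\<bar>) \<longlonglongrightarrow> (LINT x::'a|lebesgue. 0)"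
  proof (rule integral_dominated_convergence[where w="\<lambda>x. 2 * real k * indicator ?T x"])
    have "N \<in> null_sets lebesgue" using N by (simp add: negligible_iff_null_sets)
    then have "AE x in lebesgue. x \<notin> N" by (rule AE_not_in)
    then show "AE x in lebesgue. (\<lambda>n. \<bar>cl k (u x) - cl k (h n x) * indicator ?T x\<bar>) \<longlonglongrightarrow> 0"
    proof eventually_elim
      case (elim x)
      have "(\<lambda>n. cl k (h n x)) \<longlonglongrightarrow> cl k (u x)"
        by (rule continuous_on_tendsto_compose[OF clc lim[OF elim]]) auto
      then have "(\<lambda>n. \<bar>cl k (u x) - cl k (h n x) * indicator ?T x\<bar>) \<longlonglongrightarrow> \<bar>cl k (u x) - cl k (u x) * indicator ?T x\<bar>"
        by (intro tendsto_intros)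
      then show ?case using clu[of x] by simp
    qed
    show "AE x in lebesgue. norm \<bar>cl k (u x) - cl k (h n x) * indicator ?T x\<bar> \<le> 2 * real k * indicator ?T x" for n
      by (intro AE_I2, subst clu) (auto simp: indicator_def cl_def)
    show "integrable lebesgue (\<lambda>x. 2 * real k * indicator ?T x)" using IT by simp
  qed (use hm measurable_compose[OF um clm] borel_measurable_integrable[OF IT] in \<open>auto intro!: borel_measurable_times borel_measurable_diff borel_measurable_abs\<close>)
  then have "\<forall>\<^sub>F n in sequentially. (LINT x|lebesgue. \<bar>cl k (u x) - cl k (h n x) * indicator ?T x\<bar>) < \<epsilon> / 2"
    using \<epsilon> by (intro order_tendstoD(2)) auto
  then obtain n where n: "(LINT x|lebesgue. \<bar>cl k (u x) - cl k (h n x) * indicator ?T x\<bar>) < \<epsilon> / 2" by (auto simp: eventually_sequentially)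
  have Iclu: "integrable lebesgue (\<lambda>x. cl k (u x))"
    by (rule Bochner_Integration.integrable_bound[OF u measurable_compose[OF um clm]]) (auto simp: cl_def)
  have "(LINT x|lebesgue. \<bar>u x - cl k (h n x) * indicator ?T x\<bar>) \<le> (LINT x|lebesgue. \<bar>u x - cl k (u x)\<bar> + \<bar>cl k (u x) - cl k (h n x) * indicator ?T x\<bar>)"
    by (intro integral_mono integrable_abs Bochner_Integration.integrable_add Bochner_Integration.integrable_diff u Ih Iclu) linarith
  also have "\<dots> = (LINT x|lebesgue. \<bar>u x - cl k (u x)\<bar>) + (LINT x|lebesgue. \<bar>cl k (u x) - cl k (h n x) * indicator ?T x\<bar>)"
    by (intro Bochner_Integration.integral_add integrable_abs Bochner_Integration.integrable_diff u Ih Iclu)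
  also have "\<dots> < \<epsilon>" using k n by linarith
  finally have "ennreal (LINT x|lebesgue. \<bar>u x - cl k (h n x) * indicator ?T x\<bar>) < ennreal \<epsilon>"
    using \<epsilon> by (intro ennreal_lessI)
  moreover have "(\<integral>\<^sup>+x. ennreal \<bar>u x - cl k (h n x) * indicator ?T x\<bar> \<partial>lebesgue) = ennreal (LINT x|lebesgue. \<bar>u x - cl k (h n x) * indicator ?T x\<bar>)"
    by (intro nn_integral_eq_integral integrable_abs Bochner_Integration.integrable_diff u Ih) auto
  ultimately have "(\<integral>\<^sup>+x. ennreal \<bar>u x - cl k (h n x) * indicator ?T x\<bar> \<partial>lebesgue) < ennreal \<epsilon>"
    by simp
  moreover have "continuous_on UNIV (\<lambda>x. cl k (h n x))"
    by (intro continuous_on_compose2[OF clc] h) auto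
  ultimately show ?thesis by blast
qed


lemma mollify_L1:
  fixes u :: "'a::euclidean_space \<Rightarrow> real"
  assumes u: "integrable lebesgue u" and supp: "\<And>x. x \<notin> cball 0 M \<Longrightarrow> u x = 0" and \<epsilon>: "0 < \<epsilon>"
  shows "\<exists>e0>0. \<forall>e \<eta> \<Gamma>. e \<le> e0 \<and> mollifier e \<eta> \<Gamma> \<longrightarrow>
    (\<integral>\<^sup>+x\<in>cball 0 (M - 1). ennreal \<bar>(LINT y|lebesgue. u y * \<eta> (x - y)) - u x\<bar> \<partial>lebesgue) \<le> ennreal \<epsilon>"
proof -
  let ?T = "cball (0::'a) M" and ?Q = "cball (0::'a) (M - 1)"
  define \<tau> where "\<tau> = measure lborel ?T"
  have \<tau>: "emeasure lborel ?T = ennreal \<tau>" "0 \<le> \<tau>"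
    using emeasure_bounded_finite[OF bounded_cball, of "0::'a" M] by (auto simp: \<tau>_def emeasure_eq_ennreal_measure)
  \<comment> \<open>The error consists of |u - v| on the ball and of its mollification, each with
    integral at most \<delta>, and of the oscillation of v, at most \<delta> on a set of measure
    \<tau>.\<close>
  define \<delta> where "\<delta> = \<epsilon> / (2 + \<tau>)"
  have \<delta>: "0 < \<delta>" "\<delta> * (2 + \<tau>) = \<epsilon>" using \<epsilon> \<tau> by (auto simp: \<delta>_def)
  obtain v where v: "continuous_on UNIV v" and close: "(\<integral>\<^sup>+x. ennreal \<bar>u x - v x * indicator ?T x\<bar> \<partial>lebesgue) < ennreal \<delta>"
    using L1_approx_continuous[OF u supp \<delta>(1)] by blast
  define k where "k x = ennreal \<bar>u x - v x * indicator ?T x\<bar>" for x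
  have vm: "v \<in> borel_measurable lebesgue" using borel_measurable_continuous_onI[OF v] by (intro measurable_completion) simp
  have um: "u \<in> borel_measurable lebesgue" using u by simp
  have km: "k \<in> borel_measurable lebesgue" 
  proof -
    have im: "(indicator ?T :: 'a \<Rightarrow> real) \<in> borel_measurable lebesgue" by (intro borel_measurable_indicator) auto
    show ?thesis unfolding k_def
      by (intro measurable_compose[OF _ measurable_ennreal] borel_measurable_abs borel_measurable_diff borel_measurable_times um vm im)
  qed
  have "uniformly_continuous_on ?T v" by (intro compact_uniformly_continuous continuous_on_subset[OF v]) auto
  then obtain d where d: "0 < d" "\<And>x y. x \<in> ?T \<Longrightarrow> y \<in> ?T \<Longrightarrow> dist y x < d \<Longrightarrow> dist (v y) (v x) < \<delta>"
    using \<delta> unfolding uniformly_continuous_on_def by meson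
  \<comment> \<open>With x in the ball of radius M - 1 and e \<le> 1, all y at which
    \<open>\<eta>\<close> (x - y) does not vanish stay in the ball on which v is uniformly
    continuous.\<close>
  have main: "(\<integral>\<^sup>+x\<in>?Q. ennreal \<bar>(LINT y|lebesgue. u y * \<eta> (x - y)) - u x\<bar> \<partial>lebesgue) \<le> ennreal \<epsilon>"
    if e: "e \<le> min 1 d" and m: "mollifier e \<eta> \<Gamma>" for e \<eta> and \<Gamma> :: "'a \<Rightarrow> 'a"
  proof -
    have C: "C1_gradient \<eta> \<Gamma>" and z: "\<And>z. e \<le> norm z \<Longrightarrow> \<eta> z = 0" and \<eta>0: "\<And>z. 0 \<le> \<eta> z"
      using m by (auto simp: mollifier_def)
    have \<eta>m: "(\<lambda>y. \<eta> (x - y)) \<in> borel_measurable lebesgue" for x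
      by (intro measurable_lebesgue_reflect borel_measurable_continuous_onI C1_gradient_continuous[OF C])
    have Iu: "integrable lebesgue (\<lambda>y. u y * \<eta> (x - y))" for x
      using integrable_convolution[OF u C1_gradient_continuous[OF C] z] by simp
    have pt: "ennreal \<bar>(LINT y|lebesgue. u y * \<eta> (x - y)) - u x\<bar> * indicator ?Q x \<le>
      (\<integral>\<^sup>+y. k y * ennreal (\<eta> (x - y)) \<partial>lebesgue) + (ennreal \<delta> * indicator ?T x + k x)" for x
    proof (cases "x \<in> ?Q")
      case True
      then have xT: "x \<in> ?T" by simp
      have Ic: "integrable lebesgue (\<lambda>y. v x * \<eta> (x - y))" using mollifier_integral(2)[OF m] by simp
      have "(LINT y|lebesgue. u y * \<eta> (x - y)) - v x = (LINT y|lebesgue. u y * \<eta> (x - y) - v x * \<eta> (x - y))"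
        using mollifier_integral(3)[OF m] by (simp add: Bochner_Integration.integral_diff[OF Iu Ic])
      then have "ennreal \<bar>(LINT y|lebesgue. u y * \<eta> (x - y)) - v x\<bar> = ennreal (norm (LINT y|lebesgue. u y * \<eta> (x - y) - v x * \<eta> (x - y)))"
        by simp
      also have "\<dots> \<le> (\<integral>\<^sup>+y. norm (u y * \<eta> (x - y) - v x * \<eta> (x - y)) \<partial>lebesgue)"
        by (intro integral_norm_bound_ennreal Bochner_Integration.integrable_diff Iu Ic)
      also have "\<dots> \<le> (\<integral>\<^sup>+y. k y * ennreal (\<eta> (x - y)) + ennreal \<delta> * ennreal (\<eta> (x - y)) \<partial>lebesgue)"
      proof (rule nn_integral_mono)
        fix y
        have "\<bar>u y - v x\<bar> * \<eta> (x - y) \<le> (\<bar>u y - v y * indicator ?T y\<bar> + \<delta>) * \<eta> (x - y)"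
        proof (cases "\<eta> (x - y) = 0")
          case False
          then have xy: "norm (x - y) < e" using z[of "x - y"] by (meson not_le)
          have "norm y \<le> norm x + norm (x - y)" using norm_triangle_ineq2[of y x] by (simp add: norm_minus_commute)
          then have yT: "y \<in> ?T" using True xy e by auto
          have "dist (v y) (v x) < \<delta>" using xy e by (intro d(2)[OF xT yT]) (simp add: dist_norm norm_minus_commute)
          then show ?thesis using yT \<eta>0 by (intro mult_right_mono) (auto simp: dist_real_def)
        qed simp
        then have "norm (u y * \<eta> (x - y) - v x * \<eta> (x - y)) \<le> (\<bar>u y - v y * indicator ?T y\<bar> + \<delta>) * \<eta> (x - y)"
          using \<eta>0 by (simp flip: left_diff_distrib add: abs_mult)
        then have "ennreal (norm (u y * \<eta> (x - y) - v x * \<eta> (x - y))) \<le> ennreal ((\<bar>u y - v y * indicator ?T y\<bar> + \<delta>) * \<eta> (x - y))"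
          by (rule ennreal_leI)
        also have "\<dots> = k y * ennreal (\<eta> (x - y)) + ennreal \<delta> * ennreal (\<eta> (x - y))"
          using \<delta> \<eta>0 by (simp only: k_def distrib_right) (simp add: ennreal_mult)
        finally show "ennreal (norm (u y * \<eta> (x - y) - v x * \<eta> (x - y))) \<le> k y * ennreal (\<eta> (x - y)) + ennreal \<delta> * ennreal (\<eta> (x - y))" .
      qed
      also have "\<dots> = (\<integral>\<^sup>+y. k y * ennreal (\<eta> (x - y)) \<partial>lebesgue) + ennreal \<delta> * (\<integral>\<^sup>+y. ennreal (\<eta> (x - y)) \<partial>lebesgue)"
        using km \<eta>m by (simp add: nn_integral_add nn_integral_cmult)
      also have "\<dots> = (\<integral>\<^sup>+y. k y * ennreal (\<eta> (x - y)) \<partial>lebesgue) + ennreal \<delta>"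
        using mollifier_integral(1)[OF m] by simp
      finally have 1: "ennreal \<bar>(LINT y|lebesgue. u y * \<eta> (x - y)) - v x\<bar> \<le> (\<integral>\<^sup>+y. k y * ennreal (\<eta> (x - y)) \<partial>lebesgue) + ennreal \<delta>" .
      have "ennreal \<bar>(LINT y|lebesgue. u y * \<eta> (x - y)) - u x\<bar> \<le> ennreal (\<bar>(LINT y|lebesgue. u y * \<eta> (x - y)) - v x\<bar> + \<bar>u x - v x\<bar>)"
        by (intro ennreal_leI) linarith
      also have "\<dots> = ennreal \<bar>(LINT y|lebesgue. u y * \<eta> (x - y)) - v x\<bar> + k x" using xT by (simp add: k_def)
      also have "\<dots> \<le> ((\<integral>\<^sup>+y. k y * ennreal (\<eta> (x - y)) \<partial>lebesgue) + ennreal \<delta>) + k x" by (intro add_mono 1 order.refl)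
      finally show ?thesis using True xT by (simp add: add.assoc)
    qed simp
    have cm: "(\<lambda>x. \<integral>\<^sup>+y. k y * ennreal (\<eta> (x - y)) \<partial>lebesgue) \<in> borel_measurable lebesgue"
      using nn_integral_convolution(2)[OF m km] by (intro measurable_completion) simp
    have Tm: "(\<lambda>x. ennreal \<delta> * indicator ?T x) \<in> borel_measurable lebesgue"
      by (intro borel_measurable_times_ennreal borel_measurable_indicator) auto
    have "(\<integral>\<^sup>+x\<in>?Q. ennreal \<bar>(LINT y|lebesgue. u y * \<eta> (x - y)) - u x\<bar> \<partial>lebesgue)
      \<le> (\<integral>\<^sup>+x. (\<integral>\<^sup>+y. k y * ennreal (\<eta> (x - y)) \<partial>lebesgue) + (ennreal \<delta> * indicator ?T x + k x) \<partial>lebesgue)"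
      by (rule nn_integral_mono) (rule pt)
    also have "\<dots> = (\<integral>\<^sup>+x. (\<integral>\<^sup>+y. k y * ennreal (\<eta> (x - y)) \<partial>lebesgue) \<partial>lebesgue) + (\<integral>\<^sup>+x. ennreal \<delta> * indicator ?T x + k x \<partial>lebesgue)"
      using cm km Tm by (intro nn_integral_add borel_measurable_add)
    also have "(\<integral>\<^sup>+x. ennreal \<delta> * indicator ?T x + k x \<partial>lebesgue) = ennreal \<delta> * emeasure lebesgue ?T + (\<integral>\<^sup>+x. k x \<partial>lebesgue)"
      by (subst nn_integral_add[OF Tm km]) (simp add: nn_integral_cmult_indicator)
    also have "(\<integral>\<^sup>+x. (\<integral>\<^sup>+y. k y * ennreal (\<eta> (x - y)) \<partial>lebesgue) \<partial>lebesgue) = (\<integral>\<^sup>+x. k x \<partial>lebesgue)"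
      using nn_integral_convolution(1)[OF m km] by (simp only: nn_integral_completion)
    also have "(\<integral>\<^sup>+x. k x \<partial>lebesgue) + (ennreal \<delta> * emeasure lebesgue ?T + (\<integral>\<^sup>+x. k x \<partial>lebesgue)) \<le> ennreal \<delta> + (ennreal \<delta> * ennreal \<tau> + ennreal \<delta>)"
      using close \<tau> by (intro add_mono mult_left_mono) (auto simp: k_def less_imp_le)
    also have "\<dots> = ennreal (\<delta> + (\<delta> * \<tau> + \<delta>))" using \<delta> \<tau>
      by (simp add: ennreal_mult'[symmetric] ennreal_plus[symmetric] del: ennreal_plus)
    also have "\<delta> + (\<delta> * \<tau> + \<delta>) = \<epsilon>" using \<delta>(2) by (simp add: algebra_simps)
    finally show ?thesis .
  qed
  show ?thesis
    by (rule exI[of _ "min 1 d"]) (use main d(1) in auto)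
qed

text \<open>The intermediate set S' gives the margin. Cut to S', \<open>u\<close> is integrable on
  the whole space and its convolution is defined everywhere, while for x in \<open>S\<close> and
  small e the kernel sees only points of S', where the cut changes nothing.\<close>

lemma ex_mollified_sequence:
  fixes u :: "'a::euclidean_space \<Rightarrow> real"
  assumes D: "open D" and wg: "weak_gradient D u g" and p: "1 \<le> p"
    and S: "bounded S" "closure S \<subseteq> S'" "open S'" "bounded S'" "closure S' \<subseteq> D" and um: "u \<in> borel_measurable lebesgue"
  shows "\<exists>w W. (\<forall>k::nat. C1_gradient (w k) (W k)) \<and>
    (\<forall>k. (\<integral>\<^sup>+x\<in>S. ennreal (norm (W k x) powr p) \<partial>lborel) \<le> (\<integral>\<^sup>+y\<in>D. ennreal (norm (g y) powr p) \<partial>lebesgue)) \<and>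
    (AE x in lebesgue. x \<in> S \<longrightarrow> (\<lambda>k. w k x) \<longlonglongrightarrow> u x)"
proof -
  let ?I = "\<integral>\<^sup>+y\<in>D. ennreal (norm (g y) powr p) \<partial>lebesgue"
  define u0 where "u0 y = u y * indicator S' y" for y
  have S'D: "S' \<subseteq> D" using S closure_subset by blast
  have "compact (closure S')" using S by (simp add: compact_closure)
  then have "set_integrable lebesgue (closure S') u" using wg S by (simp add: weak_gradient_def locally_integrable_def)
  then have "set_integrable lebesgue S' u"
    by (rule set_integrable_subset) (use S closure_subset in auto)
  then have u0: "integrable lebesgue u0" by (simp add: set_integrable_def u0_def[abs_def] mult.commute)
  obtain M where M: "\<And>x. x \<in> S' \<Longrightarrow> norm x \<le> M - 1"
    using S(4) by (metis bounded_iff add_diff_cancel_right')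
  have supp: "u0 x = 0" if "x \<notin> cball 0 M" for x using M[of x] that by (auto simp: u0_def indicator_def)
  have "compact (closure S)" using S by (simp add: compact_closure)
  then obtain e1 where e1: "0 < e1" "(\<Union>x\<in>closure S. ball x e1) \<subseteq> S'"
    using compact_subset_open_imp_ball_epsilon_subset[of "closure S" S'] S by blast
  have ex: "\<forall>k. \<exists>t :: real \<times> ('a \<Rightarrow> real) \<times> ('a \<Rightarrow> 'a). fst t < e1 \<and> mollifier (fst t) (fst (snd t)) (snd (snd t)) \<and>
    (\<integral>\<^sup>+x\<in>cball 0 (M - 1). ennreal \<bar>(LINT y|lebesgue. u0 y * fst (snd t) (x - y)) - u0 x\<bar> \<partial>lebesgue) \<le> ennreal (inverse (real (Suc k)))"
    (is "\<forall>k. ?P k")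
  proof
    fix k
    obtain e0 where e0: "0 < e0" "\<forall>e \<eta> (\<Gamma> :: 'a \<Rightarrow> 'a). e \<le> e0 \<and> mollifier e \<eta> \<Gamma> \<longrightarrow>
      (\<integral>\<^sup>+x\<in>cball 0 (M - 1). ennreal \<bar>(LINT y|lebesgue. u0 y * \<eta> (x - y)) - u0 x\<bar> \<partial>lebesgue) \<le> ennreal (inverse (real (Suc k)))"
      using mollify_L1[OF u0 supp, of M "inverse (real (Suc k))"] by auto
    define e where "e = min e0 (e1 / 2)"
    have "0 < e" "e \<le> e0" "e < e1" using e0 e1 by (auto simp: e_def)
    moreover obtain \<eta> and \<Gamma> :: "'a \<Rightarrow> 'a" where "mollifier e \<eta> \<Gamma>" using ex_mollifier[OF \<open>0 < e\<close>] by blast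
    ultimately show "?P k" using e0(2) by (intro exI[of _ "(e, \<eta>, \<Gamma>)"]) auto
  qed
  from choice[OF ex] obtain t :: "nat \<Rightarrow> real \<times> ('a \<Rightarrow> real) \<times> ('a \<Rightarrow> 'a)" where
    t: "\<forall>k. fst (t k) < e1 \<and> mollifier (fst (t k)) (fst (snd (t k))) (snd (snd (t k))) \<and>
    (\<integral>\<^sup>+x\<in>cball 0 (M - 1). ennreal \<bar>(LINT y|lebesgue. u0 y * fst (snd (t k)) (x - y)) - u0 x\<bar> \<partial>lebesgue) \<le> ennreal (inverse (real (Suc k)))"
    by blast
  define e where "e k = fst (t k)" for k
  define \<eta> where "\<eta> k = fst (snd (t k))" for k
  define \<Gamma> where "\<Gamma> k = snd (snd (t k))" for k
  have e: "e k < e1" and m: "mollifier (e k) (\<eta> k) (\<Gamma> k)" and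
    L1: "(\<integral>\<^sup>+x\<in>cball 0 (M - 1). ennreal \<bar>(LINT y|lebesgue. u0 y * \<eta> k (x - y)) - u0 x\<bar> \<partial>lebesgue) \<le> ennreal (inverse (real (Suc k)))" for k
    using t by (auto simp: e_def \<eta>_def \<Gamma>_def)
  define w where "w k x = (LINT y|lebesgue. u0 y * \<eta> k (x - y))" for k x
  define W where "W k x = (LINT y|lebesgue. u0 y *\<^sub>R \<Gamma> k (x - y))" for k x
  have C1: "C1_gradient (w k) (W k)" for k
    unfolding w_def[abs_def] W_def[abs_def] by (rule convolution_C1[OF m u0])
  have grad: "(\<integral>\<^sup>+x\<in>S. ennreal (norm (W k x) powr p) \<partial>lborel) \<le> ?I" for k
  proof -
    have "g \<in> borel_measurable lebesgue" using wg by (simp add: weak_gradient_def)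
    moreover have "D \<in> sets lebesgue" using D by simp
    ultimately have Jm: "(\<lambda>y. ennreal (norm (g y) powr p) * indicator D y) \<in> borel_measurable lebesgue" by measurable
    have "(\<integral>\<^sup>+x\<in>S. ennreal (norm (W k x) powr p) \<partial>lborel)
      \<le> (\<integral>\<^sup>+x. (\<integral>\<^sup>+y. (ennreal (norm (g y) powr p) * indicator D y) * ennreal (\<eta> k (x - y)) \<partial>lebesgue) \<partial>lborel)"
    proof (rule nn_integral_mono)
      fix x
      show "ennreal (norm (W k x) powr p) * indicator S x \<le> (\<integral>\<^sup>+y. (ennreal (norm (g y) powr p) * indicator D y) * ennreal (\<eta> k (x - y)) \<partial>lebesgue)"
      proof (cases "x \<in> S")
        case True
        then have "x \<in> closure S" using closure_subset by blast
        then have "ball x e1 \<subseteq> S'" using e1(2) by blast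
        moreover have "cball x (e k) \<subseteq> ball x e1" using e[of k] by auto
        ultimately have "cball x (e k) \<subseteq> S'" by blast
        from convolution_gradient_bound[OF m wg p this S'D u0[unfolded u0_def]]
        show ?thesis using True by (simp add: W_def u0_def)
      qed simp
    qed
    also have "\<dots> = ?I" by (rule nn_integral_convolution(1)[OF m Jm])
    finally show ?thesis .
  qed
  let ?Q = "cball (0::'a) (M - 1)"
  \<comment> \<open>S' lies in the ball of radius M - 1, so on \<open>S\<close> this is the true
    error. Its convergence to 0 in the mean yields almost everywhere convergence along a
    subsequence.\<close>
  define f where "f k x = (w k x - u0 x) * indicator ?Q x" for k x
  have im: "(indicator ?Q :: 'a \<Rightarrow> real) \<in> borel_measurable lebesgue" by (intro borel_measurable_indicator) auto
  have wm: "w k \<in> borel_measurable lebesgue" for k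
    using borel_measurable_continuous_onI[OF C1_gradient_continuous[OF C1[of k]]] by (intro measurable_completion) simp
  have fm: "f k \<in> borel_measurable lebesgue" for k
    unfolding f_def by (intro borel_measurable_times borel_measurable_diff wm im borel_measurable_integrable[OF u0])
  have nf: "(\<integral>\<^sup>+x. ennreal (norm (f k x)) \<partial>lebesgue) \<le> ennreal (inverse (real (Suc k)))" for k
  proof -
    have "(\<integral>\<^sup>+x. ennreal (norm (f k x)) \<partial>lebesgue) = (\<integral>\<^sup>+x\<in>?Q. ennreal \<bar>w k x - u0 x\<bar> \<partial>lebesgue)"
      by (intro nn_integral_cong) (auto simp: f_def indicator_def)
    then show ?thesis using L1[of k] by (simp add: w_def)
  qed
  have fi: "integrable lebesgue (f k)" for k
    using nf[of k] by (intro integrableI_bounded fm) (auto intro: le_less_trans)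
  have "(\<lambda>k. LINT x|lebesgue. norm (f k x)) \<longlonglongrightarrow> 0"
  proof (rule tendsto_sandwich[OF _ _ tendsto_const LIMSEQ_inverse_real_of_nat])
    show "\<forall>\<^sub>F k in sequentially. 0 \<le> (LINT x|lebesgue. norm (f k x))"
      by (intro always_eventually allI integral_nonneg_AE) auto
    have "(LINT x|lebesgue. norm (f k x)) \<le> inverse (real (Suc k))" for k
    proof -
      have "ennreal (LINT x|lebesgue. norm (f k x)) \<le> ennreal (inverse (real (Suc k)))"
        using nf[of k] fi[of k] by (subst nn_integral_eq_integral[symmetric]) auto
      then show ?thesis by (subst (asm) ennreal_le_iff) auto
    qed
    then show "\<forall>\<^sub>F k in sequentially. (LINT x|lebesgue. norm (f k x)) \<le> inverse (real (Suc k))"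
      by (intro always_eventually allI)
  qed
  then have "\<exists>r. strict_mono r \<and> (AE x in lebesgue. (\<lambda>k. f (r k) x) \<longlonglongrightarrow> 0)"
    by (rule tendsto_L1_AE_subseq[OF fi])
  then obtain r :: "nat \<Rightarrow> nat" where ae: "AE x in lebesgue. (\<lambda>k. f (r k) x) \<longlonglongrightarrow> 0"
    by blast
  have "AE x in lebesgue. x \<in> S \<longrightarrow> (\<lambda>k. w (r k) x) \<longlonglongrightarrow> u x"
    using ae
  proof eventually_elim
    case (elim x)
    show ?case
    proof
      assume "x \<in> S"
      then have "x \<in> S'" using S(2) closure_subset by blast
      then have "f k x = w k x - u x" for k using M[of x] by (simp add: f_def u0_def)
      then show "(\<lambda>k. w (r k) x) \<longlonglongrightarrow> u x" using elim by (simp add: LIM_zero_cancel)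
    qed
  qed
  then show ?thesis using C1 grad by (intro exI[of _ "\<lambda>k. w (r k)"] exI[of _ "\<lambda>k. W (r k)"]) auto
qed

section \<open>Passage to the limit\<close>


text \<open>Fatou's lemma along a subsequence on which the constants converge in the extended reals.\<close>
lemma orlicz_bound_limit:
  fixes H :: "real \<Rightarrow> real" and v :: "nat \<Rightarrow> 'a::euclidean_space \<Rightarrow> real"
  assumes Hc: "continuous_on {0..} H" and Htop: "filterlim H at_top at_top" and C: "0 < C"
    and v: "\<And>k. v k \<in> borel_measurable lebesgue" and S: "\<And>k. S k \<in> sets lebesgue" "incseq S"
    and S0: "0 < emeasure lebesgue (S 0)"
    and lim: "AE x in lebesgue. x \<in> (\<Union>k. S k) \<longrightarrow> (\<lambda>k. v k x) \<longlonglongrightarrow> u x"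
    and le: "\<And>k. (\<integral>\<^sup>+x\<in>S k. ennreal (H (\<bar>v k x - b k\<bar> / C)) \<partial>lebesgue) \<le> 1"
  shows "\<exists>b. (\<integral>\<^sup>+x\<in>(\<Union>k. S k). ennreal (H (\<bar>u x - b\<bar> / C)) \<partial>lebesgue) \<le> 1"
proof -
  \<comment> \<open>No bound on the constants is known in advance; compactness of the extended reals
    still provides a limit, which may be infinite.\<close>
  obtain l r where r: "strict_mono r" and l: "((\<lambda>k. ereal (b k)) \<circ> r) \<longlonglongrightarrow> l"
    using compact_complete_linorder by blast
  have Hm: "(\<lambda>t. H (\<bar>t\<bar> / C)) \<in> borel_measurable borel"
    using C by (intro borel_measurable_continuous_onI continuous_on_compose2[OF Hc] continuous_intros) auto
  define h where "h k x = ennreal (H (\<bar>v (r k) x - b (r k)\<bar> / C)) * indicator (S (r k)) x" for k x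
  have hm: "h k \<in> borel_measurable lebesgue" for k
    unfolding h_def using S(1) v
    by (intro borel_measurable_times_ennreal measurable_compose[OF _ measurable_ennreal] measurable_compose[OF _ Hm]) auto
  have "(\<integral>\<^sup>+x. liminf (\<lambda>k. h k x) \<partial>lebesgue) \<le> liminf (\<lambda>k. \<integral>\<^sup>+x. h k x \<partial>lebesgue)"
    by (rule nn_integral_liminf[OF hm])
  also have "\<dots> \<le> liminf (\<lambda>k. 1)" using le by (intro Liminf_mono always_eventually) (simp add: h_def)
  finally have fatou: "(\<integral>\<^sup>+x. liminf (\<lambda>k. h k x) \<partial>lebesgue) \<le> 1" by (simp add: Liminf_const)
  have rev: "\<forall>\<^sub>F k in sequentially. x \<in> S (r k)" if "x \<in> (\<Union>k. S k)" for x
  proof -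
    obtain j where j: "x \<in> S j" using \<open>x \<in> (\<Union>k. S k)\<close> by blast
    have "x \<in> S (r k)" if "j \<le> k" for k
      using j incseqD[OF S(2), of j "r k"] seq_suble[OF r, of k] that by auto
    then show ?thesis by (auto simp: eventually_sequentially)
  qed
  have limr: "AE x in lebesgue. x \<in> (\<Union>k. S k) \<longrightarrow> (\<lambda>k. v (r k) x) \<longlonglongrightarrow> u x"
    using lim by eventually_elim (auto dest: LIMSEQ_subseq_LIMSEQ[OF _ r] simp: comp_def)
  show ?thesis
  proof (cases "\<bar>l\<bar> = \<infinity>")
    case False
    then obtain b0 where b0: "l = ereal b0" by (cases l) auto
    then have bl: "(\<lambda>k. b (r k)) \<longlonglongrightarrow> b0" using l by (simp add: comp_def)
    have "(\<integral>\<^sup>+x\<in>(\<Union>k. S k). ennreal (H (\<bar>u x - b0\<bar> / C)) \<partial>lebesgue) \<le> (\<integral>\<^sup>+x. liminf (\<lambda>k. h k x) \<partial>lebesgue)"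
    proof (rule nn_integral_mono_AE)
      show "AE x in lebesgue. ennreal (H (\<bar>u x - b0\<bar> / C)) * indicator (\<Union>k. S k) x \<le> liminf (\<lambda>k. h k x)"
        using limr
      proof eventually_elim
        case (elim x)
        show ?case
        proof (cases "x \<in> (\<Union>k. S k)")
          case True
          have "(\<lambda>k. \<bar>v (r k) x - b (r k)\<bar> / C) \<longlonglongrightarrow> \<bar>u x - b0\<bar> / C"
            using elim True bl C by (intro tendsto_intros) auto
          then have "(\<lambda>k. H (\<bar>v (r k) x - b (r k)\<bar> / C)) \<longlonglongrightarrow> H (\<bar>u x - b0\<bar> / C)"
            using C by (intro continuous_on_tendsto_compose[OF Hc]) auto
          then have "(\<lambda>k. ennreal (H (\<bar>v (r k) x - b (r k)\<bar> / C))) \<longlonglongrightarrow> ennreal (H (\<bar>u x - b0\<bar> / C))" by (intro tendsto_intros)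
          moreover have "\<forall>\<^sub>F k in sequentially. ennreal (H (\<bar>v (r k) x - b (r k)\<bar> / C)) = h k x"
            using rev[OF True] by eventually_elim (simp add: h_def)
          ultimately have "(\<lambda>k. h k x) \<longlonglongrightarrow> ennreal (H (\<bar>u x - b0\<bar> / C))"
            by (rule Lim_transform_eventually)
          then show ?thesis using True by (simp add: lim_imp_Liminf)
        qed simp
      qed
    qed
    then show ?thesis using fatou order_trans by blast
  next
    case True
    \<comment> \<open>If |b| tended to infinity, the integrand would tend to infinity almost
      everywhere on \<open>S 0\<close>. As that set has positive measure, this contradicts the bound
      1 from Fatou's lemma.\<close>
    have babs: "filterlim (\<lambda>k. \<bar>b (r k)\<bar>) at_top sequentially"
    proof (cases "l = \<infinity>")
      case True
      then have "filterlim (\<lambda>k. b (r k)) at_top sequentially" using l by (simp add: comp_def tendsto_PInfty_eq_at_top)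
      then show ?thesis by (rule filterlim_at_top_mono) (auto intro!: always_eventually)
    next
      case False
      then have "l = -\<infinity>" using \<open>\<bar>l\<bar> = \<infinity>\<close> by (cases l) auto
      then have "(\<lambda>k. ereal (- b (r k))) \<longlonglongrightarrow> \<infinity>"
        using tendsto_uminus_ereal[OF l] by (simp add: comp_def)
      then have "filterlim (\<lambda>k. - b (r k)) at_top sequentially" by (simp add: tendsto_PInfty_eq_at_top)
      then show ?thesis by (rule filterlim_at_top_mono) (auto intro!: always_eventually)
    qed
    have "(\<integral>\<^sup>+x. \<infinity> * indicator (S 0) x \<partial>lebesgue) \<le> (\<integral>\<^sup>+x. liminf (\<lambda>k. h k x) \<partial>lebesgue)"
    proof (rule nn_integral_mono_AE)
      show "AE x in lebesgue. \<infinity> * indicator (S 0) x \<le> liminf (\<lambda>k. h k x)"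
        using limr
      proof eventually_elim
        case (elim x)
        show ?case
        proof (cases "x \<in> S 0")
          case True
          then have xU: "x \<in> (\<Union>k. S k)" by blast
          with elim have vl: "(\<lambda>k. v (r k) x) \<longlonglongrightarrow> u x" by simp
          have "\<forall>\<^sub>F k in sequentially. \<bar>v (r k) x - u x\<bar> < 1"
            using tendstoD[OF vl, of 1] by (simp add: dist_real_def)
          then have ev: "\<forall>\<^sub>F k in sequentially. - (\<bar>u x\<bar> + 1) + \<bar>b (r k)\<bar> \<le> \<bar>v (r k) x - b (r k)\<bar>"
            by eventually_elim linarith
          have "filterlim (\<lambda>k. - (\<bar>u x\<bar> + 1) + \<bar>b (r k)\<bar>) at_top sequentially"
            by (rule filterlim_tendsto_add_at_top[OF tendsto_const babs])
          then have "filterlim (\<lambda>k. \<bar>v (r k) x - b (r k)\<bar>) at_top sequentially"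
            using ev by (rule filterlim_at_top_mono)
          then have "filterlim (\<lambda>k. 1 / C * \<bar>v (r k) x - b (r k)\<bar>) at_top sequentially"
            using C by (intro filterlim_tendsto_pos_mult_at_top[OF tendsto_const]) auto
          then have "filterlim (\<lambda>k. H (\<bar>v (r k) x - b (r k)\<bar> / C)) at_top sequentially"
            by (intro filterlim_compose[OF Htop]) simp
          then have "(\<lambda>k. ennreal (H (\<bar>v (r k) x - b (r k)\<bar> / C))) \<longlonglongrightarrow> top" 
            by (simp add: ennreal_tendsto_top_eq_at_top)
          moreover have "\<forall>\<^sub>F k in sequentially. ennreal (H (\<bar>v (r k) x - b (r k)\<bar> / C)) = h k x"
            using rev[OF xU] by eventually_elim (simp add: h_def)
          ultimately have "(\<lambda>k. h k x) \<longlonglongrightarrow> top"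
            by (rule Lim_transform_eventually)
          then show ?thesis by (simp add: lim_imp_Liminf)
        qed simp
      qed
    qed
    also have "\<dots> \<le> 1" by (rule fatou)
    finally have "\<infinity> * emeasure lebesgue (S 0) \<le> 1" using S(1) by (simp add: nn_integral_cmult_indicator)
    then show ?thesis using S0 by (simp add: ennreal_top_mult top_unique split: if_splits)
  qed
qed

section \<open>The exhausted domain\<close>


text \<open>Both ratio conditions survive the gluing at 1: from there on \<psi>(t)/t is constant and
  t^\<alpha>/\<psi>(t) equals t^(\<alpha>-1)/\<phi>(1), which is nondecreasing as \<alpha> \<ge> 1.
  Read as inequalities between c s and s, the two conditions are the scaling assumptions of the
  locale.\<close>

lemma psi_orlicz_growth:
  assumes n2: "2 \<le> n" and p: "1 \<le> p" "p < real n" and phi: "phi_cond1 \<phi>"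
    and a: "1 \<le> \<alpha>" "\<alpha> < real n / (real n - 1)" and mono: "mono_on {0<..} (\<lambda>t. t powr \<alpha> / \<phi> t)"
  shows "orlicz_growth (psi \<phi>) \<alpha> p (\<phi> 1) n"
proof -
  have c: "continuous_on {0..} \<phi>" and sm: "strict_mono_on {0..} \<phi>" and z: "\<phi> 0 = 0"
    and r: "\<And>s t. 0 < s \<Longrightarrow> s \<le> t \<Longrightarrow> \<phi> s / s \<le> \<phi> t / t"
    using phi by (auto simp: phi_cond1_def)
  have pos: "0 < \<phi> s" if "0 < s" for s using strict_mono_onD[OF sm, of 0 s] that z by simp
  have psi_pos: "0 < psi \<phi> s" if "0 < s" for s using pos[of s] pos[of 1] that by (simp add: psi_def)
  have ratio: "psi \<phi> s / s \<le> psi \<phi> t / t" if "0 < s" "s \<le> t" for s t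
    using r[of s t] r[of s 1] that by (auto simp: psi_def)
  have ratio\<alpha>: "s powr \<alpha> / psi \<phi> s \<le> t powr \<alpha> / psi \<phi> t" if st: "0 < s" "s \<le> t" for s t
  proof -
    have big: "x powr \<alpha> / psi \<phi> x = x powr (\<alpha> - 1) / \<phi> 1" if "1 \<le> x" for x
      using that by (auto simp: psi_def powr_diff)
    consider "t \<le> 1" | "s \<le> 1" "1 \<le> t" | "1 \<le> s" by linarith
    then show ?thesis
    proof cases
      case 1 then show ?thesis using mono_onD[OF mono, of s t] st by (simp add: psi_def)
    next
      case 2
      have "s powr \<alpha> / psi \<phi> s \<le> 1 / \<phi> 1" using mono_onD[OF mono, of s 1] st 2 by (simp add: psi_def)
      also have "\<dots> \<le> t powr (\<alpha> - 1) / \<phi> 1"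
        using 2 a pos[of 1] by (intro divide_right_mono) (auto simp: ge_one_powr_ge_zero)
      finally show ?thesis using big[of t] 2 by simp
    next
      case 3
      then show ?thesis using big[of s] big[of t] st a pos[of 1]
        by (auto intro!: divide_right_mono powr_mono2)
    qed
  qed
  show ?thesis
  proof
    show "2 \<le> n" "1 \<le> p" "p < real n" "1 \<le> \<alpha>" by fact+
    show "\<alpha> * (real n - 1) < real n" using a n2 by (simp add: field_simps)
    show "0 < psi \<phi> s" if "0 < s" for s by (rule psi_pos[OF that])
    show "continuous_on {0<..} (psi \<phi>)"
      unfolding psi_def[abs_def]
      by (rule continuous_on_cases_le) (auto intro!: continuous_intros continuous_on_subset[OF c])
    fix c s :: real assume cs: "0 < c" "c \<le> 1" "0 < s"
    then have le: "0 < c * s" "c * s \<le> s" by (auto simp: mult_left_le_one_le)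
    show "psi \<phi> (c * s) \<le> c * psi \<phi> s"
      using ratio[OF le] cs by (simp add: field_simps)
    show "c powr \<alpha> * psi \<phi> s \<le> psi \<phi> (c * s)"
      using ratio\<alpha>[OF le] cs psi_pos[of s] psi_pos[of "c * s"] by (simp add: powr_mult field_simps)
  next
    fix s :: real assume s: "0 < s"
    show "psi \<phi> s \<le> \<phi> 1 * s"
      using r[of s 1] s by (auto simp: psi_def field_simps)
  qed
qed

theorem mainTheorem7:
  fixes \<phi> :: "real \<Rightarrow> real"
    and p :: real
    and D :: "'a::euclidean_space set"
    and Dseq :: "nat \<Rightarrow> 'a set"
    and cJ :: real
  assumes n2: "DIM('a) \<ge> 2"
    and p: "1 \<le> p" "p < real DIM('a)"
    and phi: "phi_cond1 \<phi>"
    and alpha: "\<exists>\<alpha>. 1 \<le> \<alpha> \<and> \<alpha> < real DIM('a) / (real DIM('a) - 1) \<and>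
                  mono_on {0<..} (\<lambda>t. t powr \<alpha> / \<phi> t)"
    and D: "open D" "connected D" "\<not> bounded D"
    and Dunion: "D = (\<Union>i. Dseq i)"
    and Dpos: "emeasure lebesgue (Dseq 0) > 0"
    and Dincr: "\<And>i. closure (Dseq i) \<subseteq> Dseq (Suc i)"
    and Dj: "\<And>i. open (Dseq i) \<and> connected (Dseq i) \<and> bounded (Dseq i) \<and> cigar_john \<phi> cJ (Dseq i)"
  shows "\<exists>H. N_function H \<and> Delta2 H \<and>
           (\<exists>c1 c2. c1 > 0 \<and> c2 > 0 \<and>
              (\<forall>t>0. c1 * (t powr (1 / p - 1) / psi \<phi> (t powr (- 1 / real DIM('a))) ^ (DIM('a) - 1))
                        \<le> inv_into {0..} H t \<and>
                      inv_into {0..} H t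
                        \<le> c2 * (t powr (1 / p - 1) / psi \<phi> (t powr (- 1 / real DIM('a))) ^ (DIM('a) - 1)))) \<and>
           (\<exists>C\<ge>0. \<forall>u g. sobolev_L1p p D u g \<longrightarrow>
              (INF b. luxemburg_norm H D (\<lambda>x. u x - b)) \<le> ennreal (C * Lp_norm_grad p D g))"
proof -
  obtain \<alpha> where \<alpha>: "1 \<le> \<alpha>" "\<alpha> < real DIM('a) / (real DIM('a) - 1)" "mono_on {0<..} (\<lambda>t. t powr \<alpha> / \<phi> t)"
    using alpha by blast
  interpret og: orlicz_growth "psi \<phi>" \<alpha> p "\<phi> 1" "DIM('a)"
    by (rule psi_orlicz_growth[OF n2 p phi \<alpha>])
  have cJ: "0 < cJ" using Dj[of 0] by (simp add: cigar_john_def)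
  \<comment> \<open>One constant for all bounded open cigar John sets with \<open>cJ\<close>, in
    particular the same one for every \<open>Dseq i\<close>.\<close>
  obtain C where C: "0 < C" and smooth: "\<forall>(U :: 'a set) f g A. C1_gradient f g \<and> open U \<and> bounded U \<and> cigar_john \<phi> cJ U \<and> 0 < A \<and>
     (\<integral>\<^sup>+w\<in>U. ennreal (norm (g w) powr p) \<partial>lborel) \<le> ennreal (A powr p) \<longrightarrow>
     (\<exists>b. (\<integral>\<^sup>+x\<in>U. ennreal (og.H (\<bar>f x - b\<bar> / (C * A))) \<partial>lborel) \<le> 1)"
    using og.smooth_orlicz_sobolev[OF refl refl cJ] by (elim exE conjE) (rule that; assumption)
  have Htop: "filterlim og.H at_top at_top"
  proof (rule filterlim_at_top_mono[OF og.H_over_at_top])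
    show "\<forall>\<^sub>F t in at_top. og.H t / t \<le> og.H t"
      using eventually_ge_at_top[of 1]
    proof eventually_elim
      case (elim t)
      then show ?case using og.H_nonneg[of t] mult_left_mono[of 1 t "og.H t"] by (simp add: field_simps)
    qed
  qed
  have inc: "incseq Dseq"
    unfolding incseq_Suc_iff using Dincr closure_subset by blast
  have Dm: "Dseq i \<in> sets lebesgue" for i using Dj[of i] by simp
  have Dipos: "0 < emeasure lebesgue (Dseq i)" for i
    using Dpos emeasure_mono[OF incseqD[OF inc, of 0 i] Dm] by (simp add: less_le_trans)
  \<comment> \<open>The limit lemma is used twice: on a fixed \<open>Dseq i\<close> for mollified
    functions, where the set is constant, and for \<open>u\<close> itself on the growing sets, where
    the function is constant.\<close>
  have bound: "\<exists>b. (\<integral>\<^sup>+x\<in>D. ennreal (og.H (\<bar>u x - b\<bar> / (C * A))) \<partial>lebesgue) \<le> 1"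
    if wg: "weak_gradient D u g" and um: "u \<in> borel_measurable lebesgue" and A: "0 < A"
      and int: "(\<integral>\<^sup>+y\<in>D. ennreal (norm (g y) powr p) \<partial>lebesgue) \<le> ennreal (A powr p)" for u g A
  proof -
    have CA: "0 < C * A" using C A by simp
    have "\<exists>b. (\<integral>\<^sup>+x\<in>Dseq i. ennreal (og.H (\<bar>u x - b\<bar> / (C * A))) \<partial>lebesgue) \<le> 1" for i
    proof -
      \<comment> \<open>The next member of the exhaustion serves as the intermediate set for the
        mollification on \<open>Dseq i\<close>.\<close>
      have "closure (Dseq (Suc i)) \<subseteq> D" using Dincr[of "Suc i"] Dunion by blast
      then have "\<exists>w W. (\<forall>k::nat. C1_gradient (w k) (W k)) \<and>
        (\<forall>k. (\<integral>\<^sup>+x\<in>Dseq i. ennreal (norm (W k x) powr p) \<partial>lborel) \<le> (\<integral>\<^sup>+y\<in>D. ennreal (norm (g y) powr p) \<partial>lebesgue)) \<and>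
        (AE x in lebesgue. x \<in> Dseq i \<longrightarrow> (\<lambda>k. w k x) \<longlonglongrightarrow> u x)"
        using Dj[of i] Dj[of "Suc i"] by (intro ex_mollified_sequence[OF D(1) wg p(1) _ Dincr] um) auto
      then obtain w W where w: "\<And>k::nat. C1_gradient (w k) (W k)"
        and W: "\<And>k. (\<integral>\<^sup>+x\<in>Dseq i. ennreal (norm (W k x) powr p) \<partial>lborel) \<le> (\<integral>\<^sup>+y\<in>D. ennreal (norm (g y) powr p) \<partial>lebesgue)"
        and lim: "AE x in lebesgue. x \<in> Dseq i \<longrightarrow> (\<lambda>k. w k x) \<longlonglongrightarrow> u x" by blast
      have ex: "\<forall>k. \<exists>b. (\<integral>\<^sup>+x\<in>Dseq i. ennreal (og.H (\<bar>w k x - b\<bar> / (C * A))) \<partial>lebesgue) \<le> 1"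
      proof
        fix k
        have "\<exists>b. (\<integral>\<^sup>+x\<in>Dseq i. ennreal (og.H (\<bar>w k x - b\<bar> / (C * A))) \<partial>lborel) \<le> 1"
          using smooth[rule_format, of "w k" "W k" "Dseq i" A] w[of k] Dj[of i] A order_trans[OF W[of k] int] by blast
        then show "\<exists>b. (\<integral>\<^sup>+x\<in>Dseq i. ennreal (og.H (\<bar>w k x - b\<bar> / (C * A))) \<partial>lebesgue) \<le> 1"
          by (simp only: nn_integral_completion)
      qed
      from choice[OF ex] obtain b where b: "\<forall>k. (\<integral>\<^sup>+x\<in>Dseq i. ennreal (og.H (\<bar>w k x - b k\<bar> / (C * A))) \<partial>lebesgue) \<le> 1"
        by blast
      have wm: "w k \<in> borel_measurable lebesgue" for k
        using borel_measurable_continuous_onI[OF C1_gradient_continuous[OF w[of k]]] by (intro measurable_completion) simp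
      have "\<exists>b. (\<integral>\<^sup>+x\<in>(\<Union>k::nat. Dseq i). ennreal (og.H (\<bar>u x - b\<bar> / (C * A))) \<partial>lebesgue) \<le> 1"
        by (rule orlicz_bound_limit[OF og.H_continuous Htop CA wm, where b=b]) (use Dm Dipos lim b in \<open>auto simp: incseq_def\<close>)
      then show ?thesis by simp
    qed
    then have ex: "\<forall>i. \<exists>b. (\<integral>\<^sup>+x\<in>Dseq i. ennreal (og.H (\<bar>u x - b\<bar> / (C * A))) \<partial>lebesgue) \<le> 1" by blast
    from choice[OF ex] obtain b where b: "\<forall>i. (\<integral>\<^sup>+x\<in>Dseq i. ennreal (og.H (\<bar>u x - b i\<bar> / (C * A))) \<partial>lebesgue) \<le> 1"
      by blast
    show ?thesis
      unfolding Dunion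
      by (rule orlicz_bound_limit[OF og.H_continuous Htop CA, where v="\<lambda>_. u" and b=b]) (use Dm Dpos inc um b in auto)
  qed
  have sob: "(INF b. luxemburg_norm og.H D (\<lambda>x. u x - b)) \<le> ennreal (C * Lp_norm_grad p D g)"
    if S: "sobolev_L1p p D u g" for u g
  proof -
    have um: "u \<in> borel_measurable lebesgue" and wg: "weak_gradient D u g"
      and gi: "set_integrable lebesgue D (\<lambda>x. norm (g x) powr p)" using S by (auto simp: sobolev_L1p_def)
    define I where "I = (LINT x:D|lebesgue. norm (g x) powr p)"
    define N where "N = Lp_norm_grad p D g"
    have I0: "0 \<le> I" unfolding I_def set_lebesgue_integral_def by (intro integral_nonneg_AE) auto
    have N: "N = I powr (1 / p)" by (simp add: N_def Lp_norm_grad_def I_def)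
    have N0: "0 \<le> N" by (simp add: N)
    have Np: "N powr p = I" using I0 p by (simp add: N powr_powr)
    have "(\<integral>\<^sup>+y\<in>D. ennreal (norm (g y) powr p) \<partial>lebesgue) = (\<integral>\<^sup>+y. ennreal (indicator D y *\<^sub>R (norm (g y) powr p)) \<partial>lebesgue)"
      by (intro nn_integral_cong) (auto simp: indicator_def)
    also have "\<dots> = ennreal I"
      using gi unfolding I_def set_lebesgue_integral_def set_integrable_def by (intro nn_integral_eq_integral) auto
    finally have int: "(\<integral>\<^sup>+y\<in>D. ennreal (norm (g y) powr p) \<partial>lebesgue) = ennreal I" .
    \<comment> \<open>A is taken strictly above the norm because the smooth estimate asks for A > 0
      and the norm may be zero; A then decreases to \<open>N\<close>.\<close>
    have le: "(INF b. luxemburg_norm og.H D (\<lambda>x. u x - b)) \<le> ennreal (C * A)" if A: "N < A" for A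
    proof -
      have "I \<le> A powr p" unfolding Np[symmetric] using A N0 p by (intro powr_mono2) auto
      then have "(\<integral>\<^sup>+y\<in>D. ennreal (norm (g y) powr p) \<partial>lebesgue) \<le> ennreal (A powr p)" unfolding int by (rule ennreal_leI)
      then obtain b where b: "(\<integral>\<^sup>+x\<in>D. ennreal (og.H (\<bar>u x - b\<bar> / (C * A))) \<partial>lebesgue) \<le> 1"
        using bound[OF wg um] A N0 by (meson le_less_trans)
      have "(INF b. luxemburg_norm og.H D (\<lambda>x. u x - b)) \<le> luxemburg_norm og.H D (\<lambda>x. u x - b)"
        by (rule INF_lower) simp
      also have "\<dots> \<le> ennreal (C * A)"
        unfolding luxemburg_norm_def using b C A N0 by (intro Inf_lower) auto
      finally show ?thesis .
    qed
    have "(\<lambda>k. ennreal (C * (N + inverse (real (Suc k))))) \<longlonglongrightarrow> ennreal (C * (N + 0))"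
      by (intro tendsto_intros LIMSEQ_inverse_real_of_nat)
    then have "(INF b. luxemburg_norm og.H D (\<lambda>x. u x - b)) \<le> ennreal (C * (N + 0))"
      by (rule LIMSEQ_le_const) (use le in auto)
    then show ?thesis by (simp add: N_def)
  qed
  show ?thesis
  proof (intro exI[of _ og.H] conjI og.H_N_function og.H_Delta2)
    show "\<exists>c1 c2. c1 > 0 \<and> c2 > 0 \<and>
              (\<forall>t>0. c1 * (t powr (1 / p - 1) / psi \<phi> (t powr (- 1 / real DIM('a))) ^ (DIM('a) - 1))
                        \<le> inv_into {0..} og.H t \<and>
                      inv_into {0..} og.H t
                        \<le> c2 * (t powr (1 / p - 1) / psi \<phi> (t powr (- 1 / real DIM('a))) ^ (DIM('a) - 1)))"
      using og.H_inverse_bounds unfolding og.F_def by (intro exI[of _ 1] exI[of _ 2]) auto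
    show "\<exists>C\<ge>0. \<forall>u g. sobolev_L1p p D u g \<longrightarrow>
              (INF b. luxemburg_norm og.H D (\<lambda>x. u x - b)) \<le> ennreal (C * Lp_norm_grad p D g)"
      using sob C by (intro exI[of _ C]) auto
  qed
qed

end
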